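(* (Second Recurrence Theorem for $\leq_1$) Let $\rho$ be an additively indecomposable ordinal. For any ordinal $\beta$, if $\rho\cdot\omega^\beta<\theta_1$ then $$max_1(\kappa_{\rho\cdot\omega^\beta})=\kappa_{\rho\cdot\omega^\beta}+max_1(\kappa_\beta).$$
   Context: $ORD$ is the class of ordinals with its usual order and arithmetic; intervals are intervals of ordinals. $\rho$ is a fixed additively indecomposable ordinal (nonzero and closed under addition; $\rho=1$ is allowed). An ordinal $\beta$ is divisible by (a multiple of) $\alpha$ if $\beta=\alpha\cdot\delta$ for some $\delta$. For $\xi<\rho$ define $f_\xi:ORD\to ORD$ by $f_\xi(\rho\cdot\zeta)=\rho\cdot\zeta+\xi$ and $f_\xi(\rho\cdot\zeta+\epsilon)=\rho\cdot\zeta$ if $0<\epsilon<\rho$. A set $X$ of ordinals is closed if $\sigma\in X$ whenever $\sigma$ is divisible by $\rho$ and $\sigma+\xi\in X$ for some $\xi<\rho$. For sets of ordinals, $X<Y$ means $x<y$ for all $x\in X$, $y\in Y$. Binary relations $\leq_1,\leq_2$ on $ORD$ are defined by recursion on the larger argument $\beta$ as below. A covering of a closed set $X$ is a strictly increasing $h:X\to ORD$ such that for all $x,y\in X$: $f_\xi(x)=y$ iff $f_\xi(h(x))=h(y)$ for every $\xi<\rho$; and $x\leq_k y$ implies $h(x)\leq_k h(y)$ for $k=1,2$. A set $Z$ is a covering of $X$ if it is the range of a covering of $X$. "Cofinally many $\tilde Y$ below $\alpha$" with a property means: for every $\gamma<\alpha$ there is such a finite $\tilde Y\subseteq(\gamma,\alpha)$.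 (i) $\alpha\leq_1\beta$ iff $\alpha\leq\beta$ and for all finite $X\subseteq\alpha$ and finite $Y\subseteq[\alpha,\beta)$ with $X\cup Y$ closed there is a finite $\tilde Y\subseteq\alpha$ with $X<\tilde Y$ such that $X\cup\tilde Y$ is a covering of $X\cup Y$. (ii) $\alpha\leq_2\beta$ iff $\alpha\leq\beta$ and both of the following hold. (Up, written $\alpha\leq_2\uparrow\beta$) For all finite $X,Y\subseteq\alpha$ with $X\cup Y$ closed and $X<Y$: if there are cofinally many $\tilde Y$ below $\alpha$ such that $X\cup\tilde Y$ is a covering of $X\cup Y$, then there are cofinally many $\tilde Y$ below $\beta$ such that $X\cup\tilde Y$ is a covering of $X\cup Y$. (Down, written $\alpha\leq_2\downarrow\beta$) For all finite $X\subseteq\alpha$ and finite $Y\subseteq[\alpha,\beta)$ with $X\cup Y$ closed there is a finite $\tilde Y\subseteq\alpha$ with $X<\tilde Y$ such that $X\cup\tilde Y$ is a covering of $X\cup Y$ and, for every $i$ less than the cardinality of $Y$, if the $i$-th element of $Y$ is $\leq_1\beta$ then the $i$-th element of $\tilde Y$ is $\leq_1\alpha$. $\alpha<_k\beta$ means $\alpha\leq_k\beta$ and $\alpha\neq\beta$. $max_k(\alpha)$ is the largest $\beta$ with $\alpha\leq_k\beta$ if the set of such $\beta$ is bounded, and $max_k(\alpha)=\infty$ otherwise (every ordinal is $<\infty$, and an ordinal plus $\infty$ is $\infty$). $(\kappa_\alpha)_{\alpha<\theta_1}$ is the increasing enumeration of all ordinals which are minimal with respect to $\leq_1$ (those $\kappa$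 with no $\xi<_1\kappa$); $\theta_1$ is an ordinal, or $\infty$ if there is a proper class of them. *)

theory Defs
  imports "HOL-Library.Infinite_Typeclass"
begin

section \<open>The class of ordinals\<close>

text \<open>
  HOL has no type of all ordinals.  \<open>ORD\<close> is rendered as an arbitrary type whose elements are the
  ordinals: it is well-ordered, satisfies the axiom of replacement (the image of an ordinal, i.e. of
  an initial segment, under any function to ordinals is bounded), and contains a limit ordinal.
  Up to isomorphism such a type is a regular uncountable initial segment of the ordinals, and it is
  closed under all operations used below.  Statements are about all types of the class; instances
  with arbitrarily many elements are given by the ordinals of cardinality at most that of an
  infinite type.
\<close>

class ordinals = wellorder +
  assumes replacement: "\<And>f a. \<exists>b. \<forall>x<a. f x < b"
    and infinity: "\<exists>l. (\<exists>x. x < l) \<and> (\<forall>x<l. \<exists>y<l. x < y)"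

unbundle cardinal_syntax

instantiation suc :: (type) wellorder
begin

definition less_eq_suc :: "'a suc \<Rightarrow> 'a suc \<Rightarrow> bool" where
  "x \<le> y \<longleftrightarrow> (x, y) \<in> card_suc |UNIV :: 'a set|"

definition less_suc :: "'a suc \<Rightarrow> 'a suc \<Rightarrow> bool" where
  "(x :: 'a suc) < y \<longleftrightarrow> x \<le> y \<and> x \<noteq> y"

instance
proof -
  let ?r = "card_suc |UNIV :: 'a set|"
  have "card_order ?r"
    by (rule card_order_card_suc) (rule card_of_card_order_on)
  then have wo: "well_order_on UNIV ?r"
    by (simp add: card_order_on_def)
  then have refl: "(x, x) \<in> ?r"
    and anti: "(x, y) \<in> ?r \<Longrightarrow> (y, x) \<in> ?r \<Longrightarrow> x = y"
    and trans: "(x, y) \<in> ?r \<Longrightarrow> (y, z) \<in> ?r \<Longrightarrow> (x, z) \<in> ?r"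
    and total: "(x, y) \<in> ?r \<or> (y, x) \<in> ?r" for x y z
    unfolding well_order_on_def linear_order_on_def partial_order_on_def preorder_on_def
      refl_on_def total_on_def antisym_def trans_def
    by (blast, blast, blast, metis UNIV_I)
  have wf: "wf (?r - Id)"
    using wo by (simp add: well_order_on_def)
  show "OFCLASS('a suc, wellorder_class)"
  proof
    fix x y z :: "'a suc"
    show "x < y \<longleftrightarrow> x \<le> y \<and> \<not> y \<le> x"
      unfolding less_suc_def less_eq_suc_def using refl anti by metis
    show "x \<le> x"
      unfolding less_eq_suc_def by (rule refl)
    show "x \<le> y \<Longrightarrow> y \<le> z \<Longrightarrow> x \<le> z"
      unfolding less_eq_suc_def by (rule trans)
    show "x \<le> y \<Longrightarrow> y \<le> x \<Longrightarrow> x = y"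
      unfolding less_eq_suc_def by (rule anti)
    show "x \<le> y \<or> y \<le> x"
      unfolding less_eq_suc_def by (rule total)
  next
    fix P :: "'a suc \<Rightarrow> bool" and a :: "'a suc"
    assume step: "\<And>x. (\<And>y. y < x \<Longrightarrow> P y) \<Longrightarrow> P x"
    show "P a"
      using wf
    proof (induction a rule: wf_induct_rule)
      case (less x)
      have "P y" if "y < x" for y
        using that by (intro less) (simp add: less_suc_def less_eq_suc_def)
      then show ?case by (rule step)
    qed
  qed
qed

end

instance suc :: (infinite) ordinals
proof
  let ?k = "|UNIV :: 'a::infinite set|"
  let ?r = "card_suc ?k"
  have co: "card_order ?k" by (rule card_of_card_order_on)
  have infU: "infinite (UNIV :: 'a::infinite set)" by (rule infinite_UNIV)
  have ci: "Cinfinite ?k"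
    unfolding cinfinite_def Field_card_of using infU co by simp
  have Co: "Card_order ?r" using co by (rule Card_order_card_suc)
  have reg: "regularCard ?r" using co ci by (rule regularCard_card_suc)
  have Fld: "Field ?r = UNIV" by (rule Field_card_suc)
  have inf: "\<not> finite (Field ?r)"
    using Cinfinite_card_suc[OF ci co] by (simp add: cinfinite_def)
  have seg: "|{..<a}| <o ?r" for a :: "'a::infinite suc"
  proof -
    have "underS ?r a = {..<a}"
      by (auto simp: underS_def less_suc_def less_eq_suc_def)
    then show ?thesis
      using card_of_underS[OF Co, of a] Fld by simp
  qed
  show "\<exists>b. \<forall>x<a. f x < b" for f :: "'a::infinite suc \<Rightarrow> 'a::infinite suc" and a
  proof (rule ccontr)
    assume "\<nexists>b. \<forall>x<a. f x < b"
    then have unb: "\<forall>b. \<exists>x<a. b \<le> f x"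
      by (meson not_le)
    have nomax: "\<exists>c. b < c" for b :: "'a::infinite suc"
      using infinite_Card_order_limit[OF Co inf, of b] Fld
      by (auto simp: less_suc_def less_eq_suc_def)
    have "cofinal (f ` {..<a}) ?r"
      unfolding cofinal_def Fld
    proof
      fix b :: "'a::infinite suc"
      obtain c where c: "b < c" using nomax by blast
      obtain x where "x < a" "c \<le> f x" using unb by blast
      with c have "b < f x" by simp
      then have "b \<noteq> f x \<and> (b, f x) \<in> ?r"
        by (simp add: less_suc_def less_eq_suc_def)
      then show "\<exists>y\<in>f ` {..<a}. b \<noteq> y \<and> (b, y) \<in> ?r"
        using \<open>x < a\<close> by blast
    qed
    then have "|f ` {..<a}| =o ?r"
      using reg Fld unfolding regularCard_def by blast
    moreover have "|f ` {..<a}| <o ?r"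
      using card_of_image[of f "{..<a}"] seg[of a] ordLeq_ordLess_trans by blast
    ultimately show False
      using not_ordLess_ordIso by blast
  qed
  show "\<exists>l :: 'a::infinite suc. (\<exists>x. x < l) \<and> (\<forall>x<l. \<exists>y<l. x < y)"
  proof -
    have "\<not> |UNIV :: 'a::infinite suc set| \<le>o ?k"
      using card_suc_greater[OF co] card_of_Field_ordIso[OF Co] Fld
      by (metis not_ordLess_ordLeq ordIso_ordLeq_trans ordIso_symmetric)
    have "\<exists>l :: 'a::infinite suc. infinite {..<l}"
    proof (rule ccontr)
      assume "\<nexists>l :: 'a::infinite suc. infinite {..<l}"
      then have fin: "finite {..<l}" for l :: "'a::infinite suc" by blast
      have "inj (\<lambda>l :: 'a::infinite suc. card {..<l})"
      proof (rule injI)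
        fix x y :: "'a::infinite suc"
        assume eq: "card {..<x} = card {..<y}"
        have lt: "card {..<u} < card {..<v}" if "u < v" for u v :: "'a::infinite suc"
          using that by (intro psubset_card_mono fin) auto
        show "x = y"
          using lt[of x y] lt[of y x] eq by (cases x y rule: linorder_cases) auto
      qed
      then have "|UNIV :: 'a::infinite suc set| \<le>o |UNIV :: nat set|"
        using card_of_ordLeq by blast
      also have "|UNIV :: nat set| \<le>o ?k"
        using infU infinite_iff_card_of_nat by blast
      finally show False
        using \<open>\<not> |UNIV :: 'a::infinite suc set| \<le>o ?k\<close> by simp
    qed
    then have inf_l: "infinite {..<(LEAST l :: 'a::infinite suc. infinite {..<l})}"
      by (rule LeastI_ex)
    define l :: "'a::infinite suc" where "l = (LEAST l. infinite {..<l})"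
    have l: "infinite {..<l}" using inf_l l_def by simp
    have fin: "finite {..<x}" if "x < l" for x
      using that not_less_Least unfolding l_def by blast
    have "\<exists>y<l. x < y" if "x < l" for x
    proof (rule ccontr)
      assume "\<not> (\<exists>y<l. x < y)"
      then have "{..<l} \<subseteq> insert x {..<x}" by auto
      then show False
        using fin[OF that] l by (meson finite.insertI finite_subset)
    qed
    moreover have "\<exists>x. x < l"
      using l by (metis finite.emptyI infinite_imp_nonempty lessThan_iff ex_in_conv)
    ultimately show ?thesis by blast
  qed
qed


unbundle no cardinal_syntax


section \<open>Ordinal arithmetic\<close>

definition ozero :: "'o::ordinals" where
  "ozero = (LEAST x. True)"

definition osucc :: "'o::ordinals \<Rightarrow> 'o" where
  "osucc a = (LEAST x. a < x)"

definition oone :: "'o::ordinals" where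
  "oone = osucc ozero"

definition olimit :: "'o::ordinals \<Rightarrow> bool" where
  "olimit l \<longleftrightarrow> ozero < l \<and> (\<forall>x<l. osucc x < l)"

definition omega :: "'o::ordinals" where
  "omega = (LEAST l. olimit l)"

text \<open>The recursions treat the zero, successor and limit cases uniformly:
  \<open>a + b = sup ({a} \<union> {(a + d) + 1 | d < b})\<close>, \<open>a \<cdot> b = sup {a \<cdot> d + a | d < b}\<close> and
  \<open>\<omega> ^ b = sup ({1} \<union> {\<omega> ^ d \<cdot> \<omega> | d < b})\<close>.  The usual equations are derived below.\<close>

function oadd :: "'o::ordinals \<Rightarrow> 'o \<Rightarrow> 'o"  (infixl "+\<^sub>o" 65) where
  "a +\<^sub>o b = (LEAST c. a \<le> c \<and> (\<forall>d<b. a +\<^sub>o d < c))"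
  by pat_completeness auto
termination
  by (relation "inv_image {(x, y). x < y} snd") (auto simp: wf)

declare oadd.simps [simp del]

function omult :: "'o::ordinals \<Rightarrow> 'o \<Rightarrow> 'o"  (infixl "*\<^sub>o" 70) where
  "a *\<^sub>o b = (LEAST c. \<forall>d<b. a *\<^sub>o d +\<^sub>o a \<le> c)"
  by pat_completeness auto
termination
  by (relation "inv_image {(x, y). x < y} snd") (auto simp: wf)

declare omult.simps [simp del]

function omega_pow :: "'o::ordinals \<Rightarrow> 'o" where
  "omega_pow b = (LEAST c. oone \<le> c \<and> (\<forall>d<b. omega_pow d *\<^sub>o omega \<le> c))"
  by pat_completeness auto
termination
  by (relation "{(x, y). x < y}") (auto simp: wf)

declare omega_pow.simps [simp del]

definition additively_indecomposable :: "'o::ordinals \<Rightarrow> bool" where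
  "additively_indecomposable r \<longleftrightarrow> r \<noteq> ozero \<and> (\<forall>a<r. \<forall>b<r. a +\<^sub>o b < r)"

definition odvd :: "'o::ordinals \<Rightarrow> 'o \<Rightarrow> bool"  (infix "dvd\<^sub>o" 50) where
  "a dvd\<^sub>o b \<longleftrightarrow> (\<exists>d. b = a *\<^sub>o d)"


subsection \<open>The usual equations\<close>

lemma ozero_least [simp]: "ozero \<le> (x :: 'o::ordinals)"
  unfolding ozero_def by (rule Least_le) simp

lemma ozero_not_less [simp]: "\<not> (x :: 'o::ordinals) < ozero"
  by (simp add: not_less)

lemma ordinals_unbounded: "\<exists>b. (a :: 'o::ordinals) < b"
  using infinity replacement[where f = "\<lambda>_. a"] by metis

lemma bounded_recursion: "\<exists>c. a \<le> c \<and> (\<forall>d<b. f d < c)" for a b :: "'o::ordinals"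
proof -
  obtain c where "\<forall>d<b. f d < c"
    using replacement[of b f] by blast
  then show ?thesis
    by (intro exI[of _ "max a c"]) (auto simp: less_max_iff_disj)
qed

lemma bounded_recursion_le: "\<exists>c. a \<le> c \<and> (\<forall>d<b. f d \<le> c)" for a b :: "'o::ordinals"
  using bounded_recursion[of a b f] less_imp_le by blast

lemma less_osucc_iff [simp]: "x < osucc a \<longleftrightarrow> x \<le> (a :: 'o::ordinals)"
proof
  show "x < osucc a \<Longrightarrow> x \<le> a"
    unfolding osucc_def using not_less_Least by (meson not_le)
  have "a < osucc a"
    unfolding osucc_def using ordinals_unbounded by (rule LeastI_ex)
  then show "x \<le> a \<Longrightarrow> x < osucc a" by simp
qed

lemma osucc_le_iff [simp]: "osucc a \<le> x \<longleftrightarrow> (a :: 'o::ordinals) < x"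
  by (meson less_osucc_iff not_le)

lemma oadd_le_iff: "a +\<^sub>o b \<le> c \<longleftrightarrow> a \<le> c \<and> (\<forall>d<b. a +\<^sub>o d < (c :: 'o::ordinals))"
proof -
  have "a \<le> a +\<^sub>o b \<and> (\<forall>d<b. a +\<^sub>o d < a +\<^sub>o b)"
    unfolding oadd.simps[of a b] by (rule LeastI_ex) (rule bounded_recursion)
  moreover have "a +\<^sub>o b \<le> c" if "a \<le> c \<and> (\<forall>d<b. a +\<^sub>o d < c)"
    unfolding oadd.simps[of a b] using that by (rule Least_le)
  ultimately show ?thesis
    by (meson order.trans order.strict_trans2)
qed

lemma omult_le_iff: "a *\<^sub>o b \<le> c \<longleftrightarrow> (\<forall>d<b. a *\<^sub>o d +\<^sub>o a \<le> (c :: 'o::ordinals))"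
proof -
  have "\<forall>d<b. a *\<^sub>o d +\<^sub>o a \<le> a *\<^sub>o b"
    unfolding omult.simps[of a b]
    by (rule LeastI_ex) (use bounded_recursion_le[of ozero] in simp)
  moreover have "a *\<^sub>o b \<le> c" if "\<forall>d<b. a *\<^sub>o d +\<^sub>o a \<le> c"
    unfolding omult.simps[of a b] using that by (rule Least_le)
  ultimately show ?thesis
    by (meson order.trans)
qed

lemma omega_pow_le_iff:
  "omega_pow b \<le> c \<longleftrightarrow> oone \<le> c \<and> (\<forall>d<b. omega_pow d *\<^sub>o omega \<le> (c :: 'o::ordinals))"
proof -
  let ?P = "\<lambda>c. oone \<le> c \<and> (\<forall>d<b. omega_pow d *\<^sub>o omega \<le> c)"
  have "?P (Least ?P)"
    by (rule LeastI_ex[of ?P]) (rule bounded_recursion_le)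
  then have "oone \<le> omega_pow b \<and> (\<forall>d<b. omega_pow d *\<^sub>o omega \<le> omega_pow b)"
    unfolding omega_pow.simps[of b, symmetric] .
  moreover have "omega_pow b \<le> c" if "oone \<le> c \<and> (\<forall>d<b. omega_pow d *\<^sub>o omega \<le> c)"
    unfolding omega_pow.simps[of b] using that by (rule Least_le)
  ultimately show ?thesis
    by (meson order.trans)
qed

lemma oadd_strict_mono: "b < c \<Longrightarrow> a +\<^sub>o b < a +\<^sub>o (c :: 'o::ordinals)"
  using oadd_le_iff[of a c "a +\<^sub>o c"] by simp

lemma oadd_less_iff [simp]: "a +\<^sub>o b < a +\<^sub>o c \<longleftrightarrow> b < (c :: 'o::ordinals)"
  by (metis less_asym linorder_neqE oadd_strict_mono)

lemma oadd_le_cancel [simp]: "a +\<^sub>o b \<le> a +\<^sub>o c \<longleftrightarrow> b \<le> (c :: 'o::ordinals)"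
  by (meson not_le oadd_less_iff)

lemma le_oadd: "a \<le> a +\<^sub>o (b :: 'o::ordinals)"
  using oadd_le_iff[of a b "a +\<^sub>o b"] by simp

lemma oadd_ozero [simp]: "a +\<^sub>o ozero = (a :: 'o::ordinals)"
  by (rule antisym) (auto simp: oadd_le_iff le_oadd)

lemma oadd_osucc: "a +\<^sub>o osucc b = osucc (a +\<^sub>o b :: 'o::ordinals)"
proof (rule antisym)
  have "a < osucc (a +\<^sub>o b)" by (simp add: le_oadd)
  then show "a +\<^sub>o osucc b \<le> osucc (a +\<^sub>o b)"
    by (simp add: oadd_le_iff[of a "osucc b"] less_imp_le)
qed simp

lemma olimitD: "olimit l \<Longrightarrow> x < l \<Longrightarrow> osucc x < l"
  by (simp add: olimit_def)

lemma oadd_olimit_le_iff: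
  assumes "olimit l"
  shows "a +\<^sub>o l \<le> c \<longleftrightarrow> (\<forall>d<l. a +\<^sub>o d \<le> (c :: 'o::ordinals))"
proof
  assume r: "\<forall>d<l. a +\<^sub>o d \<le> c"
  have "ozero < l"
    using assms by (simp add: olimit_def)
  then have "a \<le> c"
    using r[rule_format, of ozero] by simp
  moreover have "a +\<^sub>o d < c" if "d < l" for d
    using r[rule_format, OF olimitD[OF assms that]]
    by (rule order.strict_trans2[rotated]) simp
  ultimately show "a +\<^sub>o l \<le> c"
    by (simp add: oadd_le_iff)
qed (auto simp: oadd_le_iff)

lemma omult_mono: "b \<le> c \<Longrightarrow> a *\<^sub>o b \<le> a *\<^sub>o (c :: 'o::ordinals)"
  using omult_le_iff[of a b "a *\<^sub>o c"] omult_le_iff[of a c "a *\<^sub>o c"] by auto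

lemma omult_ozero [simp]: "a *\<^sub>o ozero = (ozero :: 'o::ordinals)"
  by (rule antisym) (auto simp: omult_le_iff)

lemma oadd_le_omult: "b < c \<Longrightarrow> a *\<^sub>o b +\<^sub>o a \<le> a *\<^sub>o (c :: 'o::ordinals)"
  using omult_le_iff[of a c "a *\<^sub>o c"] by simp

lemma oadd_mono_left: "a \<le> b \<Longrightarrow> a +\<^sub>o c \<le> b +\<^sub>o (c :: 'o::ordinals)"
proof (induction c rule: less_induct)
  case (less c)
  have "a +\<^sub>o d < b +\<^sub>o c" if "d < c" for d
    using less.IH[OF that less.prems] oadd_strict_mono[OF that, of b] by (rule order.strict_trans1)
  then show ?case
    using less.prems le_oadd[of b c] by (auto simp: oadd_le_iff)
qed

lemma omult_osucc: "a *\<^sub>o osucc b = a *\<^sub>o b +\<^sub>o (a :: 'o::ordinals)"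
proof (rule antisym)
  show "a *\<^sub>o osucc b \<le> a *\<^sub>o b +\<^sub>o a"
    unfolding omult_le_iff[of a "osucc b"]
    by (auto intro: oadd_mono_left omult_mono)
qed (simp add: oadd_le_omult)

lemma omult_olimit_le_iff:
  assumes "olimit l"
  shows "a *\<^sub>o l \<le> c \<longleftrightarrow> (\<forall>d<l. a *\<^sub>o d \<le> (c :: 'o::ordinals))"
proof
  assume r: "\<forall>d<l. a *\<^sub>o d \<le> c"
  show "a *\<^sub>o l \<le> c"
    unfolding omult_le_iff[of a l]
    using r olimitD[OF assms] by (metis omult_osucc)
next
  assume "a *\<^sub>o l \<le> c"
  then show "\<forall>d<l. a *\<^sub>o d \<le> c"
    by (meson less_imp_le omult_mono order.trans)
qed

lemma olimit_omega: "olimit (omega :: 'o::ordinals)"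
proof -
  obtain l :: 'o where "\<exists>x. x < l" "\<forall>x<l. \<exists>y<l. x < y"
    using infinity by blast
  then have "olimit l"
    unfolding olimit_def by (metis osucc_le_iff order.strict_trans1 ozero_least)
  then show ?thesis
    unfolding omega_def by (rule LeastI)
qed

lemma omega_pow_mono: "b \<le> c \<Longrightarrow> omega_pow b \<le> omega_pow (c :: 'o::ordinals)"
  using omega_pow_le_iff[of b "omega_pow c"] omega_pow_le_iff[of c "omega_pow c"] by auto

lemma omult_mono_left: "a \<le> b \<Longrightarrow> a *\<^sub>o c \<le> b *\<^sub>o (c :: 'o::ordinals)"
proof (induction c rule: less_induct)
  case (less c)
  have "a *\<^sub>o d +\<^sub>o a \<le> b *\<^sub>o c" if "d < c" for d
    using less that
    by (meson oadd_le_cancel oadd_le_omult oadd_mono_left order.trans)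
  then show ?case
    by (auto simp: omult_le_iff[of a])
qed

lemma omega_pow_ozero: "omega_pow ozero = (oone :: 'o::ordinals)"
  by (rule antisym) (use omega_pow_le_iff[of ozero "omega_pow ozero"] in \<open>auto simp: omega_pow_le_iff\<close>)

lemma omega_pow_osucc: "omega_pow (osucc b) = omega_pow b *\<^sub>o (omega :: 'o::ordinals)"
proof (rule antisym)
  have "oone \<le> omega_pow b"
    using omega_pow_le_iff[of b "omega_pow b"] by simp
  also have "omega_pow b \<le> omega_pow b *\<^sub>o omega"
  proof -
    have "oone < (omega :: 'o)"
      using olimit_omega by (auto simp: oone_def olimit_def)
    then have "omega_pow b *\<^sub>o oone \<le> omega_pow b *\<^sub>o omega"
      by (simp add: omult_mono)
    moreover have "ozero +\<^sub>o a = a" for a :: 'o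
    proof (induction a rule: less_induct)
      case (less a)
      then have "ozero +\<^sub>o a \<le> a" by (simp add: oadd_le_iff)
      moreover have "a \<le> ozero +\<^sub>o a"
        by (rule ccontr) (metis less not_le oadd_less_iff less_irrefl)
      ultimately show ?case by simp
    qed
    ultimately show ?thesis by (simp add: oone_def omult_osucc)
  qed
  finally show "omega_pow (osucc b) \<le> omega_pow b *\<^sub>o omega"
    unfolding omega_pow_le_iff[of "osucc b"]
    by (auto intro: omult_mono_left omega_pow_mono)
  show "omega_pow b *\<^sub>o omega \<le> omega_pow (osucc b)"
    using omega_pow_le_iff[of "osucc b" "omega_pow (osucc b)"] by simp
qed

lemma omega_pow_olimit_le_iff:
  assumes "olimit l"
  shows "omega_pow l \<le> c \<longleftrightarrow> (\<forall>d<l. omega_pow d \<le> (c :: 'o::ordinals))"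
proof
  assume r: "\<forall>d<l. omega_pow d \<le> c"
  then have "oone \<le> c"
    using assms by (metis omega_pow_ozero olimit_def)
  then show "omega_pow l \<le> c"
    unfolding omega_pow_le_iff[of l]
    using r olimitD[OF assms] by (metis omega_pow_osucc)
next
  assume "omega_pow l \<le> c"
  then show "\<forall>d<l. omega_pow d \<le> c"
    by (meson less_imp_le omega_pow_mono order.trans)
qed


section \<open>Closed sets and coverings\<close>

definition fxi :: "'o::ordinals \<Rightarrow> 'o \<Rightarrow> 'o \<Rightarrow> 'o" where
  "fxi r \<xi> x =
     (if r dvd\<^sub>o x then x +\<^sub>o \<xi>
      else (THE s. r dvd\<^sub>o s \<and> (\<exists>e. ozero < e \<and> e < r \<and> x = s +\<^sub>o e)))"

lemma omult_strict_interval: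
  assumes "r *\<^sub>o a +\<^sub>o e = r *\<^sub>o b +\<^sub>o e'" "e < r" "e' < r"
  shows "r *\<^sub>o a = r *\<^sub>o (b :: 'o::ordinals)"
proof -
  have "\<not> c < d" if "r *\<^sub>o c +\<^sub>o e = r *\<^sub>o d +\<^sub>o e'" "e < r" for c d e e'
  proof
    assume "c < d"
    have "r *\<^sub>o c +\<^sub>o e < r *\<^sub>o c +\<^sub>o r" using that(2) by simp
    also have "\<dots> \<le> r *\<^sub>o d" using \<open>c < d\<close> by (rule oadd_le_omult)
    also have "\<dots> \<le> r *\<^sub>o d +\<^sub>o e'" by (rule le_oadd)
    finally show False using that by simp
  qed
  from this[of a e b e'] this[of b e' a e] assms show ?thesis
    by (metis linorder_neqE)
qed

lemma fxi_multiple: "fxi r \<xi> (r *\<^sub>o z) = r *\<^sub>o z +\<^sub>o (\<xi> :: 'o::ordinals)"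
  by (auto simp: fxi_def odvd_def)

lemma fxi_nonmultiple:
  assumes "ozero < e" "e < (r :: 'o::ordinals)"
  shows "fxi r \<xi> (r *\<^sub>o z +\<^sub>o e) = r *\<^sub>o z"
proof -
  have "r *\<^sub>o z +\<^sub>o e \<noteq> r *\<^sub>o d" for d
  proof
    assume eq: "r *\<^sub>o z +\<^sub>o e = r *\<^sub>o d"
    then have "r *\<^sub>o z = r *\<^sub>o d"
      using omult_strict_interval[of r z e d ozero] assms by simp
    with eq have "r *\<^sub>o z +\<^sub>o e = r *\<^sub>o z +\<^sub>o ozero" by simp
    then show False
      using assms by (metis oadd_less_iff less_irrefl)
  qed
  then have "\<not> r dvd\<^sub>o r *\<^sub>o z +\<^sub>o e" by (simp add: odvd_def)
  moreover have "(THE s. r dvd\<^sub>o s \<and> (\<exists>e'. ozero < e' \<and> e' < r \<and> r *\<^sub>o z +\<^sub>o e = s +\<^sub>o e')) = r *\<^sub>o z"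
    using assms by (intro the_equality) (auto simp: odvd_def dest: omult_strict_interval)
  ultimately show ?thesis by (simp add: fxi_def)
qed

definition closed_ords :: "'o::ordinals \<Rightarrow> 'o set \<Rightarrow> bool" where
  "closed_ords r X \<longleftrightarrow> (\<forall>s. r dvd\<^sub>o s \<and> (\<exists>\<xi><r. s +\<^sub>o \<xi> \<in> X) \<longrightarrow> s \<in> X)"

definition set_less :: "'o::ordinals set \<Rightarrow> 'o set \<Rightarrow> bool"  (infix "\<lless>" 50) where
  "X \<lless> Y \<longleftrightarrow> (\<forall>x\<in>X. \<forall>y\<in>Y. x < y)"

text \<open>In the following definitions \<open>R1\<close>, \<open>R2\<close> stand for \<open>\<le>\<^sub>1\<close>, \<open>\<le>\<^sub>2\<close>; they are parameters so that
  the same clauses can be used in the recursive definition of \<open>\<le>\<^sub>1\<close> and \<open>\<le>\<^sub>2\<close>, where these are only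
  available below the ordinal at hand.\<close>

definition covering ::
    "'o::ordinals \<Rightarrow> ('o \<Rightarrow> 'o \<Rightarrow> bool) \<Rightarrow> ('o \<Rightarrow> 'o \<Rightarrow> bool) \<Rightarrow> 'o set \<Rightarrow> ('o \<Rightarrow> 'o) \<Rightarrow> bool" where
  "covering r R1 R2 X h \<longleftrightarrow>
     strict_mono_on X h \<and>
     (\<forall>x\<in>X. \<forall>y\<in>X.
        (\<forall>\<xi><r. fxi r \<xi> x = y \<longleftrightarrow> fxi r \<xi> (h x) = h y) \<and>
        (R1 x y \<longrightarrow> R1 (h x) (h y)) \<and>
        (R2 x y \<longrightarrow> R2 (h x) (h y)))"

definition is_covering_of ::
    "'o::ordinals \<Rightarrow> ('o \<Rightarrow> 'o \<Rightarrow> bool) \<Rightarrow> ('o \<Rightarrow> 'o \<Rightarrow> bool) \<Rightarrow> 'o set \<Rightarrow> 'o set \<Rightarrow> bool" where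
  "is_covering_of r R1 R2 Z X \<longleftrightarrow> (\<exists>h. covering r R1 R2 X h \<and> Z = h ` X)"

definition cofinally_many ::
    "'o::ordinals \<Rightarrow> ('o \<Rightarrow> 'o \<Rightarrow> bool) \<Rightarrow> ('o \<Rightarrow> 'o \<Rightarrow> bool) \<Rightarrow> 'o set \<Rightarrow> 'o set \<Rightarrow> 'o \<Rightarrow> bool" where
  "cofinally_many r R1 R2 X Y a \<longleftrightarrow>
     (\<forall>c<a. \<exists>Z. finite Z \<and> Z \<subseteq> {c<..<a} \<and> is_covering_of r R1 R2 (X \<union> Z) (X \<union> Y))"


section \<open>The relations \<open>\<le>\<^sub>1\<close> and \<open>\<le>\<^sub>2\<close>\<close>

definition le1_clause ::
    "'o::ordinals \<Rightarrow> ('o \<Rightarrow> 'o \<Rightarrow> bool) \<Rightarrow> ('o \<Rightarrow> 'o \<Rightarrow> bool) \<Rightarrow> 'o \<Rightarrow> 'o \<Rightarrow> bool" where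
  "le1_clause r R1 R2 a b \<longleftrightarrow>
     a \<le> b \<and>
     (\<forall>X Y. finite X \<and> finite Y \<and> X \<subseteq> {..<a} \<and> Y \<subseteq> {a..<b} \<and> closed_ords r (X \<union> Y) \<longrightarrow>
        (\<exists>Z. finite Z \<and> Z \<subseteq> {..<a} \<and> X \<lless> Z \<and> is_covering_of r R1 R2 (X \<union> Z) (X \<union> Y)))"

definition le2_up ::
    "'o::ordinals \<Rightarrow> ('o \<Rightarrow> 'o \<Rightarrow> bool) \<Rightarrow> ('o \<Rightarrow> 'o \<Rightarrow> bool) \<Rightarrow> 'o \<Rightarrow> 'o \<Rightarrow> bool" where
  "le2_up r R1 R2 a b \<longleftrightarrow>
     (\<forall>X Y. finite X \<and> finite Y \<and> X \<subseteq> {..<a} \<and> Y \<subseteq> {..<a} \<and> closed_ords r (X \<union> Y) \<and> X \<lless> Y \<longrightarrow>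
        cofinally_many r R1 R2 X Y a \<longrightarrow> cofinally_many r R1 R2 X Y b)"

definition le2_down ::
    "'o::ordinals \<Rightarrow> ('o \<Rightarrow> 'o \<Rightarrow> bool) \<Rightarrow> ('o \<Rightarrow> 'o \<Rightarrow> bool) \<Rightarrow> 'o \<Rightarrow> 'o \<Rightarrow> bool" where
  "le2_down r R1 R2 a b \<longleftrightarrow>
     (\<forall>X Y. finite X \<and> finite Y \<and> X \<subseteq> {..<a} \<and> Y \<subseteq> {a..<b} \<and> closed_ords r (X \<union> Y) \<longrightarrow>
        (\<exists>Z. finite Z \<and> Z \<subseteq> {..<a} \<and> X \<lless> Z \<and> is_covering_of r R1 R2 (X \<union> Z) (X \<union> Y) \<and>
           (\<forall>i<card Y. R1 (sorted_list_of_set Y ! i) b \<longrightarrow> R1 (sorted_list_of_set Z ! i) a)))"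

definition le2_clause ::
    "'o::ordinals \<Rightarrow> ('o \<Rightarrow> 'o \<Rightarrow> bool) \<Rightarrow> ('o \<Rightarrow> 'o \<Rightarrow> bool) \<Rightarrow> 'o \<Rightarrow> 'o \<Rightarrow> bool" where
  "le2_clause r R1 R2 a b \<longleftrightarrow> a \<le> b \<and> le2_up r R1 R2 a b \<and> le2_down r R1 R2 a b"

text \<open>The guards \<open>y < b\<close> and \<open>y \<le> b\<close> make the recursion on the larger argument explicit; the
  equations \<open>le1_iff\<close> and \<open>le2_iff\<close> below show that they have no effect.\<close>

context
  notes conj_cong [fundef_cong]
begin

function le1 :: "'o::ordinals \<Rightarrow> 'o \<Rightarrow> 'o \<Rightarrow> bool"
  and le2 :: "'o \<Rightarrow> 'o \<Rightarrow> 'o \<Rightarrow> bool" where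
  "le1 r a b = le1_clause r (\<lambda>x y. y < b \<and> le1 r x y) (\<lambda>x y. y < b \<and> le2 r x y) a b"
| "le2 r a b = le2_clause r (\<lambda>x y. y \<le> b \<and> le1 r x y) (\<lambda>x y. y < b \<and> le2 r x y) a b"
  by pat_completeness auto
termination
  by (relation "inv_image ({(x, y). x < y} <*lex*> less_than)
        (case_sum (\<lambda>(r, a, b). (b, 0)) (\<lambda>(r, a, b). (b, 1 :: nat)))")
    (auto simp: wf)

end

declare le1.simps [simp del] le2.simps [simp del]

lemma is_covering_of_cong:
  assumes "\<And>x y. y \<in> X \<union> Z \<Longrightarrow> R1 x y \<longleftrightarrow> R1' x y"
    and "\<And>x y. y \<in> X \<union> Z \<Longrightarrow> R2 x y \<longleftrightarrow> R2' x y"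
  shows "is_covering_of r R1 R2 Z X \<longleftrightarrow> is_covering_of r R1' R2' Z X"
proof -
  have "covering r R1 R2 X h \<longleftrightarrow> covering r R1' R2' X h" if "Z = h ` X" for h
    unfolding covering_def using assms that by (intro ball_cong refl conj_cong imp_cong) auto
  then show ?thesis
    unfolding is_covering_of_def by blast
qed

lemma le1_iff: "le1 r a b \<longleftrightarrow> le1_clause r (le1 r) (le2 r) a (b :: 'o::ordinals)"
proof -
  have "is_covering_of r (\<lambda>x y. y < b \<and> le1 r x y) (\<lambda>x y. y < b \<and> le2 r x y) (X \<union> Z) (X \<union> Y)
      \<longleftrightarrow> is_covering_of r (le1 r) (le2 r) (X \<union> Z) (X \<union> Y)"
    if "a \<le> b" "X \<subseteq> {..<a}" "Y \<subseteq> {a..<b}" "Z \<subseteq> {..<a}" for X Y Z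
    by (rule is_covering_of_cong) (use that in fastforce)+
  then show ?thesis
    unfolding le1.simps[of r a b] le1_clause_def by (simp cong: conj_cong)
qed

lemma le2_iff: "le2 r a b \<longleftrightarrow> le2_clause r (le1 r) (le2 r) a (b :: 'o::ordinals)"
proof (cases "a \<le> b")
  case True
  then have sub: "x < b" if "x < a" for x
    using that by simp
  let ?R1 = "\<lambda>x y. y \<le> b \<and> le1 r x y" and ?R2 = "\<lambda>x y. y < b \<and> le2 r x y"
  have cov: "is_covering_of r ?R1 ?R2 Z X \<longleftrightarrow> is_covering_of r (le1 r) (le2 r) Z X"
    if "X \<subseteq> {..<b}" "Z \<subseteq> {..<b}" for X Z
    by (rule is_covering_of_cong) (use that in fastforce)+
  have cof: "cofinally_many r ?R1 ?R2 X Y c \<longleftrightarrow> cofinally_many r (le1 r) (le2 r) X Y c"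
    if XY: "X \<subseteq> {..<a}" "Y \<subseteq> {..<a}" and "c \<le> b" for X Y c
  proof -
    have "is_covering_of r ?R1 ?R2 (X \<union> Z) (X \<union> Y) \<longleftrightarrow> is_covering_of r (le1 r) (le2 r) (X \<union> Z) (X \<union> Y)"
      if "Z \<subseteq> {d<..<c}" for Z d
    proof (rule cov)
      show "X \<union> Y \<subseteq> {..<b}" using XY sub by blast
      have "x < b" if "x < c" for x
        using that \<open>c \<le> b\<close> by simp
      then show "X \<union> Z \<subseteq> {..<b}" using XY sub that by force
    qed
    then show ?thesis
      unfolding cofinally_many_def by (simp cong: conj_cong)
  qed
  have "le2_up r ?R1 ?R2 a b \<longleftrightarrow> le2_up r (le1 r) (le2 r) a b"
    unfolding le2_up_def
    by (intro all_cong1 imp_cong refl cof) (use True in blast)+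
  moreover have "le2_down r ?R1 ?R2 a b \<longleftrightarrow> le2_down r (le1 r) (le2 r) a b"
  proof -
    have "is_covering_of r ?R1 ?R2 (X \<union> Z) (X \<union> Y) \<longleftrightarrow> is_covering_of r (le1 r) (le2 r) (X \<union> Z) (X \<union> Y)"
      if "X \<subseteq> {..<a}" "Y \<subseteq> {a..<b}" "Z \<subseteq> {..<a}" for X Y Z
    proof (rule cov)
      show "X \<union> Y \<subseteq> {..<b}" "X \<union> Z \<subseteq> {..<b}"
        using that sub by (force, blast)
    qed
    then show ?thesis
      unfolding le2_down_def using True by (simp cong: conj_cong)
  qed
  ultimately show ?thesis
    unfolding le2.simps[of r a b] le2_clause_def by simp
qed (simp add: le2.simps[of r a b] le2_clause_def)


section \<open>The ordinals \<open>\<kappa>\<close>, \<open>\<theta>\<^sub>1\<close> and \<open>max\<^sub>1\<close>\<close>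

datatype 'o ord_inf = Fin 'o | Infty

primrec less_inf :: "'o::ordinals \<Rightarrow> 'o ord_inf \<Rightarrow> bool"  (infix "<\<^sub>i" 50) where
  "a <\<^sub>i Fin b \<longleftrightarrow> a < b"
| "a <\<^sub>i Infty \<longleftrightarrow> True"

primrec oadd_inf :: "'o::ordinals \<Rightarrow> 'o ord_inf \<Rightarrow> 'o ord_inf"  (infixl "+\<^sub>i" 65) where
  "a +\<^sub>i Fin b = Fin (a +\<^sub>o b)"
| "a +\<^sub>i Infty = Infty"

definition max1 :: "'o::ordinals \<Rightarrow> 'o \<Rightarrow> 'o ord_inf" where
  "max1 r a =
     (if bdd_above {b. le1 r a b} then Fin (GREATEST b. le1 r a b) else Infty)"

definition minimal1 :: "'o::ordinals \<Rightarrow> 'o \<Rightarrow> bool" where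
  "minimal1 r k \<longleftrightarrow> \<not> (\<exists>x. le1 r x k \<and> x \<noteq> k)"

function kappa :: "'o::ordinals \<Rightarrow> 'o \<Rightarrow> 'o" where
  "kappa r a = (LEAST k. minimal1 r k \<and> (\<forall>b<a. kappa r b < k))"
  by pat_completeness auto
termination
  by (relation "inv_image {(x, y). x < y} snd") (auto simp: wf)

declare kappa.simps [simp del]

text \<open>\<open>\<theta>\<^sub>1\<close> is the first index at which the enumeration stops; on indices below it, \<open>kappa\<close> is the
  increasing enumeration of the minimal ordinals (lemmas \<open>kappa_strict_mono\<close>, \<open>kappa_range\<close>).\<close>

definition theta1 :: "'o::ordinals \<Rightarrow> 'o ord_inf" where
  "theta1 r =
     (if \<exists>a. \<not> (\<exists>k. minimal1 r k \<and> (\<forall>b<a. kappa r b < k))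
      then Fin (LEAST a. \<not> (\<exists>k. minimal1 r k \<and> (\<forall>b<a. kappa r b < k)))
      else Infty)"

lemma less_theta1_ex:
  assumes "a <\<^sub>i theta1 r"
  shows "\<exists>k. minimal1 r k \<and> (\<forall>b<a. kappa r b < (k :: 'o::ordinals))"
proof (rule ccontr)
  assume no: "\<not> ?thesis"
  define t where "t = (LEAST a. \<not> (\<exists>k. minimal1 r k \<and> (\<forall>b<a. kappa r b < k)))"
  from no have "theta1 r = Fin t"
    unfolding theta1_def t_def by (subst if_P) blast+
  then have "a < t" using assms by simp
  then show False
    using no not_less_Least unfolding t_def by blast
qed

lemma less_inf_trans: "a < b \<Longrightarrow> b <\<^sub>i m \<Longrightarrow> (a :: 'o::ordinals) <\<^sub>i m"
  by (cases m) auto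

lemma kappa_minimal_greater:
  assumes "a <\<^sub>i theta1 r"
  shows "minimal1 r (kappa r a) \<and> (\<forall>b<a. kappa r b < kappa r (a :: 'o::ordinals))"
  unfolding kappa.simps[of r a] using less_theta1_ex[OF assms] by (rule LeastI_ex)

lemma kappa_strict_mono: "strict_mono_on {a. a <\<^sub>i theta1 r} (kappa r)"
  by (auto simp: strict_mono_on_def kappa_minimal_greater)

lemma kappa_range: "kappa r ` {a. a <\<^sub>i theta1 r} = {k :: 'o::ordinals. minimal1 r k}"
proof (intro equalityI subsetI)
  fix k assume "k \<in> {k. minimal1 r k}"
  then have k: "minimal1 r k" by simp
  show "k \<in> kappa r ` {a. a <\<^sub>i theta1 r}"
  proof (rule ccontr)
    assume no: "k \<notin> kappa r ` {a. a <\<^sub>i theta1 r}"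
    have below: "kappa r a < k" if "a <\<^sub>i theta1 r" for a
      using that
    proof (induction a rule: less_induct)
      case (less a)
      then have "\<forall>b<a. kappa r b < k"
        using less_inf_trans by blast
      then have "kappa r a \<le> k"
        unfolding kappa.simps[of r a] using k by (intro Least_le) simp
      moreover have "kappa r a \<noteq> k" using no less.prems by blast
      ultimately show ?case by simp
    qed
    show False
    proof (cases "theta1 r")
      case (Fin t)
      let ?P = "\<lambda>a. \<not> (\<exists>k. minimal1 r k \<and> (\<forall>b<a. kappa r b < k))"
      have ex: "\<exists>a. ?P a"
        using Fin unfolding theta1_def by (metis ord_inf.distinct(1))
      then have t: "t = (LEAST a. ?P a)"
        using Fin unfolding theta1_def by (simp only: if_True ord_inf.inject)
      have "?P t"
        unfolding t using ex by (rule LeastI_ex)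
      then show False
        using k below Fin by auto
    next
      case Infty
      have le: "a \<le> kappa r a" for a
      proof (induction a rule: less_induct)
        case (less a)
        then have "b < kappa r a" if "b < a" for b
          using that kappa_minimal_greater[of a r] Infty by fastforce
        then show ?case by (meson less_irrefl not_le)
      qed
      show False
        using le[of k] below[of k] Infty by simp
    qed
  qed
qed (auto simp: kappa_minimal_greater)

lemma le1_refl: "le1 r a (a :: 'o::ordinals)"
proof -
  have "is_covering_of r (le1 r) (le2 r) (X \<union> {}) (X \<union> {})" for X
    unfolding is_covering_of_def covering_def
    by (intro exI[of _ id]) (auto simp: strict_mono_on_def)
  then show ?thesis
    unfolding le1_iff[of r a a] le1_clause_def
    by (auto intro!: exI[of _ "{}"] simp: set_less_def)
qed

lemma max1_greatest:
  assumes "max1 r a = Fin (b :: 'o::ordinals)"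
  shows "le1 r a b \<and> (\<forall>c. le1 r a c \<longrightarrow> c \<le> b)"
proof -
  have bdd: "bdd_above {b. le1 r a b}" and b: "b = (GREATEST b. le1 r a b)"
    using assms by (auto simp: max1_def split: if_splits)
  define s where "s = (LEAST s. \<forall>c. le1 r a c \<longrightarrow> c \<le> s)"
  have ub: "c \<le> s" if "le1 r a c" for c
  proof -
    have "\<exists>s. \<forall>c. le1 r a c \<longrightarrow> c \<le> s"
      using bdd by (auto simp: bdd_above_def)
    then have "\<forall>c. le1 r a c \<longrightarrow> c \<le> s"
      unfolding s_def by (rule LeastI_ex)
    with that show ?thesis by blast
  qed
  have lub: "\<exists>c. le1 r a c \<and> d < c" if "d < s" for d
  proof (rule ccontr)
    assume "\<not> ?thesis"
    then have "\<forall>c. le1 r a c \<longrightarrow> c \<le> d"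
      by (auto simp: not_less)
    then have "s \<le> d"
      unfolding s_def by (rule Least_le)
    with that show False by simp
  qed
  have "le1 r a s"
    unfolding le1_iff[of r a s] le1_clause_def
  proof (intro conjI allI impI)
    show "a \<le> s" using ub le1_refl by blast
  next
    fix X Y
    assume XY: "finite X \<and> finite Y \<and> X \<subseteq> {..<a} \<and> Y \<subseteq> {a..<s} \<and> closed_ords r (X \<union> Y)"
    obtain c where c: "le1 r a c" "Y \<subseteq> {a..<c}"
    proof (cases "Y = {}")
      case True
      then show ?thesis using that le1_refl by blast
    next
      case False
      then have "Max Y < s" using XY by auto
      then obtain c where "le1 r a c" "Max Y < c" using lub by blast
      then show ?thesis
        using that XY False by (metis Max_less_iff atLeastLessThan_iff subset_iff)
    qed
    then show "\<exists>Z. finite Z \<and> Z \<subseteq> {..<a} \<and> X \<lless> Z \<and>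
        is_covering_of r (le1 r) (le2 r) (X \<union> Z) (X \<union> Y)"
      using XY unfolding le1_iff[of r a c] le1_clause_def by blast
  qed
  then have "b = s"
    unfolding b using ub by (intro Greatest_equality)
  then show ?thesis
    using \<open>le1 r a s\<close> ub by blast
qed

end

theory Submission
  imports Defs
begin

text \<open>
  Write \<open>\<lambda>\<^sub>B = \<kappa>\<^bsub>\<rho>\<cdot>B\<^esub>\<close>; these are the \<open>\<le>\<^sub>1\<close>-minimal multiples of \<open>\<rho>\<close>.  A minimal ordinal \<open>\<lambda>\<close> has no
  relation to it from below and no proper \<open>\<le>\<^sub>2\<close>-successor, so as long as \<open>\<lambda> \<le>\<^sub>1 \<lambda> + d\<close>, both relations
  on \<open>(\<lambda>, \<lambda> + d]\<close> are the translates of those on \<open>(0, d]\<close>.  By induction on \<open>B = B\<^sub>0 + \<omega>\<^sup>\<beta>\<close> one shows that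
  \<open>\<lambda>\<^sub>B \<le>\<^sub>1 \<lambda>\<^sub>B + n\<close> holds iff \<open>n \<le> \<kappa>\<^sub>\<beta>\<close> or \<open>\<kappa>\<^sub>\<beta> \<le>\<^sub>1 n\<close>.  If the right side holds, a finite set above \<open>\<lambda>\<^sub>B\<close> is
  translated back, covered below \<open>\<kappa>\<^sub>\<beta>\<close>, hence inside some \<open>[0, max\<^sub>1(\<kappa>\<^sub>\<gamma>)]\<close> with \<open>\<gamma> < \<beta>\<close>, and translated
  to a \<open>\<lambda>\<^bsub>B'\<^esub>\<close> with \<open>B' = \<dots> + \<omega>\<^sup>\<gamma> < B\<close>, of which there are cofinally many.  Conversely, \<open>\<lambda>\<^sub>B \<le>\<^sub>1 \<lambda>\<^sub>B + n\<close>
  makes every finite closed subset of \<open>n\<close> coverable below \<open>\<kappa>\<^sub>\<beta>\<close>.  Such coverings move the parameters, but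
  below every minimal \<open>k\<close> there is, for each \<open>y < k\<close>, a finite pattern without a copy below \<open>y\<close>;
  adjoining such a pattern pushes the covering above the parameters, and
  \<open>\<kappa>\<^sub>\<beta> \<le>\<^sub>1 n\<close> follows.
\<close>

section \<open>Ordinal arithmetic\<close>

text \<open>At a least \<open>a\<close> with \<open>f a < a\<close>, strict monotonicity would make
  \<open>f a\<close> a smaller ordinal of the same kind.\<close>

lemma le_strict_mono:
  fixes f :: "'o::ordinals \<Rightarrow> 'o"
  assumes "\<And>x y. x < y \<Longrightarrow> f x < f y"
  shows "a \<le> f a"
proof (induction a rule: less_induct)
  case (less a)
  show ?case
    by (rule ccontr) (metis assms less less_asym not_le)
qed

lemma le_oadd_right: "b \<le> a +\<^sub>o (b :: 'o::ordinals)"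
  by (rule le_strict_mono) simp

lemma oadd_left_cancel [simp]: "a +\<^sub>o b = a +\<^sub>o c \<longleftrightarrow> b = (c :: 'o::ordinals)"
  by (metis linorder_neqE oadd_strict_mono less_irrefl)

text \<open>The least \<open>d\<close> with \<open>b \<le> a +\<^sub>o d\<close> gives equality,
  because all smaller \<open>d\<close> keep the sum below \<open>b\<close>.\<close>

lemma oadd_diff_exists:
  assumes "a \<le> (b :: 'o::ordinals)"
  obtains d where "b = a +\<^sub>o d"
proof -
  define d where "d = (LEAST d. b \<le> a +\<^sub>o d)"
  have "b \<le> a +\<^sub>o d"
    unfolding d_def using le_oadd_right by (rule LeastI)
  moreover have "a +\<^sub>o d \<le> b"
    unfolding oadd_le_iff[of a d] using assms not_less_Least unfolding d_def by (meson not_le)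
  ultimately show ?thesis using that by force
qed

text \<open>Left difference. The description has its intended meaning only for
  \<open>a \<le> b\<close>, where left cancellation makes \<open>d\<close> unique.\<close>

definition ominus :: "'o::ordinals \<Rightarrow> 'o \<Rightarrow> 'o" where
  "ominus b a = (THE d. b = a +\<^sub>o d)"

lemma ominus_oadd [simp]: "ominus (a +\<^sub>o d) a = (d :: 'o::ordinals)"
  by (simp add: ominus_def)

lemma oadd_ominus: "a \<le> b \<Longrightarrow> a +\<^sub>o ominus b a = (b :: 'o::ordinals)"
  by (metis oadd_diff_exists ominus_oadd)

lemma oadd_assoc: "(a +\<^sub>o b) +\<^sub>o c = a +\<^sub>o (b +\<^sub>o (c :: 'o::ordinals))"
proof (induction c rule: less_induct)
  case (less c)
  show ?case
  proof (rule antisym)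
    show "(a +\<^sub>o b) +\<^sub>o c \<le> a +\<^sub>o (b +\<^sub>o c)"
      by (auto simp: oadd_le_iff[of "a +\<^sub>o b"] less le_oadd)
    have "a +\<^sub>o d < (a +\<^sub>o b) +\<^sub>o c" if d: "d < b +\<^sub>o c" for d
    proof (cases "d < b")
      case True
      then show ?thesis
        by (meson le_oadd oadd_less_iff order.strict_trans2)
    next
      case False
      then obtain d' where d': "d = b +\<^sub>o d'" by (meson not_le oadd_diff_exists)
      then have "d' < c" using d by simp
      then show ?thesis using less[of d'] d' by (metis oadd_less_iff)
    qed
    then show "a +\<^sub>o (b +\<^sub>o c) \<le> (a +\<^sub>o b) +\<^sub>o c"
      unfolding oadd_le_iff[of a] by (meson le_oadd order.trans)
  qed
qed

lemma ozero_oadd [simp]: "ozero +\<^sub>o a = (a :: 'o::ordinals)"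
proof (induction a rule: less_induct)
  case (less a)
  show ?case
    by (rule antisym) (auto simp: less oadd_le_iff le_oadd_right)
qed

lemma ozero_less_iff: "ozero < x \<longleftrightarrow> x \<noteq> (ozero :: 'o::ordinals)"
  by (metis less_le ozero_least)

lemma le_ozero_iff [simp]: "a \<le> ozero \<longleftrightarrow> a = (ozero :: 'o::ordinals)"
  by (metis antisym ozero_least order.refl)

section \<open>Multiplication and division with remainder\<close>

lemma less_omultD:
  assumes "x < a *\<^sub>o (c :: 'o::ordinals)"
  obtains d where "d < c" "x < a *\<^sub>o d +\<^sub>o a"
  using assms omult_le_iff[of a c x] by (meson not_le)

lemma omult_oadd: "a *\<^sub>o (b +\<^sub>o c) = a *\<^sub>o b +\<^sub>o a *\<^sub>o (c :: 'o::ordinals)"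
proof (induction c rule: less_induct)
  case (less c)
  show ?case
  proof (rule antisym)
    have "a *\<^sub>o d +\<^sub>o a \<le> a *\<^sub>o b +\<^sub>o a *\<^sub>o c" if d: "d < b +\<^sub>o c" for d
    proof (cases "d < b")
      case True
      then show ?thesis by (meson le_oadd oadd_le_omult order.trans)
    next
      case False
      then obtain d' where d': "d = b +\<^sub>o d'" by (meson not_le oadd_diff_exists)
      then have "d' < c" using d by simp
      then show ?thesis using less[of d'] d' by (simp add: oadd_assoc oadd_le_omult)
    qed
    then show "a *\<^sub>o (b +\<^sub>o c) \<le> a *\<^sub>o b +\<^sub>o a *\<^sub>o c"
      unfolding omult_le_iff[of a "b +\<^sub>o c"] by blast
    have "a *\<^sub>o b +\<^sub>o d < a *\<^sub>o (b +\<^sub>o c)" if d: "d < a *\<^sub>o c" for d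
    proof -
      obtain c' where c': "c' < c" "d < a *\<^sub>o c' +\<^sub>o a" using d by (rule less_omultD)
      then have "a *\<^sub>o b +\<^sub>o d < a *\<^sub>o (b +\<^sub>o c') +\<^sub>o a"
        by (simp add: less oadd_assoc)
      also have "\<dots> \<le> a *\<^sub>o (b +\<^sub>o c)" using c' by (simp add: oadd_le_omult)
      finally show ?thesis .
    qed
    then show "a *\<^sub>o b +\<^sub>o a *\<^sub>o c \<le> a *\<^sub>o (b +\<^sub>o c)"
      unfolding oadd_le_iff[of "a *\<^sub>o b"] by (simp add: omult_mono le_oadd)
  qed
qed

lemma omult_strict_mono:
  assumes "ozero < (a :: 'o::ordinals)" "b < c"
  shows "a *\<^sub>o b < a *\<^sub>o c"
proof -
  have "a *\<^sub>o b +\<^sub>o ozero < a *\<^sub>o b +\<^sub>o a" using assms(1) by (simp only: oadd_less_iff)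
  also have "\<dots> \<le> a *\<^sub>o c" using assms(2) by (rule oadd_le_omult)
  finally show ?thesis by simp
qed

lemma omult_less_iff:
  assumes "ozero < (a :: 'o::ordinals)"
  shows "a *\<^sub>o b < a *\<^sub>o c \<longleftrightarrow> b < c"
  using assms by (metis omult_strict_mono linorder_neqE less_asym less_irrefl)

lemma le_omult_right: "ozero < (a :: 'o::ordinals) \<Longrightarrow> b \<le> a *\<^sub>o b"
  by (rule le_strict_mono) (rule omult_strict_mono)

text \<open>The quotient is the least \<open>q\<close> whose block starting at
  \<open>a *\<^sub>o q\<close> ends above \<open>x\<close>; minimality puts \<open>x\<close> at or
  above the start of that block.\<close>

lemma omult_divide:
  assumes "ozero < (a :: 'o::ordinals)"
  obtains q e where "x = a *\<^sub>o q +\<^sub>o e" "e < a"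
proof -
  define q where "q = (LEAST q. x < a *\<^sub>o q +\<^sub>o a)"
  have "x < a *\<^sub>o x +\<^sub>o a"
    using le_omult_right[OF assms] assms
    by (metis oadd_less_iff oadd_ozero order.strict_trans1)
  then have q: "x < a *\<^sub>o q +\<^sub>o a"
    unfolding q_def by (rule LeastI)
  have "a *\<^sub>o q \<le> x"
    unfolding omult_le_iff[of a q] using not_less_Least unfolding q_def by (meson not_le)
  then obtain e where "x = a *\<^sub>o q +\<^sub>o e" by (rule oadd_diff_exists)
  with q that show ?thesis by simp
qed

section \<open>Powers of omega and the last term of the Cantor normal form\<close>

lemma omega_pow_pos: "ozero < omega_pow (b :: 'o::ordinals)"
  using omega_pow_le_iff[of b "omega_pow b"] by (simp add: oone_def)

lemma omega_pow_omult_omega_le: "b < c \<Longrightarrow> omega_pow b *\<^sub>o omega \<le> omega_pow (c :: 'o::ordinals)"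
  using omega_pow_le_iff[of c "omega_pow c"] by simp

lemma omega_pow_strict_mono:
  assumes "b < (c :: 'o::ordinals)"
  shows "omega_pow b < omega_pow c"
proof -
  have "oone < (omega :: 'o)"
    using olimit_omega by (auto simp: oone_def olimit_def)
  then have "omega_pow b *\<^sub>o oone < omega_pow b *\<^sub>o omega"
    by (simp add: omega_pow_pos omult_strict_mono)
  also have "\<dots> \<le> omega_pow c" using assms by (rule omega_pow_omult_omega_le)
  finally show ?thesis by (simp add: oone_def omult_osucc)
qed

lemma le_omega_pow: "b \<le> omega_pow (b :: 'o::ordinals)"
  by (rule le_strict_mono) (rule omega_pow_strict_mono)

text \<open>\<open>x\<close> is at most a finite multiple of some \<open>omega_pow d\<close> with
  \<open>c \<le> d < b\<close>, and one more summand keeps the multiple finite. This leaves room for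
  indices with a prescribed last term below a given one.\<close>

lemma oadd_omega_pow_less:
  assumes x: "x < omega_pow b" and c: "c < (b :: 'o::ordinals)"
  shows "x +\<^sub>o omega_pow c < omega_pow b"
proof -
  obtain d n where d: "c \<le> d" "d < b" and n: "n < omega" "x \<le> omega_pow d *\<^sub>o n"
  proof (cases "x = ozero")
    case True
    have "ozero < (omega :: 'o)" by (metis olimit_def olimit_omega)
    then show ?thesis using that[of c ozero] c True by simp
  next
    case False
    then have "oone \<le> x" by (simp add: oone_def ozero_less_iff)
    \<comment> \<open>As \<open>oone \<le> x\<close>, the inequality \<open>x < omega_pow b\<close>
      must come from one of the terms \<open>omega_pow d' *\<^sub>o omega\<close> in the supremum
      defining \<open>omega_pow b\<close>.\<close>
    then obtain d' where d': "d' < b" "x < omega_pow d' *\<^sub>o omega"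
      using x omega_pow_le_iff[of b x] by (meson not_le)
    let ?d = "max c d'"
    have "x < omega_pow ?d *\<^sub>o omega"
      using d'(2) by (rule order.strict_trans2) (simp add: omult_mono_left omega_pow_mono)
    then obtain n where "n < omega" "x < omega_pow ?d *\<^sub>o n"
      using omult_olimit_le_iff[OF olimit_omega] by (meson not_le)
    then show ?thesis using that[of ?d n] c d'(1) by simp
  qed
  have "x +\<^sub>o omega_pow c \<le> omega_pow d *\<^sub>o n +\<^sub>o omega_pow d"
    using n(2) d(1) by (meson oadd_le_cancel oadd_mono_left omega_pow_mono order.trans)
  also have "\<dots> = omega_pow d *\<^sub>o osucc n" by (simp add: omult_osucc)
  also have "\<dots> < omega_pow d *\<^sub>o omega"
    using n(1) by (simp add: omega_pow_pos omult_strict_mono olimitD[OF olimit_omega])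
  also have "\<dots> \<le> omega_pow b" using d(2) by (rule omega_pow_omult_omega_le)
  finally show ?thesis .
qed

text \<open>Divide \<open>b\<close> by the largest power of omega not exceeding it. A nonzero
  remainder is smaller than \<open>b\<close> and has a last term by induction; if the remainder is
  zero, the quotient is a finite successor and the power itself is the last term.\<close>

lemma omega_pow_last_term:
  assumes "ozero < (b :: 'o::ordinals)"
  obtains c g where "b = c +\<^sub>o omega_pow g"
proof -
  have "\<exists>c g. b = c +\<^sub>o omega_pow g"
    using assms
  proof (induction b rule: less_induct)
    case (less b)
    define d where "d = (LEAST d. b < omega_pow d)"
    have "b < omega_pow (osucc b)"
      using le_omega_pow[of "osucc b"] by simp
    then have d: "b < omega_pow d"
      unfolding d_def by (rule LeastI)
    then obtain g where g: "g < d" "b < omega_pow g *\<^sub>o omega"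
      using less.prems omega_pow_le_iff[of d b] by (metis not_le oone_def osucc_le_iff)
    have gb: "omega_pow g \<le> b"
      using g(1) not_less_Least unfolding d_def by (meson not_le)
    obtain q e where b: "b = omega_pow g *\<^sub>o q +\<^sub>o e" "e < omega_pow g"
      using omega_pow_pos by (rule omult_divide)
    show ?case
    proof (cases "e = ozero")
      case True
      have "omega_pow g *\<^sub>o q < omega_pow g *\<^sub>o omega"
        using g(2) b True by simp
      then have "q < omega" by (simp add: omult_less_iff omega_pow_pos)
      \<comment> \<open>Below the least limit, a nonzero quotient is a successor.\<close>
      then have "\<not> olimit q" unfolding omega_def using not_less_Least by blast
      moreover have "ozero < q"
        using b True less.prems by (metis oadd_ozero omult_ozero ozero_less_iff)
      ultimately obtain x where "x < q" "q \<le> osucc x"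
        unfolding olimit_def by (meson not_le)
      then have "q = osucc x" by (simp add: antisym)
      then show ?thesis using b True by (auto simp: omult_osucc)
    next
      case False
      then have "\<exists>c h. e = c +\<^sub>o omega_pow h"
        using less.IH[of e] b(2) gb by (simp add: ozero_less_iff)
      then obtain c h where "e = c +\<^sub>o omega_pow h" by blast
      then show ?thesis using b(1) by (metis oadd_assoc)
    qed
  qed
  then show ?thesis using that by blast
qed

lemma le_less_inf_trans: "a \<le> b \<Longrightarrow> b <\<^sub>i m \<Longrightarrow> (a :: 'o::ordinals) <\<^sub>i m"
  using less_inf_trans by (metis order.order_iff_strict)


section \<open>Multiples and coverings\<close>

locale indecomposable =
  fixes r :: "'o::ordinals"
  assumes indecomposable: "additively_indecomposable r"
begin

abbreviation le1r (infix "\<sqsubseteq>\<^sub>1" 50) where "x \<sqsubseteq>\<^sub>1 y \<equiv> le1 r x y"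
abbreviation le2r (infix "\<sqsubseteq>\<^sub>2" 50) where "x \<sqsubseteq>\<^sub>2 y \<equiv> le2 r x y"
abbreviation cover where "cover X h \<equiv> covering r (le1 r) (le2 r) X h"
abbreviation closed where "closed X \<equiv> closed_ords r X"

lemma r_pos: "ozero < r"
  using indecomposable by (simp add: additively_indecomposable_def ozero_less_iff)

lemma oadd_less_r: "a < r \<Longrightarrow> b < r \<Longrightarrow> a +\<^sub>o b < r"
  using indecomposable by (simp add: additively_indecomposable_def)

text \<open>Closure of \<open>r\<close> under addition keeps every \<open>a +\<^sub>o d\<close> with
  \<open>d < r\<close> below \<open>r\<close>.\<close>

lemma oadd_r: "a < r \<Longrightarrow> a +\<^sub>o r = r"
  by (rule antisym) (auto simp: oadd_le_iff oadd_less_r le_oadd_right)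

section \<open>Multiples of the indecomposable ordinal\<close>

lemma odvd_ozero [simp]: "r dvd\<^sub>o ozero"
  unfolding odvd_def by (metis omult_ozero)

lemma odvd_oadd: "r dvd\<^sub>o a \<Longrightarrow> r dvd\<^sub>o b \<Longrightarrow> r dvd\<^sub>o a +\<^sub>o b"
  unfolding odvd_def by (metis omult_oadd)

lemma odvd_oaddD: "r dvd\<^sub>o a \<Longrightarrow> r dvd\<^sub>o a +\<^sub>o b \<Longrightarrow> r dvd\<^sub>o b"
  unfolding odvd_def
  by (metis le_oadd not_le oadd_diff_exists oadd_left_cancel omult_less_iff omult_oadd r_pos)

lemma odvd_floor:
  obtains t e where "x = t +\<^sub>o e" "r dvd\<^sub>o t" "e < r"
  using omult_divide[OF r_pos, of x] unfolding odvd_def by metis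

lemma odvd_less:
  assumes "r dvd\<^sub>o a" "r dvd\<^sub>o b" "a < b"
  shows "a +\<^sub>o r \<le> b"
  using assms unfolding odvd_def by (metis oadd_le_omult omult_less_iff r_pos)

lemma odvd_less_oadd:
  assumes "r dvd\<^sub>o a" "r dvd\<^sub>o b" "a < b +\<^sub>o e" "e < r"
  shows "a \<le> b"
  using assms odvd_less[of b a] by (meson not_le oadd_less_iff order.strict_trans less_asym)

lemma odvd_floor_unique:
  assumes "r dvd\<^sub>o a" "r dvd\<^sub>o b" "a +\<^sub>o e = b +\<^sub>o e'" "e < r" "e' < r"
  shows "a = b \<and> e = e'"
  using assms omult_strict_interval[of r _ e _ e'] unfolding odvd_def by (metis oadd_left_cancel)

lemma odvd_oadd_small: "r dvd\<^sub>o a \<Longrightarrow> e < r \<Longrightarrow> r dvd\<^sub>o a +\<^sub>o e \<longleftrightarrow> e = ozero"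
  by (metis oadd_ozero odvd_floor_unique r_pos)

section \<open>Closed sets\<close>

lemma closedD: "closed X \<Longrightarrow> r dvd\<^sub>o t \<Longrightarrow> \<xi> < r \<Longrightarrow> t +\<^sub>o \<xi> \<in> X \<Longrightarrow> t \<in> X"
  unfolding closed_ords_def by blast

lemma closedI: "(\<And>t \<xi>. r dvd\<^sub>o t \<Longrightarrow> \<xi> < r \<Longrightarrow> t +\<^sub>o \<xi> \<in> X \<Longrightarrow> t \<in> X) \<Longrightarrow> closed X"
  unfolding closed_ords_def by blast

lemma closed_Un: "closed X \<Longrightarrow> closed Y \<Longrightarrow> closed (X \<union> Y)"
  unfolding closed_ords_def by blast

lemma closed_initial: "closed X \<Longrightarrow> closed (X \<inter> {..<a})"
  by (rule closedI) (auto dest: closedD intro: le_oadd order.strict_trans1)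

text \<open>A multiple of \<open>r\<close> below the multiple \<open>a\<close> has its whole block
  below \<open>a\<close>, so the block start of an element of the final part is not cut off.\<close>

lemma closed_final:
  assumes "closed X" "r dvd\<^sub>o a"
  shows "closed (X \<inter> {a..})"
proof (rule closedI)
  fix t \<xi> assume *: "r dvd\<^sub>o t" "\<xi> < r" "t +\<^sub>o \<xi> \<in> X \<inter> {a..}"
  have "a \<le> t"
  proof (rule ccontr)
    assume "\<not> a \<le> t"
    then have "t +\<^sub>o r \<le> a" using odvd_less * assms(2) by simp
    moreover have "t +\<^sub>o \<xi> < t +\<^sub>o r" using * by simp
    moreover have "a \<le> t +\<^sub>o \<xi>" using * by simp
    ultimately show False by (meson not_le order.trans)
  qed
  with * assms(1) show "t \<in> X \<inter> {a..}" by (auto dest: closedD)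
qed

lemma closed_empty: "closed {}"
  by (simp add: closed_ords_def)

lemma closed_multiple: "r dvd\<^sub>o t \<Longrightarrow> closed {t}"
  by (rule closedI) (metis odvd_oadd_small oadd_ozero singletonD singletonI)

lemma closed_floor: "r dvd\<^sub>o t \<Longrightarrow> e < r \<Longrightarrow> closed {t, t +\<^sub>o e}"
proof (rule closedI)
  fix s \<xi> assume "r dvd\<^sub>o t" "e < r" "r dvd\<^sub>o s" "\<xi> < r" "s +\<^sub>o \<xi> \<in> {t, t +\<^sub>o e}"
  then show "s \<in> {t, t +\<^sub>o e}"
    using odvd_floor_unique[of s t \<xi> ozero] odvd_floor_unique[of s t \<xi> e] r_pos by auto
qed

section \<open>Coverings of closed sets\<close>

lemma fxi_multiple': "r dvd\<^sub>o t \<Longrightarrow> fxi r \<xi> t = t +\<^sub>o \<xi>"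
  by (simp add: fxi_def)

lemma fxi_nonmultiple': "r dvd\<^sub>o t \<Longrightarrow> ozero < e \<Longrightarrow> e < r \<Longrightarrow> fxi r \<xi> (t +\<^sub>o e) = t"
  unfolding odvd_def using fxi_nonmultiple by blast

text \<open>Expresses being a multiple through \<open>fxi\<close>, the only arithmetic that
  coverings are required to respect.\<close>

lemma odvd_iff_fxi: "r dvd\<^sub>o t \<longleftrightarrow> fxi r ozero t = t"
proof
  assume *: "fxi r ozero t = t"
  obtain s e where s: "t = s +\<^sub>o e" "r dvd\<^sub>o s" "e < r" by (rule odvd_floor)
  show "r dvd\<^sub>o t"
  proof (cases "e = ozero")
    case False
    then have "fxi r ozero t = s" using s fxi_nonmultiple' by (simp add: ozero_less_iff)
    then show ?thesis using * s by simp
  qed (use s in simp)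
qed (simp add: fxi_multiple')

text \<open>In a closed set the block start of each element is present, so the equivalences for all
  \<open>fxi\<close> reduce to sending multiples to multiples and carrying remainders along;
  injectivity and uniqueness of remainders supply the converse directions.\<close>

lemma covering_iff:
  assumes "closed X"
  shows "cover X h \<longleftrightarrow> strict_mono_on X h \<and>
     (\<forall>t \<xi>. r dvd\<^sub>o t \<and> \<xi> < r \<and> t +\<^sub>o \<xi> \<in> X \<longrightarrow> r dvd\<^sub>o h t \<and> h (t +\<^sub>o \<xi>) = h t +\<^sub>o \<xi>) \<and>
     (\<forall>x\<in>X. \<forall>y\<in>X. (x \<sqsubseteq>\<^sub>1 y \<longrightarrow> h x \<sqsubseteq>\<^sub>1 h y) \<and> (x \<sqsubseteq>\<^sub>2 y \<longrightarrow> h x \<sqsubseteq>\<^sub>2 h y))"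
    (is "_ \<longleftrightarrow> ?m \<and> ?f \<and> ?R")
proof
  assume h: "cover X h"
  have ?f
  proof (intro allI impI)
    fix t \<xi> assume t: "r dvd\<^sub>o t \<and> \<xi> < r \<and> t +\<^sub>o \<xi> \<in> X"
    then have tX: "t \<in> X" using assms closedD by blast
    have "fxi r ozero t = t" using t odvd_iff_fxi by blast
    then have "fxi r ozero (h t) = h t"
      using h tX r_pos unfolding covering_def by blast
    then have "r dvd\<^sub>o h t" by (simp add: odvd_iff_fxi)
    moreover have "fxi r \<xi> (h t) = h (t +\<^sub>o \<xi>)"
      using h t tX fxi_multiple'[of t \<xi>] unfolding covering_def by blast
    ultimately show "r dvd\<^sub>o h t \<and> h (t +\<^sub>o \<xi>) = h t +\<^sub>o \<xi>"
      by (simp add: fxi_multiple')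
  qed
  with h show "?m \<and> ?f \<and> ?R" unfolding covering_def by blast
next
  assume *: "?m \<and> ?f \<and> ?R"
  then have inj: "h x = h y \<longleftrightarrow> x = y" if "x \<in> X" "y \<in> X" for x y
    using that by (metis strict_mono_on_imp_inj_on inj_on_eq_iff)
  have "fxi r \<xi> x = y \<longleftrightarrow> fxi r \<xi> (h x) = h y" if x: "x \<in> X" "y \<in> X" and \<xi>: "\<xi> < r" for x y \<xi>
  proof -
    obtain t e where t: "x = t +\<^sub>o e" "r dvd\<^sub>o t" "e < r" by (rule odvd_floor)
    obtain s e' where s: "y = s +\<^sub>o e'" "r dvd\<^sub>o s" "e' < r" by (rule odvd_floor)
    have ht: "t \<in> X" "r dvd\<^sub>o h t" "h x = h t +\<^sub>o e" using * t x assms closedD by blast+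
    have hs: "s \<in> X" "r dvd\<^sub>o h s" "h y = h s +\<^sub>o e'" using * s x assms closedD by blast+
    show ?thesis
    proof (cases "e = ozero")
      case True
      then show ?thesis
        using t s ht hs \<xi> inj by (metis fxi_multiple' oadd_ozero odvd_floor_unique)
    next
      case False
      then have "fxi r \<xi> x = t" "fxi r \<xi> (h x) = h t"
        using t ht fxi_nonmultiple' by (auto simp: ozero_less_iff)
      then show ?thesis using inj ht x by simp
    qed
  qed
  with * show "cover X h" unfolding covering_def by blast
qed

lemma coverI:
  assumes "closed X"
    and "\<And>x y. x \<in> X \<Longrightarrow> y \<in> X \<Longrightarrow> x < y \<Longrightarrow> h x < h y"
    and "\<And>t \<xi>. r dvd\<^sub>o t \<Longrightarrow> \<xi> < r \<Longrightarrow> t \<in> X \<Longrightarrow> t +\<^sub>o \<xi> \<in> X \<Longrightarrow> r dvd\<^sub>o h t \<and> h (t +\<^sub>o \<xi>) = h t +\<^sub>o \<xi>"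
    and "\<And>x y. x \<in> X \<Longrightarrow> y \<in> X \<Longrightarrow> x \<sqsubseteq>\<^sub>1 y \<Longrightarrow> h x \<sqsubseteq>\<^sub>1 h y"
    and "\<And>x y. x \<in> X \<Longrightarrow> y \<in> X \<Longrightarrow> x \<sqsubseteq>\<^sub>2 y \<Longrightarrow> h x \<sqsubseteq>\<^sub>2 h y"
  shows "cover X h"
  unfolding covering_iff[OF assms(1)] strict_mono_on_def
  using assms closedD[OF assms(1)] by blast

lemma cover_less: "cover X h \<Longrightarrow> x \<in> X \<Longrightarrow> y \<in> X \<Longrightarrow> h x < h y \<longleftrightarrow> x < y"
  unfolding covering_def strict_mono_on_def by (metis less_asym linorder_neqE)

lemma cover_inj: "cover X h \<Longrightarrow> inj_on h X"
  unfolding covering_def by (simp add: strict_mono_on_imp_inj_on)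

lemma cover_le1: "cover X h \<Longrightarrow> x \<in> X \<Longrightarrow> y \<in> X \<Longrightarrow> x \<sqsubseteq>\<^sub>1 y \<Longrightarrow> h x \<sqsubseteq>\<^sub>1 h y"
  unfolding covering_def by blast

lemma cover_le2: "cover X h \<Longrightarrow> x \<in> X \<Longrightarrow> y \<in> X \<Longrightarrow> x \<sqsubseteq>\<^sub>2 y \<Longrightarrow> h x \<sqsubseteq>\<^sub>2 h y"
  unfolding covering_def by blast

lemma cover_odvd: "cover X h \<Longrightarrow> x \<in> X \<Longrightarrow> r dvd\<^sub>o x \<Longrightarrow> r dvd\<^sub>o h x"
  using r_pos unfolding covering_def odvd_iff_fxi by blast

lemma cover_oadd:
  "closed X \<Longrightarrow> cover X h \<Longrightarrow> r dvd\<^sub>o t \<Longrightarrow> \<xi> < r \<Longrightarrow> t +\<^sub>o \<xi> \<in> X \<Longrightarrow> h (t +\<^sub>o \<xi>) = h t +\<^sub>o \<xi>"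
  using covering_iff by blast

lemma cover_subset: "cover X h \<Longrightarrow> Y \<subseteq> X \<Longrightarrow> cover Y h"
  unfolding covering_def strict_mono_on_def by (meson subset_iff)

lemma cover_id: "cover X (\<lambda>x. x)"
  unfolding covering_def by (simp add: strict_mono_on_def)

lemma cover_comp: "cover X h \<Longrightarrow> cover (h ` X) g \<Longrightarrow> cover X (\<lambda>x. g (h x))"
  unfolding covering_def strict_mono_on_def by simp

lemma cover_cong: "(\<And>x. x \<in> X \<Longrightarrow> g x = h x) \<Longrightarrow> cover X g \<longleftrightarrow> cover X h"
  unfolding covering_def strict_mono_on_def by simp

text \<open>The decomposition of \<open>h x\<close> into block start and remainder is the image of
  that of \<open>x\<close>, and such decompositions are unique.\<close>

lemma closed_cover_image:
  assumes "closed X" "cover X h"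
  shows "closed (h ` X)"
proof (rule closedI)
  fix t \<xi> assume t: "r dvd\<^sub>o t" "\<xi> < r" "t +\<^sub>o \<xi> \<in> h ` X"
  then obtain x where x: "x \<in> X" "t +\<^sub>o \<xi> = h x" by blast
  obtain s e where s: "x = s +\<^sub>o e" "r dvd\<^sub>o s" "e < r" by (rule odvd_floor)
  then have "s \<in> X" using assms(1) x closedD by blast
  moreover have "h x = h s +\<^sub>o e" "r dvd\<^sub>o h s"
    using assms x s covering_iff by blast+
  ultimately show "t \<in> h ` X"
    using t s x odvd_floor_unique[of t "h s" \<xi> e] by simp
qed

text \<open>Since \<open>X\<close> is an initial segment of both sets, a covering of \<open>X \<union> Y\<close> by \<open>X \<union> Z\<close> fixes \<open>X\<close>.\<close>

lemma is_covering_of_iff: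
  assumes "X \<lless> Y" "X \<lless> Z"
  shows "is_covering_of r (le1 r) (le2 r) (X \<union> Z) (X \<union> Y) \<longleftrightarrow>
    (\<exists>h. cover (X \<union> Y) h \<and> (\<forall>x\<in>X. h x = x) \<and> h ` Y = Z)"
proof
  assume "is_covering_of r (le1 r) (le2 r) (X \<union> Z) (X \<union> Y)"
  then obtain h where h: "cover (X \<union> Y) h" "X \<union> Z = h ` (X \<union> Y)"
    unfolding is_covering_of_def by blast
  note less = cover_less[OF h(1)]
  \<comment> \<open>\<open>x\<close> is the image of some \<open>w\<close>. If \<open>w < x\<close>,
    then \<open>h\<close> fixes \<open>w\<close> by induction; if \<open>x < w\<close>, then
    \<open>h x\<close> lies in \<open>X\<close> below \<open>x\<close> and is fixed by induction,
    against injectivity.\<close>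
  have hX: "h x = x" if "x \<in> X" for x
    using that
  proof (induction x rule: less_induct)
    case (less x)
    obtain w where w: "w \<in> X \<union> Y" "x = h w" using less.prems h(2) by blast
    consider "w < x" | "w = x" | "x < w" by (rule linorder_cases)
    then show ?case
    proof cases
      case 1
      then have "w \<in> X" using w(1) less.prems assms(1) unfolding set_less_def by force
      then show ?thesis using less.IH 1 w by force
    next
      case 3
      then have lt: "h x < x" using cover_less[OF h(1), of x w] less.prems w by simp
      then have "h x \<in> X"
        using h(2) less.prems assms(2) unfolding set_less_def by (metis UnE UnI1 image_eqI less_asym)
      then have "h (h x) = h x" using less.IH lt by blast
      then show ?thesis
        using cover_inj[OF h(1)] less.prems \<open>h x \<in> X\<close> lt by (metis UnI1 inj_on_eq_iff)
    qed (use w in simp)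
  qed
  have disj: "X \<inter> Z = {}" "X \<inter> Y = {}"
    using assms unfolding set_less_def by force+
  have hXX: "h ` X = X" using hX by simp
  have "h ` X \<inter> h ` Y = {}"
    using inj_on_image_Int[OF cover_inj[OF h(1)], of X Y] disj by simp
  moreover have "X \<union> Z = X \<union> h ` Y"
    unfolding h(2) image_Un hXX ..
  ultimately have "h ` Y = Z" using disj(1) unfolding hXX by blast
  with h hX show "\<exists>h. cover (X \<union> Y) h \<and> (\<forall>x\<in>X. h x = x) \<and> h ` Y = Z" by blast
next
  assume "\<exists>h. cover (X \<union> Y) h \<and> (\<forall>x\<in>X. h x = x) \<and> h ` Y = Z"
  then obtain h where h: "cover (X \<union> Y) h" "\<forall>x\<in>X. h x = x" "h ` Y = Z" by blast
  then have "X \<union> Z = h ` (X \<union> Y)" by (auto simp: image_Un)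
  with h show "is_covering_of r (le1 r) (le2 r) (X \<union> Z) (X \<union> Y)"
    unfolding is_covering_of_def by blast
qed

section \<open>The relations in terms of coverings\<close>

text \<open>Common form of the condition for \<open>\<sqsubseteq>\<^sub>1\<close> and of the
  downward clause for \<open>\<sqsubseteq>\<^sub>2\<close>: a single closed set \<open>S\<close>
  replaces its parts \<open>X\<close> below \<open>a\<close> and \<open>Y\<close> from
  \<open>a\<close> on. The predicates carry the extra demand of the downward clause and are
  constantly false for \<open>\<sqsubseteq>\<^sub>1\<close>.\<close>

definition reflects :: "'o \<Rightarrow> 'o \<Rightarrow> ('o \<Rightarrow> bool) \<Rightarrow> ('o \<Rightarrow> bool) \<Rightarrow> bool" where
  "reflects a b P Q \<longleftrightarrow>
     (\<forall>S. finite S \<and> closed S \<and> S \<subseteq> {..<b} \<longrightarrow>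
       (\<exists>h. cover S h \<and> (\<forall>z\<in>S. z < a \<longrightarrow> h z = z) \<and> h ` S \<subseteq> {..<a} \<and>
         (\<forall>z\<in>S. a \<le> z \<and> P z \<longrightarrow> Q (h z))))"

lemma reflectsE:
  assumes "reflects a b P Q" "finite S" "closed S" "S \<subseteq> {..<b}"
  obtains h where "cover S h" "\<And>z. z \<in> S \<Longrightarrow> z < a \<Longrightarrow> h z = z" "\<And>z. z \<in> S \<Longrightarrow> h z < a"
    "\<And>z. z \<in> S \<Longrightarrow> a \<le> z \<Longrightarrow> P z \<Longrightarrow> Q (h z)"
proof -
  obtain h where "cover S h" "\<forall>z\<in>S. z < a \<longrightarrow> h z = z" "h ` S \<subseteq> {..<a}"
      "\<forall>z\<in>S. a \<le> z \<and> P z \<longrightarrow> Q (h z)"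
    using assms(1)[unfolded reflects_def, rule_format, of S] assms(2-) by blast
  then show thesis by (intro that[of h]) auto
qed

lemma reflectsI:
  assumes "\<And>S. finite S \<Longrightarrow> closed S \<Longrightarrow> S \<subseteq> {..<b} \<Longrightarrow>
       (\<exists>h. cover S h \<and> (\<forall>z\<in>S. z < a \<longrightarrow> h z = z) \<and> (\<forall>z\<in>S. h z < a) \<and>
         (\<forall>z\<in>S. a \<le> z \<and> P z \<longrightarrow> Q (h z)))"
  shows "reflects a b P Q"
  unfolding reflects_def image_subset_iff lessThan_iff by (intro allI impI assms) auto

text \<open>Serves both to pass from the downward clause to \<open>\<sqsubseteq>\<^sub>1\<close> and
  to shrink the right end of \<open>\<sqsubseteq>\<^sub>1\<close>.\<close>

lemma reflects_weaken:
  assumes "reflects a b P Q" "c \<le> b"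
  shows "reflects a c (\<lambda>_. False) (\<lambda>_. False)"
proof (rule reflectsI)
  fix S assume S: "finite S" "closed S" "S \<subseteq> {..<c}"
  with assms(2) have "S \<subseteq> {..<b}" by fastforce
  with assms(1) S(1,2) obtain h where "cover S h" "\<And>z. z \<in> S \<Longrightarrow> z < a \<Longrightarrow> h z = z"
      "\<And>z. z \<in> S \<Longrightarrow> h z < a"
    by (rule reflectsE) blast
  then show "\<exists>h. cover S h \<and> (\<forall>z\<in>S. z < a \<longrightarrow> h z = z) \<and> (\<forall>z\<in>S. h z < a) \<and>
      (\<forall>z\<in>S. a \<le> z \<and> False \<longrightarrow> False)"
    by blast
qed

text \<open>Turns the comparison of the i-th elements of \<open>Y\<close> and of its copy into a
  comparison of \<open>z\<close> with \<open>h z\<close>.\<close>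

lemma sorted_list_of_set_image_strict_mono:
  assumes "finite Y" "strict_mono_on Y (h :: 'o \<Rightarrow> 'o)"
  shows "sorted_list_of_set (h ` Y) = map h (sorted_list_of_set Y)"
proof (rule sym, rule strict_sorted_equal)
  have "sorted_wrt (\<lambda>x y. h x < h y) (sorted_list_of_set Y)"
    by (rule sorted_wrt_mono_rel[of _ "(<)"])
      (use assms strict_sorted_list_of_set in \<open>auto simp: strict_mono_on_def\<close>)
  then show "sorted_wrt (<) (map h (sorted_list_of_set Y))"
    by (simp add: sorted_wrt_map)
qed (use assms in auto)

text \<open>\<open>S\<close> is cut at \<open>a\<close> into \<open>X\<close> and \<open>Y\<close>.
  By \<open>is_covering_of_iff\<close> a covering set containing \<open>X\<close> as initial part
  comes from a map fixing \<open>X\<close>, and positions in the sorted lists correspond under this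
  map.\<close>

lemma reflects_iff:
  assumes "a \<le> b"
  shows "reflects a b P Q \<longleftrightarrow>
     (\<forall>X Y. finite X \<and> finite Y \<and> X \<subseteq> {..<a} \<and> Y \<subseteq> {a..<b} \<and> closed (X \<union> Y) \<longrightarrow>
        (\<exists>Z. finite Z \<and> Z \<subseteq> {..<a} \<and> X \<lless> Z \<and> is_covering_of r (le1 r) (le2 r) (X \<union> Z) (X \<union> Y) \<and>
           (\<forall>i<card Y. P (sorted_list_of_set Y ! i) \<longrightarrow> Q (sorted_list_of_set Z ! i))))"
    (is "_ \<longleftrightarrow> ?R")
proof
  assume L: "reflects a b P Q"
  show ?R
  proof (intro allI impI)
    fix X Y
    assume XY: "finite X \<and> finite Y \<and> X \<subseteq> {..<a} \<and> Y \<subseteq> {a..<b} \<and> closed (X \<union> Y)"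
    then have "X \<union> Y \<subseteq> {..<b}" using assms by fastforce
    then obtain h where h: "cover (X \<union> Y) h" "\<And>z. z \<in> X \<union> Y \<Longrightarrow> z < a \<Longrightarrow> h z = z"
        "\<And>z. z \<in> X \<union> Y \<Longrightarrow> h z < a" "\<And>z. z \<in> X \<union> Y \<Longrightarrow> a \<le> z \<Longrightarrow> P z \<Longrightarrow> Q (h z)"
      using reflectsE[OF L] XY by (metis finite_Un)
    have less: "X \<lless> Y" using XY unfolding set_less_def by fastforce
    have "X \<lless> h ` Y"
      unfolding set_less_def
    proof safe
      fix x y assume "x \<in> X" "y \<in> Y"
      then have "h x < h y" "h x = x"
        using cover_less[OF h(1)] less h(2) XY by (auto simp: set_less_def)
      then show "x < h y" by simp
    qed
    moreover have "is_covering_of r (le1 r) (le2 r) (X \<union> h ` Y) (X \<union> Y)"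
      unfolding is_covering_of_iff[OF less \<open>X \<lless> h ` Y\<close>]
      using h(1,2) XY by (intro exI[of _ h]) auto
    moreover have "Q (sorted_list_of_set (h ` Y) ! i)"
      if "i < card Y" "P (sorted_list_of_set Y ! i)" for i
    proof -
      have "strict_mono_on Y h"
        using h(1) by (auto simp: covering_def strict_mono_on_def)
      then have "sorted_list_of_set (h ` Y) = map h (sorted_list_of_set Y)"
        using XY by (intro sorted_list_of_set_image_strict_mono) auto
      moreover have "sorted_list_of_set Y ! i \<in> Y"
        using that(1) XY by (metis length_sorted_list_of_set nth_mem set_sorted_list_of_set)
      ultimately show ?thesis
        using that h(4)[of "sorted_list_of_set Y ! i"] XY by force
    qed
    ultimately show "\<exists>Z. finite Z \<and> Z \<subseteq> {..<a} \<and> X \<lless> Z \<and>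
        is_covering_of r (le1 r) (le2 r) (X \<union> Z) (X \<union> Y) \<and>
           (\<forall>i<card Y. P (sorted_list_of_set Y ! i) \<longrightarrow> Q (sorted_list_of_set Z ! i))"
      using XY h(3) by (intro exI[of _ "h ` Y"]) auto
  qed
next
  assume R: ?R
  show "reflects a b P Q"
  proof (rule reflectsI)
    fix S assume S: "finite S" "closed S" "S \<subseteq> {..<b}"
    define X where "X = S \<inter> {..<a}"
    define Y where "Y = S \<inter> {a..}"
    have XY: "S = X \<union> Y" "finite X" "finite Y" "X \<subseteq> {..<a}" "Y \<subseteq> {a..<b}"
      using S unfolding X_def Y_def by auto
    then obtain Z where Z: "finite Z" "Z \<subseteq> {..<a}" "X \<lless> Z"
        "is_covering_of r (le1 r) (le2 r) (X \<union> Z) (X \<union> Y)"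
        "\<forall>i<card Y. P (sorted_list_of_set Y ! i) \<longrightarrow> Q (sorted_list_of_set Z ! i)"
      using R S(2) by metis
    have less: "X \<lless> Y" using XY unfolding set_less_def by fastforce
    obtain h where h: "cover (X \<union> Y) h" "\<forall>x\<in>X. h x = x" "h ` Y = Z"
      using Z(4) is_covering_of_iff[OF less Z(3)] by blast
    have "strict_mono_on Y h"
      using h(1) by (auto simp: covering_def strict_mono_on_def)
    then have sorted: "sorted_list_of_set Z = map h (sorted_list_of_set Y)"
      unfolding h(3)[symmetric] using XY by (intro sorted_list_of_set_image_strict_mono)
    have "Q (h z)" if z: "z \<in> Y" "P z" for z
    proof -
      obtain i where i: "i < card Y" "z = sorted_list_of_set Y ! i"
        using z(1) XY(3) by (metis in_set_conv_nth length_sorted_list_of_set set_sorted_list_of_set)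
      then show ?thesis using Z(5) z(2) sorted by auto
    qed
    then show "\<exists>h. cover S h \<and> (\<forall>z\<in>S. z < a \<longrightarrow> h z = z) \<and> (\<forall>z\<in>S. h z < a) \<and>
         (\<forall>z\<in>S. a \<le> z \<and> P z \<longrightarrow> Q (h z))"
      using h XY Z(2) by (intro exI[of _ h]) force
  qed
qed

lemma le1_iff_reflects: "a \<sqsubseteq>\<^sub>1 b \<longleftrightarrow> a \<le> b \<and> reflects a b (\<lambda>_. False) (\<lambda>_. False)"
  unfolding le1_iff[of r a b] le1_clause_def by (rule conj_cong[OF refl]) (simp add: reflects_iff)

lemma le2_down_iff:
  "a \<le> b \<Longrightarrow> le2_down r (le1 r) (le2 r) a b \<longleftrightarrow> reflects a b (\<lambda>z. z \<sqsubseteq>\<^sub>1 b) (\<lambda>z. z \<sqsubseteq>\<^sub>1 a)"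
  unfolding le2_down_def by (rule reflects_iff[symmetric])

section \<open>Cofinally many copies and the upward clause\<close>

definition cofinal :: "'o set \<Rightarrow> 'o set \<Rightarrow> 'o \<Rightarrow> bool" where
  "cofinal X Y a \<longleftrightarrow>
     (\<forall>c<a. \<exists>h. cover (X \<union> Y) h \<and> (\<forall>x\<in>X. h x = x) \<and> h ` Y \<subseteq> {c<..<a})"

lemma cofinally_many_iff:
  assumes "finite X" "finite Y" "X \<subseteq> {..<a}" "X \<lless> Y"
  shows "cofinally_many r (le1 r) (le2 r) X Y a \<longleftrightarrow> cofinal X Y a"
proof
  assume L: "cofinally_many r (le1 r) (le2 r) X Y a"
  show "cofinal X Y a"
    unfolding cofinal_def
  proof (intro allI impI)
    fix c assume "c < a"
    \<comment> \<open>Raising the bound to the maximum of \<open>X\<close> puts the copy above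
      \<open>X\<close>, which is what makes the covering fix \<open>X\<close>.\<close>
    define d where "d = Max (insert c X)"
    have d: "d < a" "c \<le> d" "\<forall>x\<in>X. x \<le> d"
      unfolding d_def using assms(1,3) \<open>c < a\<close> by auto
    then obtain Z where Z: "finite Z" "Z \<subseteq> {d<..<a}"
        "is_covering_of r (le1 r) (le2 r) (X \<union> Z) (X \<union> Y)"
      using L unfolding cofinally_many_def by blast
    have "X \<lless> Z" using Z(2) d(3) unfolding set_less_def by force
    then obtain h where "cover (X \<union> Y) h" "\<forall>x\<in>X. h x = x" "h ` Y = Z"
      using Z(3) is_covering_of_iff[OF assms(4)] by blast
    then show "\<exists>h. cover (X \<union> Y) h \<and> (\<forall>x\<in>X. h x = x) \<and> h ` Y \<subseteq> {c<..<a}"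
      using Z(2) d(2) by (intro exI[of _ h]) force
  qed
next
  assume R: "cofinal X Y a"
  show "cofinally_many r (le1 r) (le2 r) X Y a"
    unfolding cofinally_many_def
  proof (intro allI impI)
    fix c assume "c < a"
    then obtain h where h: "cover (X \<union> Y) h" "\<forall>x\<in>X. h x = x" "h ` Y \<subseteq> {c<..<a}"
      using R unfolding cofinal_def by blast
    then have "X \<union> h ` Y = h ` (X \<union> Y)" by (auto simp: image_Un)
    then show "\<exists>Z. finite Z \<and> Z \<subseteq> {c<..<a} \<and> is_covering_of r (le1 r) (le2 r) (X \<union> Z) (X \<union> Y)"
      using h assms(2) unfolding is_covering_of_def by (intro exI[of _ "h ` Y"]) auto
  qed
qed

lemma le2_up_iff:
  assumes "a \<le> b"
  shows "le2_up r (le1 r) (le2 r) a b \<longleftrightarrow>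
    (\<forall>X Y. finite X \<and> finite Y \<and> X \<subseteq> {..<a} \<and> Y \<subseteq> {..<a} \<and> closed (X \<union> Y) \<and> X \<lless> Y \<longrightarrow>
        cofinal X Y a \<longrightarrow> cofinal X Y b)"
proof -
  have "X \<subseteq> {..<b}" if "X \<subseteq> {..<a}" for X
    using that assms by fastforce
  then show ?thesis
    unfolding le2_up_def by (intro all_cong1 imp_cong refl) (simp_all add: cofinally_many_iff)
qed

lemma le2_iff_reflects:
  "a \<sqsubseteq>\<^sub>2 b \<longleftrightarrow> a \<le> b \<and> reflects a b (\<lambda>z. z \<sqsubseteq>\<^sub>1 b) (\<lambda>z. z \<sqsubseteq>\<^sub>1 a) \<and>
    (\<forall>X Y. finite X \<and> finite Y \<and> X \<subseteq> {..<a} \<and> Y \<subseteq> {..<a} \<and> closed (X \<union> Y) \<and> X \<lless> Y \<longrightarrow>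
        cofinal X Y a \<longrightarrow> cofinal X Y b)"
  unfolding le2_iff[of r a b] le2_clause_def
  using le2_up_iff[of a b] le2_down_iff[of a b] by blast

section \<open>First properties of the two relations\<close>

lemma le1_le: "a \<sqsubseteq>\<^sub>1 b \<Longrightarrow> a \<le> b"
  by (simp add: le1_iff_reflects)

lemma le1E:
  assumes "a \<sqsubseteq>\<^sub>1 b" "finite S" "closed S" "S \<subseteq> {..<b}"
  obtains h where "cover S h" "\<And>z. z \<in> S \<Longrightarrow> z < a \<Longrightarrow> h z = z" "\<And>z. z \<in> S \<Longrightarrow> h z < a"
proof -
  have "reflects a b (\<lambda>_. False) (\<lambda>_. False)" using assms(1) by (simp add: le1_iff_reflects)
  then show thesis using assms(2-) by (rule reflectsE) (rule that)
qed

lemma le1I: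
  assumes "a \<le> b"
    and "\<And>S. finite S \<Longrightarrow> closed S \<Longrightarrow> S \<subseteq> {..<b} \<Longrightarrow>
       \<exists>h. cover S h \<and> (\<forall>z\<in>S. z < a \<longrightarrow> h z = z) \<and> (\<forall>z\<in>S. h z < a)"
  shows "a \<sqsubseteq>\<^sub>1 b"
  unfolding le1_iff_reflects
proof (rule conjI[OF assms(1)], rule reflectsI)
  fix S assume "finite S" "closed S" "S \<subseteq> {..<b}"
  then have "\<exists>h. cover S h \<and> (\<forall>z\<in>S. z < a \<longrightarrow> h z = z) \<and> (\<forall>z\<in>S. h z < a)"
    by (rule assms(2))
  then show "\<exists>h. cover S h \<and> (\<forall>z\<in>S. z < a \<longrightarrow> h z = z) \<and> (\<forall>z\<in>S. h z < a) \<and>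
      (\<forall>z\<in>S. a \<le> z \<and> False \<longrightarrow> False)"
    by blast
qed

lemma le2_imp_le1: "a \<sqsubseteq>\<^sub>2 b \<Longrightarrow> a \<sqsubseteq>\<^sub>1 b"
  unfolding le2_iff_reflects le1_iff_reflects by (auto elim: reflects_weaken)

lemma le1_interval: "a \<sqsubseteq>\<^sub>1 b \<Longrightarrow> a \<le> c \<Longrightarrow> c \<le> b \<Longrightarrow> a \<sqsubseteq>\<^sub>1 c"
  unfolding le1_iff_reflects by (auto elim: reflects_weaken)

text \<open>Cover below \<open>b\<close> first and then below \<open>a\<close>. The first map fixes
  everything below \<open>b\<close>, so the composite fixes everything below
  \<open>a\<close>.\<close>

lemma le1_trans:
  assumes "a \<sqsubseteq>\<^sub>1 b" "b \<sqsubseteq>\<^sub>1 c"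
  shows "a \<sqsubseteq>\<^sub>1 c"
proof (rule le1I)
  show "a \<le> c" using assms le1_le order.trans by blast
next
  fix S assume S: "finite S" "closed S" "S \<subseteq> {..<c}"
  obtain h where h: "cover S h" "\<And>z. z \<in> S \<Longrightarrow> z < b \<Longrightarrow> h z = z" "\<And>z. z \<in> S \<Longrightarrow> h z < b"
    using assms(2) S by (rule le1E) blast
  have "closed (h ` S)" using S h closed_cover_image by blast
  then obtain g where g: "cover (h ` S) g" "\<And>z. z \<in> h ` S \<Longrightarrow> z < a \<Longrightarrow> g z = z"
      "\<And>z. z \<in> h ` S \<Longrightarrow> g z < a"
    using le1E[OF assms(1), of "h ` S"] S(1) h(3) by (metis finite_imageI image_subset_iff lessThan_iff)
  have "g (h z) = z" if "z \<in> S" "z < a" for z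
    using that h(2)[of z] g(2)[of z] le1_le[OF assms(1)]
    by (metis image_eqI order.strict_trans2)
  then show "\<exists>h. cover S h \<and> (\<forall>z\<in>S. z < a \<longrightarrow> h z = z) \<and> (\<forall>z\<in>S. h z < a)"
    using cover_comp[OF h(1) g(1)] g(3) by (intro exI[of _ "\<lambda>z. g (h z)"]) blast
qed

lemma le2_refl: "a \<sqsubseteq>\<^sub>2 a"
proof -
  have "reflects a a (\<lambda>z. z \<sqsubseteq>\<^sub>1 a) (\<lambda>z. z \<sqsubseteq>\<^sub>1 a)"
    unfolding reflects_def by (intro allI impI exI[of _ "\<lambda>x. x"]) (simp add: cover_id)
  then show ?thesis unfolding le2_iff_reflects by blast
qed

text \<open>A reflection would fix the block start \<open>t\<close>, hence also
  \<open>t +\<^sub>o e\<close>, which it should move below itself.\<close>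

lemma le1_nonmultiple:
  assumes "r dvd\<^sub>o t" "ozero < e" "e < r" "t +\<^sub>o e \<sqsubseteq>\<^sub>1 b"
  shows "b = t +\<^sub>o e"
proof (rule ccontr)
  assume "b \<noteq> t +\<^sub>o e"
  then have lt: "t +\<^sub>o e < b" using le1_le[OF assms(4)] by simp
  have t: "t < t +\<^sub>o e" using oadd_strict_mono[OF assms(2), of t] by simp
  have c: "closed {t, t +\<^sub>o e}" using assms closed_floor by blast
  have "{t, t +\<^sub>o e} \<subseteq> {..<b}" using lt t by simp
  then obtain h where h: "cover {t, t +\<^sub>o e} h" "\<And>z. z \<in> {t, t +\<^sub>o e} \<Longrightarrow> z < t +\<^sub>o e \<Longrightarrow> h z = z"
      "\<And>z. z \<in> {t, t +\<^sub>o e} \<Longrightarrow> h z < t +\<^sub>o e"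
    using le1E[OF assms(4) _ c] by (metis finite.emptyI finite_insert)
  have "h (t +\<^sub>o e) = h t +\<^sub>o e" using cover_oadd[OF c h(1)] assms by simp
  moreover have "h t = t" using h(2) t by simp
  ultimately show False using h(3) by force
qed

text \<open>The singleton of zero has no copy below zero.\<close>

lemma le1_ozero:
  assumes "ozero \<sqsubseteq>\<^sub>1 b"
  shows "b = ozero"
proof (rule ccontr)
  assume "b \<noteq> ozero"
  then have "{ozero} \<subseteq> {..<b}" by (simp add: ozero_less_iff)
  then show False
    using le1E[OF assms _ closed_multiple[OF odvd_ozero]]
    by (metis finite.emptyI finite_insert insertI1 ozero_not_less)
qed

section \<open>Minimal ordinals\<close>

abbreviation minimal where "minimal \<equiv> minimal1 r"

lemma minimalD: "minimal k \<Longrightarrow> x \<sqsubseteq>\<^sub>1 k \<Longrightarrow> x = k"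
  by (auto simp: minimal1_def)

text \<open>Shrinking the right end to \<open>k\<close> would give \<open>k\<close> a proper
  predecessor. A minimal ordinal thus separates what lies below it from the rest.\<close>

lemma minimal_not_le1: "minimal k \<Longrightarrow> x < k \<Longrightarrow> k \<le> y \<Longrightarrow> \<not> x \<sqsubseteq>\<^sub>1 y"
  using le1_interval[of x y k] minimalD[of k x] by auto

text \<open>The least \<open>\<sqsubseteq>\<^sub>1\<close>-predecessor of \<open>x\<close> is
  minimal by transitivity.\<close>

lemma minimal_pred:
  obtains k where "minimal k" "k \<sqsubseteq>\<^sub>1 x"
proof -
  define k where "k = (LEAST k. k \<sqsubseteq>\<^sub>1 x)"
  have k: "k \<sqsubseteq>\<^sub>1 x" unfolding k_def using le1_refl by (rule LeastI)
  have "minimal k"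
    unfolding minimal1_def
  proof
    assume "\<exists>u. u \<sqsubseteq>\<^sub>1 k \<and> u \<noteq> k"
    then obtain u where u: "u \<sqsubseteq>\<^sub>1 k" "u \<noteq> k" by blast
    then have "u \<sqsubseteq>\<^sub>1 x" using k le1_trans by blast
    then have "k \<le> u" unfolding k_def by (rule Least_le)
    then show False using u le1_le[of u k] by simp
  qed
  with k that show ?thesis by blast
qed

text \<open>The second half of the downward clause, applied to \<open>{a}\<close>, yields a proper
  \<open>\<le>\<^sub>1\<close>-predecessor of \<open>a\<close>.\<close>

lemma minimal_le2:
  assumes "minimal a" "a \<sqsubseteq>\<^sub>2 b"
  shows "b = a"
proof (rule ccontr)
  assume "b \<noteq> a"
  have le1: "a \<sqsubseteq>\<^sub>1 b" using assms(2) by (rule le2_imp_le1)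
  then have "a < b" using \<open>b \<noteq> a\<close> le1_le[OF le1] by simp
  obtain t e where t: "a = t +\<^sub>o e" "r dvd\<^sub>o t" "e < r" by (rule odvd_floor)
  then have "e = ozero" using le1_nonmultiple[of t e b] le1 \<open>b \<noteq> a\<close> by (auto simp: ozero_less_iff)
  then have "closed {a}" using t closed_multiple by simp
  moreover have "reflects a b (\<lambda>z. z \<sqsubseteq>\<^sub>1 b) (\<lambda>z. z \<sqsubseteq>\<^sub>1 a)"
    using assms(2) by (simp add: le2_iff_reflects)
  moreover have "finite {a}" "{a} \<subseteq> {..<b}" using \<open>a < b\<close> by auto
  ultimately obtain h where "h a < a" "h a \<sqsubseteq>\<^sub>1 a"
    using reflectsE[of a b _ _ "{a}"] le1 by (metis insertI1 order.refl)
  then show False using minimalD[OF assms(1), of "h a"] by simp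
qed

section \<open>Translation by a minimal multiple of \<open>\<rho>\<close>\<close>

text \<open>As \<open>l\<close> is a multiple, no block straddles it, so the block start of a
  translate is again a translate.\<close>

lemma closed_translate:
  assumes "r dvd\<^sub>o l" "closed S"
  shows "closed ((+\<^sub>o) l ` S)"
proof (rule closedI)
  fix t \<xi> assume t: "r dvd\<^sub>o t" "\<xi> < r" "t +\<^sub>o \<xi> \<in> (+\<^sub>o) l ` S"
  then obtain s where s: "s \<in> S" "t +\<^sub>o \<xi> = l +\<^sub>o s" by blast
  have "l \<le> t"
  proof (rule ccontr)
    assume "\<not> l \<le> t"
    then have "t +\<^sub>o r \<le> l" using odvd_less assms(1) t(1) by simp
    also have "l \<le> t +\<^sub>o \<xi>" unfolding s(2) by (rule le_oadd)
    finally show False using t(2) by (simp add: not_le[symmetric])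
  qed
  then obtain u where u: "t = l +\<^sub>o u" by (rule oadd_diff_exists)
  then have "s = u +\<^sub>o \<xi>" "r dvd\<^sub>o u"
    using s(2) t(1) assms(1) by (auto simp: oadd_assoc dest: odvd_oaddD)
  then show "t \<in> (+\<^sub>o) l ` S"
    using u s(1) t(2) assms(2) closedD by blast
qed

lemma closed_untranslate:
  assumes "r dvd\<^sub>o l" "closed S"
  shows "closed {s. l +\<^sub>o s \<in> S}"
  by (rule closedI) (use assms in \<open>auto simp: oadd_assoc[symmetric] dest: closedD odvd_oadd\<close>)

lemma finite_untranslate: "finite S \<Longrightarrow> finite {s. l +\<^sub>o s \<in> S}"
  by (rule finite_vimageI[of S "(+\<^sub>o) l", unfolded vimage_def]) (auto intro: injI)

text \<open>Zero is excluded as left argument: it is related only to itself, whereas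
  \<open>l\<close> may have many successors.\<close>

definition translatable :: "'o \<Rightarrow> 'o set \<Rightarrow> bool" where
  "translatable l S \<longleftrightarrow> (\<forall>x\<in>S. \<forall>y\<in>S. ozero < x \<longrightarrow>
     (x \<sqsubseteq>\<^sub>1 y \<longleftrightarrow> l +\<^sub>o x \<sqsubseteq>\<^sub>1 l +\<^sub>o y) \<and> (x \<sqsubseteq>\<^sub>2 y \<longleftrightarrow> l +\<^sub>o x \<sqsubseteq>\<^sub>2 l +\<^sub>o y))"

lemma translatableD:
  assumes "translatable l S" "x \<in> S" "y \<in> S" "ozero < x"
  shows "x \<sqsubseteq>\<^sub>1 y \<longleftrightarrow> l +\<^sub>o x \<sqsubseteq>\<^sub>1 l +\<^sub>o y" "x \<sqsubseteq>\<^sub>2 y \<longleftrightarrow> l +\<^sub>o x \<sqsubseteq>\<^sub>2 l +\<^sub>o y"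
  using assms unfolding translatable_def by blast+

text \<open>No relation leads from below a minimal ordinal to it or beyond, so the part of a set below it
  can be covered independently of the rest.\<close>

lemma cover_Un_minimal:
  assumes "minimal l" "X \<subseteq> {..<l}" "Y \<subseteq> {l..}" "closed X" "closed Y"
    and "cover X h" "cover Y h" "h ` X \<lless> h ` Y"
  shows "cover (X \<union> Y) h"
proof (rule coverI)
  show "closed (X \<union> Y)" using assms closed_Un by blast
  show "h x < h y" if xy: "x \<in> X \<union> Y" "y \<in> X \<union> Y" "x < y" for x y
  proof -
    consider "x \<in> X" "y \<in> X" | "x \<in> Y" "y \<in> Y" | "x \<in> X" "y \<in> Y" | "x \<in> Y" "y \<in> X"
      using xy(1,2) by blast
    then show ?thesis
    proof cases
      case 4
      then have "y < x" using assms(2,3) by fastforce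
      with xy show ?thesis by simp
    qed (use xy(3) assms(6,7,8) cover_less in \<open>auto simp: set_less_def\<close>)
  qed
  show "r dvd\<^sub>o h t \<and> h (t +\<^sub>o \<xi>) = h t +\<^sub>o \<xi>"
    if t: "r dvd\<^sub>o t" "\<xi> < r" "t +\<^sub>o \<xi> \<in> X \<union> Y" for t \<xi>
  proof -
    have "t +\<^sub>o \<xi> \<in> X \<or> t +\<^sub>o \<xi> \<in> Y" using t by blast
    then show ?thesis
      using t(1,2) closedD[OF assms(4), of t \<xi>] closedD[OF assms(5), of t \<xi>]
        cover_oadd[OF assms(4) assms(6), of t \<xi>] cover_oadd[OF assms(5) assms(7), of t \<xi>]
        cover_odvd[OF assms(6), of t] cover_odvd[OF assms(7), of t] by blast
  qed
  have cross: "x \<in> X \<and> y \<in> X \<or> x \<in> Y \<and> y \<in> Y"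
    if "x \<in> X \<union> Y" "y \<in> X \<union> Y" "x \<sqsubseteq>\<^sub>1 y" for x y
  proof -
    have "\<not> (x \<in> X \<and> y \<in> Y)"
      using minimal_not_le1[OF assms(1), of x y] that assms(2,3) by auto
    moreover have "\<not> (x \<in> Y \<and> y \<in> X)"
      using le1_le[OF that(3)] assms(2,3) by force
    ultimately show ?thesis using that(1,2) by blast
  qed
  show "h x \<sqsubseteq>\<^sub>1 h y" if "x \<in> X \<union> Y" "y \<in> X \<union> Y" "x \<sqsubseteq>\<^sub>1 y" for x y
    using cross[OF that] that(3) cover_le1[OF assms(6)] cover_le1[OF assms(7)] by blast
  show "h x \<sqsubseteq>\<^sub>2 h y" if "x \<in> X \<union> Y" "y \<in> X \<union> Y" "x \<sqsubseteq>\<^sub>2 y" for x y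
    using cross[OF that(1,2) le2_imp_le1[OF that(3)]] that(3)
      cover_le2[OF assms(6)] cover_le2[OF assms(7)] by blast
qed

text \<open>Away from zero, relations above \<open>l\<close> are translated back, preserved by
  \<open>g\<close> and translated to \<open>l'\<close>. Relations starting at \<open>l\<close>
  itself are handled separately: \<open>head\<close> provides those for
  \<open>\<sqsubseteq>\<^sub>1\<close>, and a minimal \<open>l\<close> has no proper
  \<open>\<sqsubseteq>\<^sub>2\<close>-successor. The part \<open>X\<close> below \<open>l\<close>
  stays fixed.\<close>

lemma cover_translate:
  assumes l: "minimal l" "r dvd\<^sub>o l" and l': "r dvd\<^sub>o l'"
    and S: "closed S" "cover S g" "translatable l S" "translatable l' (g ` S)"
    and head: "\<And>s. s \<in> S \<Longrightarrow> l' \<sqsubseteq>\<^sub>1 l' +\<^sub>o g s"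
    and zero: "ozero \<in> S \<Longrightarrow> g ozero = ozero"
    and pos: "\<And>s. s \<in> S \<Longrightarrow> ozero < s \<Longrightarrow> ozero < g s"
    and X: "closed X" "X \<subseteq> {..<l}" "X \<subseteq> {..<l'}"
  shows "cover (X \<union> (+\<^sub>o) l ` S) (\<lambda>x. if x < l then x else l' +\<^sub>o g (ominus x l))"
    (is "cover _ ?H")
proof -
  have H: "?H (l +\<^sub>o s) = l' +\<^sub>o g s" for s
    using le_oadd[of l s] by (auto simp: not_le[symmetric])
  have c: "closed ((+\<^sub>o) l ` S)" using l(2) S(1) by (rule closed_translate)
  have cS: "cover ((+\<^sub>o) l ` S) ?H"
  proof (rule coverI[OF c])
    fix x y assume "x \<in> (+\<^sub>o) l ` S" "y \<in> (+\<^sub>o) l ` S"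
    then obtain s u where s: "x = l +\<^sub>o s" "s \<in> S" "y = l +\<^sub>o u" "u \<in> S" by blast
    show "?H x < ?H y" if "x < y"
      using that s cover_less[OF S(2)] unfolding s(1,3) H by simp
    show "?H x \<sqsubseteq>\<^sub>1 ?H y" if r1: "x \<sqsubseteq>\<^sub>1 y"
    proof (cases "s = ozero")
      case True
      then show ?thesis
        using zero head[OF s(4)] s(2) unfolding s(1,3) H by simp
    next
      case False
      then have "ozero < s" by (simp add: ozero_less_iff)
      then have "s \<sqsubseteq>\<^sub>1 u" using r1 s translatableD(1)[OF S(3)] by blast
      then have "g s \<sqsubseteq>\<^sub>1 g u" using cover_le1[OF S(2)] s by blast
      then show ?thesis
        using translatableD(1)[OF S(4)] pos[OF s(2) \<open>ozero < s\<close>] s(2,4) unfolding s(1,3) H by blast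
    qed
    show "?H x \<sqsubseteq>\<^sub>2 ?H y" if r2: "x \<sqsubseteq>\<^sub>2 y"
    proof (cases "s = ozero")
      case True
      then have "y = x" using minimal_le2[OF l(1)] r2 s(1) by simp
      then show ?thesis using le2_refl by simp
    next
      case False
      then have "ozero < s" by (simp add: ozero_less_iff)
      then have "s \<sqsubseteq>\<^sub>2 u" using r2 s translatableD(2)[OF S(3)] by blast
      then have "g s \<sqsubseteq>\<^sub>2 g u" using cover_le2[OF S(2)] s by blast
      then show ?thesis
        using translatableD(2)[OF S(4)] pos[OF s(2) \<open>ozero < s\<close>] s(2,4) unfolding s(1,3) H by blast
    qed
  next
    fix t \<xi> assume t: "r dvd\<^sub>o t" "\<xi> < r" "t \<in> (+\<^sub>o) l ` S" "t +\<^sub>o \<xi> \<in> (+\<^sub>o) l ` S"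
    then obtain u where u: "t = l +\<^sub>o u" "u \<in> S" "u +\<^sub>o \<xi> \<in> S"
      by (auto simp: oadd_assoc)
    then have "r dvd\<^sub>o u" using t l(2) odvd_oaddD by blast
    then have "r dvd\<^sub>o g u" "g (u +\<^sub>o \<xi>) = g u +\<^sub>o \<xi>"
      using cover_odvd[OF S(2)] cover_oadd[OF S(1,2)] u t(2) by blast+
    then show "r dvd\<^sub>o ?H t \<and> ?H (t +\<^sub>o \<xi>) = ?H t +\<^sub>o \<xi>"
      unfolding u(1) oadd_assoc[of l] H using l' odvd_oadd by (simp add: oadd_assoc)
  qed
  show ?thesis
  proof (rule cover_Un_minimal[OF l(1) X(2) _ X(1) c _ cS])
    show "(+\<^sub>o) l ` S \<subseteq> {l..}" by (auto simp: le_oadd)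
    have id: "?H x = x" if "x \<in> X" for x using that X(2) by auto
    show "cover X ?H" using cover_id[of X] cover_cong[of X ?H "\<lambda>x. x", OF id] by simp
    show "?H ` X \<lless> ?H ` (+\<^sub>o) l ` S"
      unfolding set_less_def
    proof (intro ballI, elim imageE)
      fix a b x y s assume *: "a = ?H x" "x \<in> X" "b = ?H y" "y = l +\<^sub>o s"
      have "a < l'" using id[OF *(2)] *(1,2) X(3) by auto
      also have "l' \<le> b" unfolding *(3,4) H by (rule le_oadd)
      finally show "a < b" .
    qed
  qed
qed

text \<open>The passage opposite to \<open>cover_translate\<close>. Relations starting at zero are
  trivial here, so no condition on the image of zero is imposed.\<close>

lemma cover_untranslate:
  assumes l: "r dvd\<^sub>o l" "r dvd\<^sub>o l'"
    and S: "closed S" "translatable l S" "translatable l' (g ` S)"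
    and G: "cover ((+\<^sub>o) l ` S) G" "\<And>s. s \<in> S \<Longrightarrow> G (l +\<^sub>o s) = l' +\<^sub>o g s"
    and pos: "\<And>s. s \<in> S \<Longrightarrow> ozero < s \<Longrightarrow> ozero < g s"
  shows "cover S g"
proof (rule coverI[OF S(1)])
  fix x y assume xy: "x \<in> S" "y \<in> S"
  show "g x < g y" if "x < y"
    using cover_less[OF G(1), of "l +\<^sub>o x" "l +\<^sub>o y"] G(2) xy that by simp
  show "g x \<sqsubseteq>\<^sub>1 g y" if r1: "x \<sqsubseteq>\<^sub>1 y"
  proof (cases "x = ozero")
    case True
    then have "y = x" using r1 le1_ozero by simp
    then show ?thesis using le1_refl by simp
  next
    case False
    then have "ozero < x" by (simp add: ozero_less_iff)
    then have "l +\<^sub>o x \<sqsubseteq>\<^sub>1 l +\<^sub>o y" using r1 xy translatableD(1)[OF S(2)] by blast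
    then have "l' +\<^sub>o g x \<sqsubseteq>\<^sub>1 l' +\<^sub>o g y"
      using cover_le1[OF G(1), of "l +\<^sub>o x" "l +\<^sub>o y"] G(2) xy by simp
    then show ?thesis
      using translatableD(1)[OF S(3)] pos[OF xy(1) \<open>ozero < x\<close>] xy by blast
  qed
  show "g x \<sqsubseteq>\<^sub>2 g y" if r2: "x \<sqsubseteq>\<^sub>2 y"
  proof (cases "x = ozero")
    case True
    then have "y = x" using r2 le1_ozero le2_imp_le1 by simp
    then show ?thesis using le2_refl by simp
  next
    case False
    then have "ozero < x" by (simp add: ozero_less_iff)
    then have "l +\<^sub>o x \<sqsubseteq>\<^sub>2 l +\<^sub>o y" using r2 xy translatableD(2)[OF S(2)] by blast
    then have "l' +\<^sub>o g x \<sqsubseteq>\<^sub>2 l' +\<^sub>o g y"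
      using cover_le2[OF G(1), of "l +\<^sub>o x" "l +\<^sub>o y"] G(2) xy by simp
    then show ?thesis
      using translatableD(2)[OF S(3)] pos[OF xy(1) \<open>ozero < x\<close>] xy by blast
  qed
next
  fix t \<xi> assume t: "r dvd\<^sub>o t" "\<xi> < r" "t \<in> S" "t +\<^sub>o \<xi> \<in> S"
  have c: "closed ((+\<^sub>o) l ` S)" using l(1) S(1) by (rule closed_translate)
  have d: "r dvd\<^sub>o l +\<^sub>o t" using l t odvd_oadd by blast
  have m: "(l +\<^sub>o t) +\<^sub>o \<xi> \<in> (+\<^sub>o) l ` S" using t by (simp add: oadd_assoc)
  have "r dvd\<^sub>o l' +\<^sub>o g t"
    using cover_odvd[OF G(1) _ d] t(3) G(2)[of t] by simp
  moreover have "l' +\<^sub>o g (t +\<^sub>o \<xi>) = (l' +\<^sub>o g t) +\<^sub>o \<xi>"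
    using cover_oadd[OF c G(1) d t(2) m] G(2)[of "t +\<^sub>o \<xi>"] G(2)[of t] t by (simp add: oadd_assoc)
  then have "g (t +\<^sub>o \<xi>) = g t +\<^sub>o \<xi>" by (simp add: oadd_assoc)
  ultimately show "r dvd\<^sub>o g t \<and> g (t +\<^sub>o \<xi>) = g t +\<^sub>o \<xi>"
    using odvd_oaddD[OF l(2)] by simp
qed

text \<open>Coverings preserve and reflect order and \<open>fxi\<close>, so the passage from the
  copy given by \<open>h\<close> to the copy given by \<open>g\<close> can only fail on the two
  relations.\<close>

lemma cover_factor:
  assumes h: "cover S h" and g: "cover S g"
    and le1: "\<And>x y. x \<in> S \<Longrightarrow> y \<in> S \<Longrightarrow> h x \<sqsubseteq>\<^sub>1 h y \<Longrightarrow> g x \<sqsubseteq>\<^sub>1 g y"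
    and le2: "\<And>x y. x \<in> S \<Longrightarrow> y \<in> S \<Longrightarrow> h x \<sqsubseteq>\<^sub>2 h y \<Longrightarrow> g x \<sqsubseteq>\<^sub>2 g y"
  shows "cover (h ` S) (\<lambda>z. g (inv_into S h z))"
proof -
  have inv: "inv_into S h (h x) = x" if "x \<in> S" for x
    using that cover_inj[OF h] by simp
  show ?thesis
    unfolding covering_def strict_mono_on_def ball_simps
  proof (intro conjI allI impI ballI)
    fix x y assume "x \<in> h ` S \<and> y \<in> h ` S \<and> x < y"
    then show "g (inv_into S h x) < g (inv_into S h y)"
      using inv cover_less[OF h] cover_less[OF g] by auto
  next
    fix x y assume xy: "x \<in> S" "y \<in> S"
    show "g (inv_into S h (h x)) \<sqsubseteq>\<^sub>1 g (inv_into S h (h y))" if "h x \<sqsubseteq>\<^sub>1 h y"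
      using that xy inv le1 by simp
    show "g (inv_into S h (h x)) \<sqsubseteq>\<^sub>2 g (inv_into S h (h y))" if "h x \<sqsubseteq>\<^sub>2 h y"
      using that xy inv le2 by simp
    show "fxi r \<xi> (h x) = h y \<longleftrightarrow> fxi r \<xi> (g (inv_into S h (h x))) = g (inv_into S h (h y))"
      if "\<xi> < r" for \<xi>
      using that xy inv h g unfolding covering_def by metis
  qed
qed

text \<open>A pigeonhole argument: some isomorphism type of coverings of \<open>X \<union> Y\<close> occurs cofinally often.\<close>

lemma cofinal_refine:
  assumes fin: "finite X" "finite Y" and cof: "cofinal X Y a" and d: "d < a"
  obtains h where "cover (X \<union> Y) h" "\<And>x. x \<in> X \<Longrightarrow> h x = x" "h ` Y \<subseteq> {d<..<a}"
    "cofinal X (h ` Y) a"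
proof -
  define W where "W = (X \<union> Y) \<times> (X \<union> Y)"
  \<comment> \<open>The isomorphism type of a copy: the pairs of pattern elements whose images are
    related, of which there are finitely many possibilities.\<close>
  define T where "T = (\<lambda>h. ({(x, y) \<in> W. h x \<sqsubseteq>\<^sub>1 h y}, {(x, y) \<in> W. h x \<sqsubseteq>\<^sub>2 h y}))"
  define A where "A = (\<lambda>c. {h. cover (X \<union> Y) h \<and> (\<forall>x\<in>X. h x = x) \<and> h ` Y \<subseteq> {c<..<a}})"
  have "finite (Pow W \<times> Pow W)" using fin unfolding W_def by simp
  moreover have "T ` A c \<subseteq> Pow W \<times> Pow W" for c unfolding T_def by auto
  ultimately have finT: "finite (T ` A c)" for c using finite_subset by blast
  \<comment> \<open>The set of types occurring above \<open>c\<close> shrinks as \<open>c\<close>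
    grows. Where its cardinality is least, it has become constant, so each type present occurs
    arbitrarily high.\<close>
  obtain c where c: "d \<le> c" "c < a" "\<And>c'. d \<le> c' \<Longrightarrow> c' < a \<Longrightarrow> card (T ` A c) \<le> card (T ` A c')"
    using ex_has_least_nat[of "\<lambda>c. d \<le> c \<and> c < a" d "\<lambda>c. card (T ` A c)"] d by blast
  have anti: "A c' \<subseteq> A c" if "c \<le> c'" for c'
    using that unfolding A_def by fastforce
  have same: "T ` A c' = T ` A c" if "c \<le> c'" "c' < a" for c'
    using that c anti finT by (intro card_seteq) auto
  obtain h where h: "h \<in> A c"
    using cof c(2) unfolding cofinal_def A_def by blast
  show ?thesis
  proof
    show hc: "cover (X \<union> Y) h" and hX: "\<And>x. x \<in> X \<Longrightarrow> h x = x"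
      using h unfolding A_def by auto
    show "h ` Y \<subseteq> {d<..<a}" using h c(1) unfolding A_def by fastforce
    show "cofinal X (h ` Y) a"
      unfolding cofinal_def
    proof (intro allI impI)
      fix b assume "b < a"
      then have "T h \<in> T ` A (max b c)" using same[of "max b c"] c(2) h by simp
      then obtain g where g: "g \<in> A (max b c)" "T h = T g" by blast
      then have gc: "cover (X \<union> Y) g" and gX: "\<forall>x\<in>X. g x = x" and gY: "g ` Y \<subseteq> {max b c<..<a}"
        unfolding A_def by auto
      let ?k = "\<lambda>z. g (inv_into (X \<union> Y) h z)"
      have inv: "inv_into (X \<union> Y) h (h x) = x" if "x \<in> X \<union> Y" for x
        using that cover_inj[OF hc] by simp
      have T: "{(x, y) \<in> W. h x \<sqsubseteq>\<^sub>1 h y} = {(x, y) \<in> W. g x \<sqsubseteq>\<^sub>1 g y}"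
          "{(x, y) \<in> W. h x \<sqsubseteq>\<^sub>2 h y} = {(x, y) \<in> W. g x \<sqsubseteq>\<^sub>2 g y}"
        using g(2) unfolding T_def by auto
      have "cover (h ` (X \<union> Y)) ?k"
      proof (rule cover_factor[OF hc gc])
        fix x y assume "x \<in> X \<union> Y" "y \<in> X \<union> Y"
        then have "(x, y) \<in> W" unfolding W_def by blast
        then show "h x \<sqsubseteq>\<^sub>1 h y \<Longrightarrow> g x \<sqsubseteq>\<^sub>1 g y" "h x \<sqsubseteq>\<^sub>2 h y \<Longrightarrow> g x \<sqsubseteq>\<^sub>2 g y"
          using T by blast+
      qed
      moreover have "h ` (X \<union> Y) = X \<union> h ` Y" using hX by (auto simp: image_Un)
      moreover have "?k x = x" if "x \<in> X" for x
        using inv[of x] hX gX that by simp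
      moreover have "?k ` h ` Y \<subseteq> {b<..<a}"
        using inv gY by auto
      ultimately show "\<exists>k. cover (X \<union> h ` Y) k \<and> (\<forall>x\<in>X. k x = x) \<and> k ` h ` Y \<subseteq> {b<..<a}"
        by (intro exI[of _ ?k]) simp
    qed
  qed
qed

text \<open>Carries the conclusion for a refined copy, as given by \<open>cofinal_refine\<close>,
  back to the original pattern.\<close>

lemma cofinal_comp:
  assumes "cover (X \<union> Y) h" "\<And>x. x \<in> X \<Longrightarrow> h x = x" "cofinal X (h ` Y) a"
  shows "cofinal X Y a"
  unfolding cofinal_def
proof (intro allI impI)
  fix c assume "c < a"
  then obtain g where g: "cover (X \<union> h ` Y) g" "\<forall>x\<in>X. g x = x" "g ` h ` Y \<subseteq> {c<..<a}"
    using assms(3) unfolding cofinal_def by blast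
  have "h ` (X \<union> Y) = X \<union> h ` Y" using assms(2) by (auto simp: image_Un)
  then have "cover (X \<union> Y) (\<lambda>x. g (h x))" using cover_comp[OF assms(1)] g(1) by simp
  then show "\<exists>g. cover (X \<union> Y) g \<and> (\<forall>x\<in>X. g x = x) \<and> g ` Y \<subseteq> {c<..<a}"
    using assms(2) g(2,3) by (intro exI[of _ "\<lambda>x. g (h x)"]) auto
qed

section \<open>Translating the defining clauses\<close>

lemma less_ominus_iff: "l \<le> x \<Longrightarrow> s < ominus x l \<longleftrightarrow> l +\<^sub>o s < x" for l x s :: 'o
  using oadd_ominus[of l x] oadd_less_iff[of l s "ominus x l"] by simp

lemma ominus_less_iff: "l \<le> x \<Longrightarrow> ominus x l < s \<longleftrightarrow> x < l +\<^sub>o s" for l x s :: 'o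
  using oadd_ominus[of l x] oadd_less_iff[of l "ominus x l" s] by simp

text \<open>A set is cut at \<open>l\<close>; its upper part is translated to the other side,
  covered there, and the covering is translated back. The lower part does not interact with the
  upper one because \<open>l\<close> is minimal.\<close>

lemma reflects_translate:
  assumes l: "minimal l" "r dvd\<^sub>o l" and x: "ozero < x" "x \<le> d"
    and tr: "translatable l {..<d}" and head: "\<And>s. s < d \<Longrightarrow> l \<sqsubseteq>\<^sub>1 l +\<^sub>o s"
    and P: "\<And>z. z < d \<Longrightarrow> ozero < z \<Longrightarrow> P z \<longleftrightarrow> P' (l +\<^sub>o z)"
    and Q: "\<And>z. z < x \<Longrightarrow> ozero < z \<Longrightarrow> Q z \<longleftrightarrow> Q' (l +\<^sub>o z)"
  shows "reflects x d P Q \<longleftrightarrow> reflects (l +\<^sub>o x) (l +\<^sub>o d) P' Q'"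
proof
  have tr': "translatable l S" if "S \<subseteq> {..<d}" for S
    using tr that unfolding translatable_def by blast
  assume L: "reflects x d P Q"
  show "reflects (l +\<^sub>o x) (l +\<^sub>o d) P' Q'"
  proof (rule reflectsI)
    fix S assume S: "finite S" "closed S" "S \<subseteq> {..<l +\<^sub>o d}"
    define S0 where "S0 = S \<inter> {..<l}"
    \<comment> \<open>Adjoining zero, which \<open>g\<close> fixes since it is below
      \<open>x\<close>, ensures that positive elements have positive images.\<close>
    define S1 where "S1 = {ozero} \<union> {s. l +\<^sub>o s \<in> S}"
    have S1: "finite S1" "closed S1" "S1 \<subseteq> {..<d}"
      unfolding S1_def
      using S x finite_untranslate[OF S(1)]
        closed_Un[OF closed_multiple[OF odvd_ozero] closed_untranslate[OF l(2) S(2)]]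
      by auto
    obtain g where g: "cover S1 g" "\<And>z. z \<in> S1 \<Longrightarrow> z < x \<Longrightarrow> g z = z" "\<And>z. z \<in> S1 \<Longrightarrow> g z < x"
        "\<And>z. z \<in> S1 \<Longrightarrow> x \<le> z \<Longrightarrow> P z \<Longrightarrow> Q (g z)"
      using L S1 by (rule reflectsE) blast
    have g0: "g ozero = ozero" using g(2) x(1) unfolding S1_def by simp
    have gpos: "ozero < g s" if "s \<in> S1" "ozero < s" for s
      using cover_less[OF g(1), of ozero s] that g0 unfolding S1_def by simp
    have gd: "g s < d" if "s \<in> S1" for s using g(3)[OF that] x(2) by simp
    define H where "H = (\<lambda>x. if x < l then x else l +\<^sub>o g (ominus x l))"
    have H: "H (l +\<^sub>o s) = l +\<^sub>o g s" for s
      using le_oadd[of l s] unfolding H_def by (auto simp: not_le[symmetric])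
    have "cover (S0 \<union> (+\<^sub>o) l ` S1) H"
      unfolding H_def
    proof (rule cover_translate[OF l l(2) S1(2) g(1)])
      have "g ` S1 \<subseteq> {..<d}" using gd by auto
      then show "translatable l S1" "translatable l (g ` S1)" using tr' S1(3) by blast+
      show "closed S0" unfolding S0_def using S(2) by (rule closed_initial)
    qed (use head gd g0 gpos S0_def in auto)
    moreover have SS: "z \<in> S0 \<or> (\<exists>s\<in>S1. z = l +\<^sub>o s)" if "z \<in> S" for z
    proof (cases "z < l")
      case False
      then obtain s where "z = l +\<^sub>o s" using oadd_diff_exists not_le by metis
      then show ?thesis using that unfolding S1_def by auto
    qed (use that S0_def in auto)
    ultimately have "cover S H"
      using cover_subset[of "S0 \<union> (+\<^sub>o) l ` S1" H S] by blast
    moreover have "H z = z" if "z \<in> S" "z < l +\<^sub>o x" for z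
      using SS[OF that(1)]
    proof
      assume "\<exists>s\<in>S1. z = l +\<^sub>o s"
      then show ?thesis using H g(2) that(2) by auto
    qed (simp add: S0_def H_def)
    moreover have "H z < l +\<^sub>o x" if "z \<in> S" for z
      using SS[OF that]
    proof
      assume "\<exists>s\<in>S1. z = l +\<^sub>o s"
      then show ?thesis using H g(3) by auto
    next
      assume "z \<in> S0"
      then have "H z < l" by (simp add: S0_def H_def)
      then show ?thesis using le_oadd order.strict_trans2 by blast
    qed
    moreover have "Q' (H z)" if z: "z \<in> S" "l +\<^sub>o x \<le> z" "P' z" for z
    proof -
      have "l \<le> z" using z(2) le_oadd order.trans by blast
      then have "\<exists>s\<in>S1. z = l +\<^sub>o s" using SS[OF z(1)] unfolding S0_def by auto
      then obtain s where s: "s \<in> S1" "z = l +\<^sub>o s" by blast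
      have xs: "x \<le> s" using z(2) s(2) by simp
      then have pos: "ozero < s" using x(1) by simp
      have "P s" using P[of s] S1(3) s z(3) pos by auto
      then have "Q (g s)" using g(4) s(1) xs by blast
      then show ?thesis using Q[of "g s"] g(3)[OF s(1)] gpos[OF s(1) pos] H s(2) by simp
    qed
    ultimately show "\<exists>h. cover S h \<and> (\<forall>z\<in>S. z < l +\<^sub>o x \<longrightarrow> h z = z) \<and> (\<forall>z\<in>S. h z < l +\<^sub>o x) \<and>
         (\<forall>z\<in>S. l +\<^sub>o x \<le> z \<and> P' z \<longrightarrow> Q' (h z))"
      by blast
  qed
next
  have tr': "translatable l S" if "S \<subseteq> {..<d}" for S
    using tr that unfolding translatable_def by blast
  assume R: "reflects (l +\<^sub>o x) (l +\<^sub>o d) P' Q'"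
  show "reflects x d P Q"
  proof (rule reflectsI)
    fix S assume S: "finite S" "closed S" "S \<subseteq> {..<d}"
    define S1 where "S1 = {ozero} \<union> S"
    have S1: "finite S1" "closed S1" "S1 \<subseteq> {..<d}"
      using S x closed_Un[OF closed_multiple[OF odvd_ozero]] unfolding S1_def by auto
    have "finite ((+\<^sub>o) l ` S1)" "closed ((+\<^sub>o) l ` S1)" "(+\<^sub>o) l ` S1 \<subseteq> {..<l +\<^sub>o d}"
      using S1 l(2) closed_translate by auto
    then obtain G where G: "cover ((+\<^sub>o) l ` S1) G"
        "\<And>z. z \<in> (+\<^sub>o) l ` S1 \<Longrightarrow> z < l +\<^sub>o x \<Longrightarrow> G z = z"
        "\<And>z. z \<in> (+\<^sub>o) l ` S1 \<Longrightarrow> G z < l +\<^sub>o x"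
        "\<And>z. z \<in> (+\<^sub>o) l ` S1 \<Longrightarrow> l +\<^sub>o x \<le> z \<Longrightarrow> P' z \<Longrightarrow> Q' (G z)"
      by (rule reflectsE[OF R]) blast
    define g where "g = (\<lambda>s. ominus (G (l +\<^sub>o s)) l)"
    have z: "ozero \<in> S1" unfolding S1_def by simp
    have zl: "l \<in> (+\<^sub>o) l ` S1" using z image_eqI[of l "(+\<^sub>o) l" ozero S1] by simp
    have "l < l +\<^sub>o x" using oadd_strict_mono[OF x(1), of l] by simp
    \<comment> \<open>As \<open>l\<close> was adjoined and is fixed, all other images lie above
      \<open>l\<close> and can be translated back.\<close>
    then have G0: "G l = l" using G(2) zl by blast
    have Gl: "l \<le> G (l +\<^sub>o s)" if "s \<in> S1" for s
    proof -
      have "\<not> G (l +\<^sub>o s) < G l"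
        using cover_less[OF G(1), of "l +\<^sub>o s" l] that zl le_oadd[of l s] by (simp add: not_less)
      then show ?thesis using G0 by simp
    qed
    have Gg: "G (l +\<^sub>o s) = l +\<^sub>o g s" if "s \<in> S1" for s
      using Gl[OF that] unfolding g_def by (simp add: oadd_ominus)
    have gpos: "ozero < g s" if "s \<in> S1" "ozero < s" for s
    proof -
      have "l < l +\<^sub>o s" using oadd_strict_mono[OF that(2), of l] by simp
      then have "G l < G (l +\<^sub>o s)" using cover_less[OF G(1), of l "l +\<^sub>o s"] that zl by simp
      then show ?thesis using oadd_less_iff[of l ozero "g s"] Gg[OF that(1)] G0 by simp
    qed
    have gx: "g s < x" if "s \<in> S1" for s
      using G(3)[of "l +\<^sub>o s"] Gg[OF that] that by simp
    have gid: "g s = s" if "s \<in> S1" "s < x" for s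
      using G(2)[of "l +\<^sub>o s"] Gg[OF that(1)] that by simp
    have "cover S1 g"
    proof (rule cover_untranslate[OF l(2) l(2) S1(2) _ _ G(1) Gg gpos])
      have "g ` S1 \<subseteq> {..<d}" using gx x(2) by (auto intro: order.strict_trans2)
      then show "translatable l S1" "translatable l (g ` S1)" using tr' S1(3) by blast+
    qed auto
    then have "cover S g" by (rule cover_subset) (auto simp: S1_def)
    moreover have "Q (g z)" if "z \<in> S" "x \<le> z" "P z" for z
    proof -
      have z: "z \<in> S1" "z < d" "ozero < z" using that S(3) x(1) unfolding S1_def by auto
      then have "P' (l +\<^sub>o z)" using P that(3) by blast
      then have "Q' (l +\<^sub>o g z)" using G(4)[of "l +\<^sub>o z"] Gg z(1) that(2) by simp
      then show ?thesis using Q gx[OF z(1)] gpos[OF z(1,3)] by blast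
    qed
    ultimately show "\<exists>h. cover S h \<and> (\<forall>z\<in>S. z < x \<longrightarrow> h z = z) \<and> (\<forall>z\<in>S. h z < x) \<and>
         (\<forall>z\<in>S. x \<le> z \<and> P z \<longrightarrow> Q (h z))"
      using gid gx unfolding S1_def by (intro exI[of _ g]) blast
  qed
qed

text \<open>\<open>W\<close> holds the parameters below \<open>l\<close>, which remain fixed on the
  translated side. Zero is kept out of the movable part \<open>Y\<close>, so that the ordinal
  \<open>l\<close> itself never has to move.\<close>

lemma cofinal_translate:
  assumes l: "minimal l" "r dvd\<^sub>o l" and e: "ozero < e" "e \<le> d"
    and tr: "translatable l {..<d}" and head: "\<And>s. s < d \<Longrightarrow> l \<sqsubseteq>\<^sub>1 l +\<^sub>o s"
    and XY: "closed (X \<union> Y)" "X \<union> Y \<subseteq> {..<d}" "ozero \<notin> Y" and W: "closed W" "W \<subseteq> {..<l}"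
  shows "cofinal X Y e \<longleftrightarrow> cofinal (W \<union> (+\<^sub>o) l ` X) ((+\<^sub>o) l ` Y) (l +\<^sub>o e)"
proof
  have tr': "translatable l S" if "S \<subseteq> {..<d}" for S
    using tr that unfolding translatable_def by blast
  have un: "W \<union> (+\<^sub>o) l ` X \<union> (+\<^sub>o) l ` Y = W \<union> (+\<^sub>o) l ` (X \<union> Y)" by blast
  assume L: "cofinal X Y e"
  show "cofinal (W \<union> (+\<^sub>o) l ` X) ((+\<^sub>o) l ` Y) (l +\<^sub>o e)"
    unfolding cofinal_def un
  proof (intro allI impI)
    fix c assume c: "c < l +\<^sub>o e"
    \<comment> \<open>Translates of positive ordinals already exceed a bound below \<open>l\<close>,
      so zero serves as \<open>b\<close> there.\<close>
    obtain b where b: "b < e" "c \<le> l +\<^sub>o b"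
    proof (cases "c < l")
      case True
      then show ?thesis using that[of ozero] e(1) by simp
    next
      case False
      then obtain b where "c = l +\<^sub>o b" using oadd_diff_exists not_le by metis
      then show ?thesis using that[of b] c by simp
    qed
    obtain g where g: "cover (X \<union> Y) g" "\<forall>x\<in>X. g x = x" "g ` Y \<subseteq> {b<..<e}"
      using L b(1) unfolding cofinal_def by blast
    have gd: "g s < d" if "s \<in> X \<union> Y" for s
    proof -
      have "g s = s \<or> g s < e" using that g(2,3) by auto
      then show ?thesis using that XY(2) e(2) by auto
    qed
    define H where "H = (\<lambda>x. if x < l then x else l +\<^sub>o g (ominus x l))"
    have H: "H (l +\<^sub>o s) = l +\<^sub>o g s" for s
      using le_oadd[of l s] unfolding H_def by (auto simp: not_le[symmetric])
    have "cover (W \<union> (+\<^sub>o) l ` (X \<union> Y)) H"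
      unfolding H_def
    proof (rule cover_translate[OF l l(2) XY(1) g(1)])
      have "g ` (X \<union> Y) \<subseteq> {..<d}" using gd by auto
      then show "translatable l (X \<union> Y)" "translatable l (g ` (X \<union> Y))" using tr' XY(2) by blast+
      show "g ozero = ozero" if "ozero \<in> X \<union> Y" using that XY(3) g(2) by blast
      show "ozero < g s" if "s \<in> X \<union> Y" "ozero < s" for s
        using that g(2,3) by (auto simp: image_subset_iff intro: order.strict_trans1[OF ozero_least])
    qed (use head gd W in auto)
    moreover have "H x = x" if "x \<in> W \<union> (+\<^sub>o) l ` X" for x
      using that W(2) H g(2) by (auto simp: H_def)
    moreover have "H ` (+\<^sub>o) l ` Y \<subseteq> {c<..<l +\<^sub>o e}"
    proof -
      have "c < l +\<^sub>o g y \<and> g y < e" if "y \<in> Y" for y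
      proof -
        have "b < g y" "g y < e" using g(3) that by auto
        then show ?thesis by (auto intro: order.strict_trans1[OF b(2)])
      qed
      then show ?thesis using H by auto
    qed
    ultimately show "\<exists>h. cover (W \<union> (+\<^sub>o) l ` (X \<union> Y)) h \<and> (\<forall>x\<in>W \<union> (+\<^sub>o) l ` X. h x = x) \<and>
        h ` (+\<^sub>o) l ` Y \<subseteq> {c<..<l +\<^sub>o e}"
      by (intro exI[of _ H]) blast
  qed
next
  have tr': "translatable l S" if "S \<subseteq> {..<d}" for S
    using tr that unfolding translatable_def by blast
  assume R: "cofinal (W \<union> (+\<^sub>o) l ` X) ((+\<^sub>o) l ` Y) (l +\<^sub>o e)"
  show "cofinal X Y e"
    unfolding cofinal_def
  proof (intro allI impI)
    fix c assume "c < e"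
    then have "l +\<^sub>o c < l +\<^sub>o e" by simp
    then obtain G where G: "cover (W \<union> (+\<^sub>o) l ` X \<union> (+\<^sub>o) l ` Y) G"
        "\<forall>x\<in>W \<union> (+\<^sub>o) l ` X. G x = x" "G ` (+\<^sub>o) l ` Y \<subseteq> {l +\<^sub>o c<..<l +\<^sub>o e}"
      using R unfolding cofinal_def by blast
    define g where "g = (\<lambda>s. ominus (G (l +\<^sub>o s)) l)"
    have gX: "G (l +\<^sub>o s) = l +\<^sub>o g s \<and> g s = s" if "s \<in> X" for s
      using G(2) that unfolding g_def by simp
    have gY: "G (l +\<^sub>o s) = l +\<^sub>o g s \<and> c < g s \<and> g s < e" if "s \<in> Y" for s
    proof -
      have "G (l +\<^sub>o s) \<in> {l +\<^sub>o c<..<l +\<^sub>o e}" using G(3) that by blast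
      then have "l +\<^sub>o c < G (l +\<^sub>o s)" "G (l +\<^sub>o s) < l +\<^sub>o e" by auto
      moreover then have "l \<le> G (l +\<^sub>o s)" using le_oadd[of l c] by simp
      ultimately show ?thesis unfolding g_def by (simp add: oadd_ominus less_ominus_iff ominus_less_iff)
    qed
    have "cover (X \<union> Y) g"
    proof (rule cover_untranslate[OF l(2) l(2) XY(1)])
      have "g s < d" if "s \<in> X \<union> Y" for s
      proof -
        have "g s = s \<or> g s < e" using that gX gY by blast
        then show ?thesis using that XY(2) e(2) by auto
      qed
      then have "g ` (X \<union> Y) \<subseteq> {..<d}" by auto
      then show "translatable l (X \<union> Y)" "translatable l (g ` (X \<union> Y))" using tr' XY(2) by blast+
      show "cover ((+\<^sub>o) l ` (X \<union> Y)) G" using G(1) by (rule cover_subset) blast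
      show "G (l +\<^sub>o s) = l +\<^sub>o g s" if "s \<in> X \<union> Y" for s using that gX gY by blast
      show "ozero < g s" if "s \<in> X \<union> Y" "ozero < s" for s
        using that gX[of s] gY[of s] order.strict_trans1[OF ozero_least, of c "g s"] by auto
    qed
    then show "\<exists>h. cover (X \<union> Y) h \<and> (\<forall>x\<in>X. h x = x) \<and> h ` Y \<subseteq> {c<..<e}"
      using gX gY by (intro exI[of _ g]) auto
  qed
qed

text \<open>By induction on \<open>d\<close>, everything below \<open>d\<close> is translatable, and
  with it the clauses defining the relations to \<open>d\<close>. The downward clause also mentions
  \<open>\<sqsubseteq>\<^sub>1 d\<close>, so the equivalence for
  \<open>\<sqsubseteq>\<^sub>1\<close> comes first.\<close>

lemma translate_iff:
  assumes l: "minimal l" "r dvd\<^sub>o l" and "l \<sqsubseteq>\<^sub>1 l +\<^sub>o d" "ozero < x" "x \<le> d"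
  shows "(x \<sqsubseteq>\<^sub>1 d \<longleftrightarrow> l +\<^sub>o x \<sqsubseteq>\<^sub>1 l +\<^sub>o d) \<and> (x \<sqsubseteq>\<^sub>2 d \<longleftrightarrow> l +\<^sub>o x \<sqsubseteq>\<^sub>2 l +\<^sub>o d)"
  using assms(3-)
proof (induction d arbitrary: x rule: less_induct)
  case (less d)
  have head: "l \<sqsubseteq>\<^sub>1 l +\<^sub>o s" if "s < d" for s
    using le1_interval[OF less.prems(1) le_oadd] that by simp
  have tr: "translatable l {..<d}"
    unfolding translatable_def
  proof (intro ballI impI)
    fix u v assume uv: "u \<in> {..<d}" "v \<in> {..<d}" "ozero < u"
    show "(u \<sqsubseteq>\<^sub>1 v \<longleftrightarrow> l +\<^sub>o u \<sqsubseteq>\<^sub>1 l +\<^sub>o v) \<and> (u \<sqsubseteq>\<^sub>2 v \<longleftrightarrow> l +\<^sub>o u \<sqsubseteq>\<^sub>2 l +\<^sub>o v)"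
    proof (cases "u \<le> v")
      case True
      then show ?thesis using less.IH[of v u] head uv by simp
    next
      case False
      then show ?thesis using le1_le le2_imp_le1 oadd_le_cancel by blast
    qed
  qed
  note rt = reflects_translate[OF l _ _ tr head]
  have le1_d: "u \<sqsubseteq>\<^sub>1 d \<longleftrightarrow> l +\<^sub>o u \<sqsubseteq>\<^sub>1 l +\<^sub>o d" if "ozero < u" "u \<le> d" for u
    using rt[OF that, of "\<lambda>_. False" "\<lambda>_. False" "\<lambda>_. False" "\<lambda>_. False"] that
    unfolding le1_iff_reflects by simp
  have le1_x: "u \<sqsubseteq>\<^sub>1 x \<longleftrightarrow> l +\<^sub>o u \<sqsubseteq>\<^sub>1 l +\<^sub>o x" if "ozero < u" "u < x" for u
  proof (cases "x = d")
    case False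
    then have "x < d" using less.prems by simp
    then show ?thesis using less.IH[of x u] head that by simp
  qed (use le1_d that in simp)
  have down: "reflects x d (\<lambda>z. z \<sqsubseteq>\<^sub>1 d) (\<lambda>z. z \<sqsubseteq>\<^sub>1 x) \<longleftrightarrow>
      reflects (l +\<^sub>o x) (l +\<^sub>o d) (\<lambda>z. z \<sqsubseteq>\<^sub>1 l +\<^sub>o d) (\<lambda>z. z \<sqsubseteq>\<^sub>1 l +\<^sub>o x)"
    by (rule rt[OF less.prems(2,3)]) (simp_all add: le1_d le1_x)
  note ct = cofinal_translate[OF l _ _ tr head]
  have xd: "ozero < d" using less.prems by (meson order.strict_trans2)
  let ?U = "\<lambda>a b. \<forall>X Y. finite X \<and> finite Y \<and> X \<subseteq> {..<a} \<and> Y \<subseteq> {..<a} \<and> closed (X \<union> Y) \<and> X \<lless> Y \<longrightarrow>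
        cofinal X Y a \<longrightarrow> cofinal X Y b"
  have up: "?U x d \<longleftrightarrow> ?U (l +\<^sub>o x) (l +\<^sub>o d)"
  proof
    assume U: "?U x d"
    show "?U (l +\<^sub>o x) (l +\<^sub>o d)"
    proof (intro allI impI)
      fix X Y assume XY: "finite X \<and> finite Y \<and> X \<subseteq> {..<l +\<^sub>o x} \<and> Y \<subseteq> {..<l +\<^sub>o x} \<and>
          closed (X \<union> Y) \<and> X \<lless> Y" and cof: "cofinal X Y (l +\<^sub>o x)"
      have lx: "l < l +\<^sub>o x" using oadd_strict_mono[OF less.prems(2), of l] by simp
      \<comment> \<open>\<open>Y\<close> may lie partly below or at \<open>l\<close>. A copy of it
        strictly above \<open>l\<close> with copies of its own cofinal in
        \<open>l +\<^sub>o x\<close> can be translated and takes its place.\<close>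
      obtain h where h: "cover (X \<union> Y) h" "\<And>x. x \<in> X \<Longrightarrow> h x = x" "h ` Y \<subseteq> {l<..<l +\<^sub>o x}"
          "cofinal X (h ` Y) (l +\<^sub>o x)"
        using cofinal_refine[OF _ _ cof lx] XY by blast
      define Z where "Z = h ` Y"
      define W where "W = X \<inter> {..<l}"
      define X1 where "X1 = {s. l +\<^sub>o s \<in> X}"
      define Z1 where "Z1 = {s. l +\<^sub>o s \<in> Z}"
      have hXY: "h ` (X \<union> Y) = X \<union> Z" using h(2) by (auto simp: image_Un Z_def)
      have cXZ: "closed (X \<union> Z)" using closed_cover_image[OF _ h(1)] XY hXY by simp
      have dec: "\<exists>s. z = l +\<^sub>o s" if "\<not> z < l" for z
        using that by (metis not_less oadd_diff_exists)
      have X: "X = W \<union> (+\<^sub>o) l ` X1"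
        unfolding W_def X1_def using dec by blast
      have Zb: "l < z \<and> z < l +\<^sub>o x" if "z \<in> Z" for z
        using that h(3) unfolding Z_def by fastforce
      then have "\<not> z < l" if "z \<in> Z" for z using that less_asym by blast
      then have Z: "Z = (+\<^sub>o) l ` Z1"
        unfolding Z1_def using dec by blast
      have fin: "finite X1" "finite Z1"
        using XY finite_untranslate unfolding X1_def Z1_def Z_def by auto
      have "{s. l +\<^sub>o s \<in> X \<union> Z} = X1 \<union> Z1" unfolding X1_def Z1_def by blast
      then have c1: "closed (X1 \<union> Z1)" using closed_untranslate[OF l(2) cXZ] by simp
      have sub: "X1 \<subseteq> {..<x}" "Z1 \<subseteq> {..<x}"
        using XY unfolding X1_def Z1_def by (auto dest: Zb)
      have subd: "X1 \<union> Z1 \<subseteq> {..<d}" using sub less.prems(3) by fastforce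
      have z0: "ozero \<notin> Z1" using Zb unfolding Z1_def by force
      have XZ: "X \<lless> Z"
        unfolding set_less_def Z_def
      proof safe
        fix u v assume "u \<in> X" "v \<in> Y"
        then show "u < h v"
          using cover_less[OF h(1), of u v] h(2)[of u] XY by (auto simp: set_less_def)
      qed
      then have less1: "X1 \<lless> Z1"
        unfolding set_less_def X1_def Z1_def by (metis mem_Collect_eq oadd_less_iff)
      have "(X \<union> Z) \<inter> {..<l} = W" using Z le_oadd unfolding W_def by (force simp: not_le[symmetric])
      then have W: "closed W" "W \<subseteq> {..<l}"
        using closed_initial[OF cXZ, of l] unfolding W_def by auto
      have "cofinal X1 Z1 x"
        using h(4) ct[OF less.prems(2,3) _ c1 subd z0 W] X Z Z_def by simp
      then have "cofinal X1 Z1 d" using U fin sub c1 less1 by blast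
      then have "cofinal X Z (l +\<^sub>o d)"
        using ct[OF xd order.refl _ c1 subd z0 W] X Z by simp
      then show "cofinal X Y (l +\<^sub>o d)"
        using cofinal_comp[OF h(1,2)] unfolding Z_def by blast
    qed
  next
    assume U: "?U (l +\<^sub>o x) (l +\<^sub>o d)"
    show "?U x d"
    proof (intro allI impI)
      fix X Y assume XY: "finite X \<and> finite Y \<and> X \<subseteq> {..<x} \<and> Y \<subseteq> {..<x} \<and>
          closed (X \<union> Y) \<and> X \<lless> Y" and cof: "cofinal X Y x"
      obtain h where h: "cover (X \<union> Y) h" "\<And>x. x \<in> X \<Longrightarrow> h x = x" "h ` Y \<subseteq> {ozero<..<x}"
          "cofinal X (h ` Y) x"
        using cofinal_refine[OF _ _ cof less.prems(2)] XY by blast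
      define Z where "Z = h ` Y"
      have hXY: "h ` (X \<union> Y) = X \<union> Z" using h(2) by (auto simp: image_Un Z_def)
      have cXZ: "closed (X \<union> Z)" using closed_cover_image[OF _ h(1)] XY hXY by simp
      have Zb: "ozero < z \<and> z < x" if "z \<in> Z" for z
        using that h(3) unfolding Z_def by fastforce
      have sub: "X \<union> Z \<subseteq> {..<d}"
        using XY Zb less.prems(3) by (auto intro: order.strict_trans2)
      have z0: "ozero \<notin> Z" using Zb by force
      have XZ: "X \<lless> Z"
        unfolding set_less_def Z_def
      proof safe
        fix u v assume "u \<in> X" "v \<in> Y"
        then show "u < h v"
          using cover_less[OF h(1), of u v] h(2)[of u] XY by (auto simp: set_less_def)
      qed
      have "(+\<^sub>o) l ` X \<union> (+\<^sub>o) l ` Z = (+\<^sub>o) l ` (X \<union> Z)" by blast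
      then have "closed ((+\<^sub>o) l ` X \<union> (+\<^sub>o) l ` Z)" using closed_translate[OF l(2) cXZ] by simp
      moreover have "(+\<^sub>o) l ` X \<lless> (+\<^sub>o) l ` Z" using XZ unfolding set_less_def by auto
      moreover have "(+\<^sub>o) l ` X \<subseteq> {..<l +\<^sub>o x}" "(+\<^sub>o) l ` Z \<subseteq> {..<l +\<^sub>o x}"
        using XY by (auto dest: Zb)
      moreover have "finite ((+\<^sub>o) l ` X)" "finite ((+\<^sub>o) l ` Z)" using XY unfolding Z_def by auto
      moreover have "cofinal ((+\<^sub>o) l ` X) ((+\<^sub>o) l ` Z) (l +\<^sub>o x)"
        using h(4) ct[OF less.prems(2,3) _ cXZ sub z0 closed_empty] Z_def by simp
      ultimately have "cofinal ((+\<^sub>o) l ` X) ((+\<^sub>o) l ` Z) (l +\<^sub>o d)" using U by blast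
      then have "cofinal X Z d"
        using ct[OF xd order.refl _ cXZ sub z0 closed_empty] by simp
      then show "cofinal X Y d"
        using cofinal_comp[OF h(1,2)] unfolding Z_def by blast
    qed
  qed
  show ?case
    using le1_d[OF less.prems(2,3)] down up less.prems(3) unfolding le2_iff_reflects by simp
qed

lemma translatableI:
  assumes "minimal l" "r dvd\<^sub>o l" "\<And>s. s \<in> S \<Longrightarrow> l \<sqsubseteq>\<^sub>1 l +\<^sub>o s"
  shows "translatable l S"
  unfolding translatable_def
proof (intro ballI impI)
  fix u v assume uv: "u \<in> S" "v \<in> S" "ozero < u"
  show "(u \<sqsubseteq>\<^sub>1 v \<longleftrightarrow> l +\<^sub>o u \<sqsubseteq>\<^sub>1 l +\<^sub>o v) \<and> (u \<sqsubseteq>\<^sub>2 v \<longleftrightarrow> l +\<^sub>o u \<sqsubseteq>\<^sub>2 l +\<^sub>o v)"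
  proof (cases "u \<le> v")
    case True
    then show ?thesis using translate_iff[of l v u] assms uv by simp
  next
    case False
    then show ?thesis using le1_le le2_imp_le1 oadd_le_cancel by blast
  qed
qed

section \<open>Unbounded patterns below a minimal ordinal\<close>

text \<open>Unlike the coverings in \<open>\<sqsubseteq>\<^sub>1\<close>, those considered here need
  not fix any parameters.\<close>

definition patterns_unbounded :: "'o \<Rightarrow> bool" where
  "patterns_unbounded k \<longleftrightarrow>
     (\<forall>y<k. \<exists>P. finite P \<and> closed P \<and> P \<subseteq> {..<k} \<and> (\<forall>h. cover P h \<longrightarrow> \<not> h ` P \<subseteq> {..<y}))"

lemma patterns_unboundedE:
  assumes "patterns_unbounded k" "y < k"
  obtains P where "finite P" "closed P" "P \<subseteq> {..<k}"
    "\<And>h. cover P h \<Longrightarrow> \<not> h ` P \<subseteq> {..<y}"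
proof -
  have "\<exists>P. finite P \<and> closed P \<and> P \<subseteq> {..<k} \<and> (\<forall>h. cover P h \<longrightarrow> \<not> h ` P \<subseteq> {..<y})"
    using assms unfolding patterns_unbounded_def by (elim allE impE)
  then show thesis by (elim exE conjE) (rule that, auto)
qed

text \<open>A copy of \<open>Y\<close> that lies above a copy of a pattern not realised below \<open>Max X\<close> lies above \<open>X\<close>;
  as \<open>k\<close> is minimal, the relations between \<open>X\<close> and \<open>Y\<close> are then preserved for lack of any.\<close>

lemma patterns_unbounded_le1:
  assumes k: "minimal k" "patterns_unbounded k" and "k \<le> b"
    and below: "\<And>Q. finite Q \<Longrightarrow> closed Q \<Longrightarrow> Q \<subseteq> {..<b} \<Longrightarrow> \<exists>h. cover Q h \<and> h ` Q \<subseteq> {..<k}"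
  shows "k \<sqsubseteq>\<^sub>1 b"
proof (cases "k = b")
  case True
  then show ?thesis using le1_refl by simp
next
  case False
  then have kb: "k < b" using assms(3) by simp
  obtain t e where t: "k = t +\<^sub>o e" "r dvd\<^sub>o t" "e < r" by (rule odvd_floor)
  \<comment> \<open>Otherwise a pattern without a copy below \<open>t\<close>, adjoined to
    \<open>t\<close> and \<open>k\<close>, forces \<open>t \<le> h t\<close> and so
    \<open>k \<le> h k\<close>, although the copy lies below \<open>k\<close>. Divisibility is
    needed to split closed sets at \<open>k\<close>.\<close>
  have dvd: "r dvd\<^sub>o k"
  proof (rule ccontr)
    assume "\<not> r dvd\<^sub>o k"
    then have "ozero < e" using t by (auto simp: ozero_less_iff)
    then have tk: "t < k" using oadd_strict_mono[of ozero e t] t(1) by simp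
    obtain P where P: "finite P" "closed P" "P \<subseteq> {..<k}"
        "\<And>h. cover P h \<Longrightarrow> \<not> h ` P \<subseteq> {..<t}"
      by (rule patterns_unboundedE[OF k(2) tk]) (rule that)
    define Q where "Q = P \<union> {t, t +\<^sub>o e}"
    have "closed Q" unfolding Q_def using P(2) t(2,3) by (intro closed_Un closed_floor)
    moreover have "finite Q" "Q \<subseteq> {..<b}"
      using P(1,3) tk kb unfolding Q_def t(1)[symmetric] by auto
    ultimately have Q: "finite Q" "closed Q" "Q \<subseteq> {..<b}" by blast+
    then obtain h where h: "cover Q h" "h ` Q \<subseteq> {..<k}" using below by blast
    have "cover P h" using h(1) by (rule cover_subset) (auto simp: Q_def)
    then obtain p where p: "p \<in> P" "t \<le> h p" 
      using P(4)[of h] by (auto simp: image_subset_iff not_less)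
    have ht: "r dvd\<^sub>o h t" "h (t +\<^sub>o e) = h t +\<^sub>o e"
      using cover_odvd[OF h(1)] cover_oadd[OF Q(2) h(1)] t unfolding Q_def by auto
    have "h p < h t +\<^sub>o e"
      using cover_less[OF h(1), of p "t +\<^sub>o e"] p(1) P(3) t(1) ht(2) unfolding Q_def by auto
    then have "t < h t +\<^sub>o e" using p(2) by simp
    then have "t \<le> h t" using odvd_less_oadd t ht(1) by blast
    then have "k \<le> h t +\<^sub>o e" unfolding t(1) by (rule oadd_mono_left)
    moreover have "h (t +\<^sub>o e) < k" using h(2) unfolding Q_def by auto
    ultimately show False using ht(2) by simp
  qed
  show ?thesis
  proof (rule le1I[OF assms(3)])
    fix S assume S: "finite S" "closed S" "S \<subseteq> {..<b}"
    define X where "X = S \<inter> {..<k}"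
    define Y where "Y = S \<inter> {k..}"
    have SXY: "S = X \<union> Y" unfolding X_def Y_def by auto
    have cXY: "closed X" "closed Y"
      unfolding X_def Y_def using S(2) dvd closed_initial closed_final by auto
    have "\<exists>h. cover Y h \<and> h ` Y \<subseteq> {..<k} \<and> X \<lless> h ` Y"
    proof (cases "X = {}")
      case True
      then have "finite Y" "closed Y" "Y \<subseteq> {..<b}" using S SXY by auto
      then show ?thesis using below True by (auto simp: set_less_def)
    next
      case False
      have fX: "finite X" using S(1) SXY by auto
      define y where "y = Max X"
      have y: "y \<in> X" "\<And>x. x \<in> X \<Longrightarrow> x \<le> y"
        unfolding y_def using fX False by auto
      have yk: "y < k" using y(1) unfolding X_def by simp
      obtain P where P: "finite P" "closed P" "P \<subseteq> {..<k}"
          "\<And>h. cover P h \<Longrightarrow> \<not> h ` P \<subseteq> {..<y}"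
        by (rule patterns_unboundedE[OF k(2) yk]) (rule that)
      have "finite (P \<union> S)" "closed (P \<union> S)" using P S closed_Un by auto
      moreover have "P \<union> S \<subseteq> {..<b}" using P(3) S(3) kb by fastforce
      ultimately obtain h where h: "cover (P \<union> S) h" "h ` (P \<union> S) \<subseteq> {..<k}" using below by blast
      have "cover P h" "cover Y h"
        using cover_subset[OF h(1)] SXY by auto
      then obtain p where p: "p \<in> P" "y \<le> h p" 
      using P(4)[of h] by (auto simp: image_subset_iff not_less)
      have "X \<lless> h ` Y"
        unfolding set_less_def
      proof safe
        fix x z assume xz: "x \<in> X" "z \<in> Y"
        have "x \<le> h p" using y(2)[OF xz(1)] p(2) by simp
        also have "h p < h z"
          using cover_less[OF h(1), of p z] p(1) P(3) xz(2) unfolding Y_def by auto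
        finally show "x < h z" .
      qed
      then show ?thesis using \<open>cover Y h\<close> h(2) SXY by (intro exI[of _ h]) auto
    qed
    then obtain h where h: "cover Y h" "h ` Y \<subseteq> {..<k}" "X \<lless> h ` Y" by blast
    define H where "H = (\<lambda>x. if x < k then x else h x)"
    have HX: "H x = x" if "x \<in> X" for x using that unfolding H_def X_def by simp
    have HY: "H x = h x" if "x \<in> Y" for x using that unfolding H_def Y_def by auto
    have "cover (X \<union> Y) H"
    proof (rule cover_Un_minimal[OF k(1) _ _ cXY])
      show "cover X H" using cover_id[of X] cover_cong[of X H "\<lambda>x. x", OF HX] by simp
      show "cover Y H" using h(1) cover_cong[of Y H h, OF HY] by simp
      show "H ` X \<lless> H ` Y" using h(3) HX HY unfolding set_less_def by simp
    qed (auto simp: X_def Y_def)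
    then show "\<exists>h. cover S h \<and> (\<forall>z\<in>S. z < k \<longrightarrow> h z = z) \<and> (\<forall>z\<in>S. h z < k)"
      using h(2) HY SXY unfolding H_def X_def by (intro exI[of _ H]) (auto simp: H_def Y_def)
  qed
qed

text \<open>If every pattern below \<open>k\<close> had a copy below some \<open>y < k\<close>, it
  would have one below a minimal \<open>k'\<close> related to \<open>y\<close>. By induction
  patterns are unbounded below \<open>k'\<close>, so \<open>patterns_unbounded_le1\<close> makes
  \<open>k'\<close> a proper predecessor of \<open>k\<close>.\<close>

lemma minimal_patterns_unbounded: "minimal k \<Longrightarrow> patterns_unbounded k"
proof (induction k rule: less_induct)
  case (less k)
  show ?case
  proof (rule ccontr)
    assume "\<not> patterns_unbounded k"
    then obtain y where y: "y < k"
        "\<not> (\<exists>P. finite P \<and> closed P \<and> P \<subseteq> {..<k} \<and> (\<forall>h. cover P h \<longrightarrow> \<not> h ` P \<subseteq> {..<y}))"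
      unfolding patterns_unbounded_def not_all not_imp by blast
    obtain k' where k': "minimal k'" "k' \<sqsubseteq>\<^sub>1 y" by (rule minimal_pred)
    have "k' < k" using le1_le[OF k'(2)] y(1) by simp
    have "k' \<sqsubseteq>\<^sub>1 k"
    proof (rule patterns_unbounded_le1[OF k'(1)])
      show "patterns_unbounded k'" using less.IH \<open>k' < k\<close> k'(1) by blast
      show "k' \<le> k" using \<open>k' < k\<close> by simp
      fix Q assume Q: "finite Q" "closed Q" "Q \<subseteq> {..<k}"
      then obtain h where h: "cover Q h" "h ` Q \<subseteq> {..<y}" using y(2) by blast
      have "finite (h ` Q)" "closed (h ` Q)" using Q closed_cover_image[OF _ h(1)] by auto
      then obtain g where g: "cover (h ` Q) g" "\<And>z. z \<in> h ` Q \<Longrightarrow> g z < k'"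
        using h(2) by (rule le1E[OF k'(2)]) blast
      show "\<exists>h. cover Q h \<and> h ` Q \<subseteq> {..<k'}"
        using cover_comp[OF h(1) g(1)] g(2) by (intro exI[of _ "\<lambda>x. g (h x)"]) auto
    qed
    then show False using minimalD[OF less.prems] \<open>k' < k\<close> by blast
  qed
qed

section \<open>The enumeration of the minimal ordinals\<close>

abbreviation index where "index a \<equiv> a <\<^sub>i theta1 r"

lemma minimal_kappa: "index a \<Longrightarrow> minimal (kappa r a)"
  using kappa_minimal_greater by blast

lemma kappa_less: "index b \<Longrightarrow> a < b \<Longrightarrow> kappa r a < kappa r b"
  using kappa_minimal_greater by blast

lemma kappa_less_iff: "index a \<Longrightarrow> index b \<Longrightarrow> kappa r a < kappa r b \<longleftrightarrow> a < b"
  using kappa_less by (metis less_asym linorder_neqE)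

lemma minimal_index:
  assumes "minimal k"
  obtains a where "index a" "k = kappa r a"
  using assms kappa_range[of r] by blast

lemma kappa_le: "minimal k \<Longrightarrow> (\<And>b. b < a \<Longrightarrow> kappa r b < k) \<Longrightarrow> kappa r a \<le> k"
  unfolding kappa.simps[of r a] by (intro Least_le) simp

section \<open>The values of \<open>kappa\<close> following the last successor of a minimal
  ordinal\<close>

lemma minimal_bounded:
  assumes "minimal u" "minimal v" "u < v"
  obtains m where "u \<sqsubseteq>\<^sub>1 m" "\<And>c. u \<sqsubseteq>\<^sub>1 c \<Longrightarrow> c \<le> m" "m < v"
proof -
  have lt: "c < v" if "u \<sqsubseteq>\<^sub>1 c" for c
    using minimal_not_le1[OF assms(2,3)] that by (meson not_le)
  then have "bdd_above {b. u \<sqsubseteq>\<^sub>1 b}"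
    unfolding bdd_above_def using less_imp_le by blast
  then obtain m where "max1 r u = Fin m" by (simp add: max1_def)
  then show ?thesis using max1_greatest[of r u m] lt that by blast
qed

text \<open>A minimal predecessor \<open>k\<close> of \<open>x\<close> other than \<open>x\<close>
  would be a multiple of \<open>r\<close>, hence at most \<open>t\<close>. Then \<open>k < u\<close>
  contradicts minimality of \<open>u\<close>, \<open>k = u\<close> contradicts maximality of
  \<open>t +\<^sub>o e\<close>, and \<open>u < k\<close> contradicts minimality of
  \<open>k\<close>.\<close>

lemma minimal_after_max:
  assumes u: "minimal u" "u \<sqsubseteq>\<^sub>1 t +\<^sub>o e" "\<And>c. u \<sqsubseteq>\<^sub>1 c \<Longrightarrow> c \<le> t +\<^sub>o e"
    and t: "r dvd\<^sub>o t" and x: "t +\<^sub>o e < x" "x \<le> t +\<^sub>o r"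
  shows "minimal x"
proof -
  obtain k where k: "minimal k" "k \<sqsubseteq>\<^sub>1 x" by (rule minimal_pred)
  have "k = x"
  proof (rule ccontr)
    assume "k \<noteq> x"
    then have kx: "k < x" using le1_le[OF k(2)] by simp
    obtain s f where s: "k = s +\<^sub>o f" "r dvd\<^sub>o s" "f < r" by (rule odvd_floor)
    have "f = ozero"
      using le1_nonmultiple[OF s(2) _ s(3)] k(2) \<open>k \<noteq> x\<close> s(1) by (auto simp: ozero_less_iff)
    then have "r dvd\<^sub>o k" using s by simp
    have "k \<le> t"
    proof (rule ccontr)
      assume "\<not> k \<le> t"
      then have "t +\<^sub>o r \<le> k" using odvd_less[OF t \<open>r dvd\<^sub>o k\<close>] by simp
      then show False using kx x(2) by simp
    qed
    then have km: "k \<le> t +\<^sub>o e" using le_oadd order.trans by blast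
    consider "k < u" | "k = u" | "u < k" by (rule linorder_cases)
    then show False
    proof cases
      case 1
      have "u \<le> x" using le1_le[OF u(2)] x(1) by simp
      then show ?thesis using minimal_not_le1[OF u(1) 1] k(2) by blast
    next
      case 2
      then show ?thesis using u(3) k(2) x(1) by (meson not_le)
    next
      case 3
      then show ?thesis using minimal_not_le1[OF k(1) 3 km] u(2) by blast
    qed
  qed
  with k(1) show ?thesis by simp
qed

text \<open>No minimal ordinal lies strictly above \<open>kappa r a\<close> and at most at
  \<open>m\<close>, while all ordinals after \<open>m\<close> up to \<open>m +\<^sub>o r\<close> are
  minimal, so the enumeration runs through them one by one.\<close>

lemma kappa_after_max:
  assumes "kappa r a \<sqsubseteq>\<^sub>1 m" "\<And>c. kappa r a \<sqsubseteq>\<^sub>1 c \<Longrightarrow> c \<le> m"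
    and "ozero < e" "e \<le> r" "index (a +\<^sub>o e)"
  shows "kappa r (a +\<^sub>o e) = m +\<^sub>o e"
  using assms(3-)
proof (induction e rule: less_induct)
  case (less e)
  have IH: "kappa r (a +\<^sub>o d) = m +\<^sub>o d" if "ozero < d" "d < e" for d
    using less.IH[OF that(2,1)] that(2) less.prems less_inf_trans[of "a +\<^sub>o d" "a +\<^sub>o e"] by simp
  have ia: "index a" using le_less_inf_trans[OF le_oadd less.prems(3)] .
  obtain t f where t: "m = t +\<^sub>o f" "r dvd\<^sub>o t" "f < r" by (rule odvd_floor)
  have me: "m < m +\<^sub>o e" using oadd_strict_mono[OF less.prems(1), of m] by simp
  have ae: "a < a +\<^sub>o e" using oadd_strict_mono[OF less.prems(1), of a] by simp
  have km: "kappa r a \<le> m" using assms(1) by (rule le1_le)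
  have "m +\<^sub>o e \<le> m +\<^sub>o r" using less.prems(2) by simp
  \<comment> \<open>Indecomposability absorbs the remainder of \<open>m\<close>, so the interval
    ends with the block of \<open>m\<close>.\<close>
  also have "m +\<^sub>o r = t +\<^sub>o r" using t oadd_r by (simp add: oadd_assoc)
  finally have "minimal (m +\<^sub>o e)"
    using minimal_after_max[OF minimal_kappa[OF ia], of t f] assms(1,2) t me by simp
  then have "kappa r (a +\<^sub>o e) \<le> m +\<^sub>o e"
  proof (rule kappa_le)
    fix b assume b: "b < a +\<^sub>o e"
    show "kappa r b < m +\<^sub>o e"
    proof (cases "b \<le> a")
      case True
      then have "kappa r b \<le> kappa r a" using kappa_less[OF ia] by (metis less_imp_le order.order_iff_strict)
      then show ?thesis using km me by simp
    next
      case False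
      then obtain d where d: "b = a +\<^sub>o d" by (metis less_imp_le not_le oadd_diff_exists)
      have "d \<noteq> ozero" using d False by auto
      then show ?thesis using IH[of d] b d by (simp add: ozero_less_iff)
    qed
  qed
  moreover have mk: "m < kappa r (a +\<^sub>o e)"
    using minimal_not_le1[OF minimal_kappa[OF less.prems(3)] kappa_less[OF less.prems(3) ae]] assms(1)
    by (meson not_le)
  have "m +\<^sub>o d < kappa r (a +\<^sub>o e)" if "d < e" for d
  proof (cases "d = ozero")
    case False
    then show ?thesis
      using IH[of d] that kappa_less[OF less.prems(3), of "a +\<^sub>o d"] by (simp add: ozero_less_iff)
  qed (use mk in simp)
  then have "m +\<^sub>o e \<le> kappa r (a +\<^sub>o e)"
    unfolding oadd_le_iff[of m e] using mk less_imp_le by blast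
  ultimately show ?case by simp
qed

text \<open>If \<open>a\<close> has a nonzero remainder over \<open>b\<close>, then
  \<open>kappa r a\<close> lies strictly inside the block of the last successor of
  \<open>kappa r b\<close>. If \<open>a\<close> is a multiple and \<open>kappa r a\<close> is not,
  its block start has a minimal predecessor \<open>kappa r c\<close> with \<open>c\<close> a
  multiple by induction; then \<open>kappa r (c +\<^sub>o r)\<close> exceeds
  \<open>kappa r a\<close> although \<open>c +\<^sub>o r \<le> a\<close>.\<close>

lemma odvd_kappa_iff: "index a \<Longrightarrow> r dvd\<^sub>o kappa r a \<longleftrightarrow> r dvd\<^sub>o a"
proof (induction a rule: less_induct)
  case (less a)
  obtain b e where b: "a = b +\<^sub>o e" "r dvd\<^sub>o b" "e < r" by (rule odvd_floor)
  show ?case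
  proof (cases "e = ozero")
    case False
    then have e: "ozero < e" by (simp add: ozero_less_iff)
    then have ba: "b < a" using oadd_strict_mono[of ozero e b] b(1) by simp
    then have ib: "index b" using less_inf_trans less.prems by blast
    obtain m where m: "kappa r b \<sqsubseteq>\<^sub>1 m" "\<And>c. kappa r b \<sqsubseteq>\<^sub>1 c \<Longrightarrow> c \<le> m"
      using minimal_bounded[OF minimal_kappa[OF ib] minimal_kappa[OF less.prems]
          kappa_less[OF less.prems ba]] by blast
    obtain t f where t: "m = t +\<^sub>o f" "r dvd\<^sub>o t" "f < r" by (rule odvd_floor)
    have "kappa r a = m +\<^sub>o e"
      using kappa_after_max[OF m e] b less.prems by simp
    then have k: "kappa r a = t +\<^sub>o (f +\<^sub>o e)" using t by (simp add: oadd_assoc)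
    have "f +\<^sub>o e \<noteq> ozero" using le_oadd_right[of e f] e by auto
    then have "\<not> r dvd\<^sub>o kappa r a"
      unfolding k using odvd_oadd_small[OF t(2) oadd_less_r[OF t(3) b(3)]] by simp
    moreover have "\<not> r dvd\<^sub>o a" using odvd_oadd_small[OF b(2,3)] b(1) False by simp
    ultimately show ?thesis by blast
  next
    case True
    then have a: "r dvd\<^sub>o a" using b by simp
    have "r dvd\<^sub>o kappa r a"
    proof (rule ccontr)
      assume no: "\<not> r dvd\<^sub>o kappa r a"
      obtain t f where t: "kappa r a = t +\<^sub>o f" "r dvd\<^sub>o t" "f < r" by (rule odvd_floor)
      then have "ozero < f" using no by (auto simp: ozero_less_iff)
      then have tk: "t < kappa r a" using oadd_strict_mono[of ozero f t] t(1) by simp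
      obtain u where u: "minimal u" "u \<sqsubseteq>\<^sub>1 t" by (rule minimal_pred)
      obtain c where c: "index c" "u = kappa r c" using u(1) by (rule minimal_index)
      have "kappa r c < kappa r a" using le1_le[OF u(2)] tk c(2) by simp
      then have ca: "c < a" using kappa_less_iff c(1) less.prems by blast
      have "r dvd\<^sub>o u"
      proof -
        obtain s g where s: "u = s +\<^sub>o g" "r dvd\<^sub>o s" "g < r" by (rule odvd_floor)
        then show ?thesis
          using le1_nonmultiple[OF s(2) _ s(3)] u(2) t(2) by (cases "g = ozero") (auto simp: ozero_less_iff)
      qed
      then have "r dvd\<^sub>o c" using less.IH[OF ca c(1)] c(2) by simp
      then have cr: "c +\<^sub>o r \<le> a" using odvd_less a ca by blast
      then have icr: "index (c +\<^sub>o r)" using le_less_inf_trans less.prems by blast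
      obtain m where m: "kappa r c \<sqsubseteq>\<^sub>1 m" "\<And>d. kappa r c \<sqsubseteq>\<^sub>1 d \<Longrightarrow> d \<le> m"
        using minimal_bounded[OF minimal_kappa[OF c(1)] minimal_kappa[OF less.prems]
            kappa_less[OF less.prems ca]] by blast
      have "t +\<^sub>o f < t +\<^sub>o r" using t(3) by simp
      also have "\<dots> \<le> m +\<^sub>o r" using m(2) u(2) c(2) by (intro oadd_mono_left) simp
      also have "\<dots> = kappa r (c +\<^sub>o r)" using kappa_after_max[OF m r_pos] icr by simp
      also have "\<dots> \<le> kappa r a"
        using cr kappa_less[OF less.prems] by (metis less_imp_le order.order_iff_strict)
      finally show False using t(1) by simp
    qed
    with a show ?thesis by simp
  qed
qed

section \<open>The minimal multiples\<close>

abbreviation lam where "lam b \<equiv> kappa r (r *\<^sub>o b)"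

lemma lam_less_iff: "index (r *\<^sub>o a) \<Longrightarrow> index (r *\<^sub>o b) \<Longrightarrow> lam a < lam b \<longleftrightarrow> a < b"
  by (simp add: kappa_less_iff omult_less_iff r_pos)

lemma lam_dvd: "index (r *\<^sub>o a) \<Longrightarrow> r dvd\<^sub>o lam a"
  using odvd_kappa_iff[of "r *\<^sub>o a"] by (auto simp: odvd_def)

lemma minimal_multiple_index:
  assumes "minimal k" "r dvd\<^sub>o k"
  obtains b where "index (r *\<^sub>o b)" "k = lam b"
proof -
  obtain a where a: "index a" "k = kappa r a" using assms(1) by (rule minimal_index)
  then have "r dvd\<^sub>o a" using odvd_kappa_iff assms(2) by simp
  then show ?thesis using that a unfolding odvd_def by blast
qed

text \<open>The index of a minimal predecessor of \<open>x\<close> lies in the block of some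
  \<open>c < b\<close>. Each later \<open>lam d\<close> exceeds this predecessor, and then also
  \<open>x\<close>, as no relation crosses a minimal ordinal.\<close>

lemma less_lamE:
  assumes "index (r *\<^sub>o b)" "x < lam b"
  obtains c where "c < b" "\<And>d. c < d \<Longrightarrow> index (r *\<^sub>o d) \<Longrightarrow> x < lam d"
proof -
  obtain u where u: "minimal u" "u \<sqsubseteq>\<^sub>1 x" by (rule minimal_pred)
  obtain a where a: "index a" "u = kappa r a" using u(1) by (rule minimal_index)
  have "kappa r a < lam b" using le1_le[OF u(2)] assms(2) a(2) by simp
  then have ab: "a < r *\<^sub>o b" using kappa_less_iff a(1) assms(1) by blast
  obtain c e where c: "a = r *\<^sub>o c +\<^sub>o e" "e < r" using omult_divide[OF r_pos] by blast
  have "r *\<^sub>o c < r *\<^sub>o b" using ab c(1) le_oadd order.strict_trans1 by blast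
  then have "c < b" by (simp add: omult_less_iff r_pos)
  moreover have "x < lam d" if d: "c < d" "index (r *\<^sub>o d)" for d
  proof -
    have "a < r *\<^sub>o c +\<^sub>o r" using c by simp
    also have "\<dots> \<le> r *\<^sub>o d" using d(1) by (rule oadd_le_omult)
    finally have "u < lam d" using kappa_less[OF d(2)] a(2) by simp
    then show ?thesis using minimal_not_le1[OF minimal_kappa[OF d(2)]] u(2) by (meson not_le)
  qed
  ultimately show ?thesis using that by blast
qed

section \<open>The recurrence\<close>

text \<open>The form with an arbitrary \<open>b0\<close> is what the induction needs, since the
  copies sit at indices that need not be pure powers of omega; only the last exponent influences the
  successors.\<close>

lemma lam_le1_iff:
  assumes "index (r *\<^sub>o b)" "b = b0 +\<^sub>o omega_pow c"
  shows "lam b \<sqsubseteq>\<^sub>1 lam b +\<^sub>o n \<longleftrightarrow> n \<le> kappa r c \<or> kappa r c \<sqsubseteq>\<^sub>1 n"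
  using assms
proof (induction b arbitrary: b0 c n rule: less_induct)
  case (less b)
  note ib = less.prems(1) and b = less.prems(2) and IH = less.IH
  define L where "L = lam b"
  define K where "K = kappa r c"
  have L: "minimal L" "r dvd\<^sub>o L" unfolding L_def using ib minimal_kappa lam_dvd by auto
  have "c \<le> omega_pow c" by (rule le_omega_pow)
  also have "\<dots> \<le> b" unfolding b by (rule le_oadd_right)
  also have "\<dots> \<le> r *\<^sub>o b" using r_pos by (rule le_omult_right)
  finally have ic: "index c" using ib le_less_inf_trans by blast
  then have K: "minimal K" unfolding K_def by (rule minimal_kappa)
  have index_less: "index (r *\<^sub>o d)" if "d < b" for d
    using ib that less_inf_trans omult_strict_mono[OF r_pos] by blast
  \<comment> \<open>The inner induction on \<open>n\<close> supplies the relations from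
    \<open>L\<close> to \<open>L +\<^sub>o s\<close> for \<open>s < n\<close>, which make
    translation by \<open>L\<close> possible.\<close>
  have lower: "L \<sqsubseteq>\<^sub>1 L +\<^sub>o n" if "n \<le> K \<or> K \<sqsubseteq>\<^sub>1 n" for n
    using that
  proof (induction n rule: less_induct)
    case (less n)
    have head: "L \<sqsubseteq>\<^sub>1 L +\<^sub>o s" if "s < n" for s
    proof (rule less.IH[OF that])
      show "s \<le> K \<or> K \<sqsubseteq>\<^sub>1 s"
        using less.prems that le1_interval[of K n s] by (meson le_cases less_imp_le order.trans)
    qed
    show ?case
    proof (cases "n = ozero")
      case True
      then show ?thesis using le1_refl by simp
    next
      case False
      then have n: "ozero < n" by (simp add: ozero_less_iff)
      have Kpos: "ozero < K"
        using less.prems False le1_ozero[of n] by (auto simp: ozero_less_iff)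
      show ?thesis
      proof (rule le1I[OF le_oadd])
        fix S assume S: "finite S" "closed S" "S \<subseteq> {..<L +\<^sub>o n}"
        define S0 where "S0 = S \<inter> {..<L}"
        define S1 where "S1 = {ozero} \<union> {s. L +\<^sub>o s \<in> S}"
        have S1: "finite S1" "closed S1" "S1 \<subseteq> {..<n}"
          unfolding S1_def
          using S n finite_untranslate[OF S(1)]
            closed_Un[OF closed_multiple[OF odvd_ozero] closed_untranslate[OF L(2) S(2)]]
          by auto
        have z1: "ozero \<in> S1" unfolding S1_def by simp
        have "\<exists>g. cover S1 g \<and> g ozero = ozero \<and> (\<forall>s\<in>S1. g s < K)"
          using less.prems
        proof
          assume "n \<le> K"
          then have "\<forall>s\<in>S1. s < K" using S1(3) by auto
          then show ?thesis using cover_id by (intro exI[of _ "\<lambda>x. x"]) simp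
        next
          assume "K \<sqsubseteq>\<^sub>1 n"
          then obtain g where "cover S1 g" "\<And>z. z \<in> S1 \<Longrightarrow> z < K \<Longrightarrow> g z = z" "\<And>z. z \<in> S1 \<Longrightarrow> g z < K"
            using S1 by (rule le1E) (rule that)
          then show ?thesis using z1 Kpos by (intro exI[of _ g]) simp
        qed
        then obtain g where g: "cover S1 g" "g ozero = ozero" "\<And>s. s \<in> S1 \<Longrightarrow> g s < K" by blast
        have gpos: "ozero < g s" if "s \<in> S1" "ozero < s" for s
          using cover_less[OF g(1) z1 that(1)] that(2) g(2) by simp
        define w where "w = Max (g ` S1)"
        have w: "w \<in> g ` S1" "\<And>s. s \<in> S1 \<Longrightarrow> g s \<le> w"
          unfolding w_def using S1(1) z1 by (auto intro: Max_in)
        \<comment> \<open>\<open>w\<close> bounds all images under \<open>g\<close>. With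
          \<open>u = kappa r d\<close>, an \<open>L'\<close> whose index ends in
          \<open>omega_pow d\<close> is related to every \<open>L' +\<^sub>o g s\<close> by the
          induction hypothesis.\<close>
        obtain u where u: "minimal u" "u \<sqsubseteq>\<^sub>1 w" by (rule minimal_pred)
        obtain d where d: "index d" "u = kappa r d" using u(1) by (rule minimal_index)
        have "w < K" using w(1) g(3) by auto
        then have "kappa r d < kappa r c" using le1_le[OF u(2)] d(2) unfolding K_def by simp
        then have dc: "d < c" using kappa_less_iff d(1) ic by blast
        obtain b1 where b1: "b1 < b" "\<And>b'. b1 < b' \<Longrightarrow> index (r *\<^sub>o b') \<Longrightarrow> S0 \<subseteq> {..<lam b'}"
        proof (cases "S0 = {}")
          case True
          have "ozero < b" unfolding b using le_oadd_right omega_pow_pos order.strict_trans2 by blast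
          then show ?thesis using that[of ozero] True by simp
        next
          case False
          have fin: "finite S0" using S(1) unfolding S0_def by simp
          have "Max S0 < lam b" using Max_in[OF fin False] unfolding S0_def L_def by simp
          then obtain b1 where "b1 < b" "\<And>b'. b1 < b' \<Longrightarrow> index (r *\<^sub>o b') \<Longrightarrow> Max S0 < lam b'"
            using less_lamE[OF ib] by blast
          then show ?thesis using that[of b1] fin False by (auto simp: Max_less_iff)
        qed
        obtain b2 where b2: "b2 < omega_pow c" "b1 \<le> b0 +\<^sub>o b2"
        proof (cases "b1 < b0")
          case True
          then show ?thesis using that[OF omega_pow_pos] by simp
        next
          case False
          then obtain b2 where "b1 = b0 +\<^sub>o b2" by (metis not_le oadd_diff_exists)
          then show ?thesis using that[of b2] b1(1) b by simp
        qed
        \<comment> \<open>This index ends in \<open>omega_pow d\<close>, exceeds \<open>b1\<close>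
          so that \<open>lam b'\<close> lies above the parameters, and stays below \<open>b\<close>
          because \<open>d < c\<close>.\<close>
        define b' where "b' = (b0 +\<^sub>o b2) +\<^sub>o omega_pow d"
        have b'b: "b' < b"
          unfolding b'_def b oadd_assoc using oadd_omega_pow_less[OF b2(1) dc] by simp
        have "b0 +\<^sub>o b2 < b'"
          unfolding b'_def using oadd_strict_mono[OF omega_pow_pos[of d], of "b0 +\<^sub>o b2"] by simp
        then have b1b': "b1 < b'" using b2(2) by simp
        have ib': "index (r *\<^sub>o b')" using index_less b'b by blast
        define L' where "L' = lam b'"
        have L': "minimal L'" "r dvd\<^sub>o L'" unfolding L'_def using ib' minimal_kappa lam_dvd by auto
        have L'L: "L' < L" unfolding L_def L'_def using lam_less_iff[OF ib' ib] b'b by simp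
        have head': "L' \<sqsubseteq>\<^sub>1 L' +\<^sub>o g s" if s: "s \<in> S1" for s
        proof -
          have "g s \<le> u \<or> u \<sqsubseteq>\<^sub>1 g s"
            using le1_interval[OF u(2) _ w(2)[OF s]] by (meson le_cases)
          then show ?thesis
            unfolding L'_def d(2) using IH[OF b'b ib' b'_def] by blast
        qed
        show "\<exists>h. cover S h \<and> (\<forall>z\<in>S. z < L \<longrightarrow> h z = z) \<and> (\<forall>z\<in>S. h z < L)"
        proof -
          define H where "H = (\<lambda>x. if x < L then x else L' +\<^sub>o g (ominus x L))"
          have H: "H (L +\<^sub>o s) = L' +\<^sub>o g s" for s
            using le_oadd[of L s] unfolding H_def by (auto simp: not_le[symmetric])
          have SS: "z \<in> S0 \<or> (\<exists>s\<in>S1. z = L +\<^sub>o s)" if "z \<in> S" for z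
          proof (cases "z < L")
            case False
            then obtain s where "z = L +\<^sub>o s" using oadd_diff_exists not_le by metis
            then show ?thesis using that unfolding S1_def by auto
          qed (use that S0_def in auto)
          have "cover (S0 \<union> (+\<^sub>o) L ` S1) H"
            unfolding H_def
          proof (rule cover_translate[OF L L'(2) S1(2) g(1)])
            show "translatable L S1"
              using L head S1(3) by (intro translatableI) auto
            show "translatable L' (g ` S1)"
              using L' head' by (intro translatableI) auto
            show "closed S0" unfolding S0_def using S(2) by (rule closed_initial)
            show "S0 \<subseteq> {..<L'}" unfolding L'_def using b1(2) b1b' ib' by blast
            show "S0 \<subseteq> {..<L}" unfolding S0_def by simp
          qed (use head' g(2) gpos in auto)
          then have "cover S H"
            using cover_subset[of "S0 \<union> (+\<^sub>o) L ` S1" H S] SS by blast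
          moreover have "H z < L" if "z \<in> S" for z
            using SS[OF that]
          proof
            assume "\<exists>s\<in>S1. z = L +\<^sub>o s"
            then obtain s where s: "s \<in> S1" "z = L +\<^sub>o s" by blast
            \<comment> \<open>The relation starting at \<open>L'\<close> cannot reach the minimal
              \<open>L\<close>.\<close>
            have "L' +\<^sub>o g s < L"
              using minimal_not_le1[OF L(1) L'L, of "L' +\<^sub>o g s"] head'[OF s(1)] by (meson not_le)
            then show ?thesis unfolding s(2) H .
          qed (simp add: S0_def H_def)
          ultimately show ?thesis by (intro exI[of _ H]) (simp add: H_def)
        qed
      qed
    qed
  qed
  \<comment> \<open>It suffices to copy each finite closed \<open>Q\<close> into \<open>K\<close>
    without fixing parameters; unbounded patterns below \<open>K\<close> restore them.\<close>
  have upper: "K \<sqsubseteq>\<^sub>1 n \<or> n \<le> K" if Ln: "L \<sqsubseteq>\<^sub>1 L +\<^sub>o n" for n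
  proof (rule disjCI)
    assume "\<not> n \<le> K"
    then have Kn: "K \<le> n" by simp
    show "K \<sqsubseteq>\<^sub>1 n"
    proof (rule patterns_unbounded_le1[OF K minimal_patterns_unbounded[OF K] Kn])
      fix Q assume Q: "finite Q" "closed Q" "Q \<subseteq> {..<n}"
      have n: "ozero < n" using \<open>\<not> n \<le> K\<close> by (auto simp: ozero_less_iff)
      define Q1 where "Q1 = {ozero} \<union> Q"
      have Q1: "finite Q1" "closed Q1" "Q1 \<subseteq> {..<n}"
        using Q n closed_Un[OF closed_multiple[OF odvd_ozero]] unfolding Q1_def by auto
      have z1: "ozero \<in> Q1" unfolding Q1_def by simp
      have lQ1: "L \<in> (+\<^sub>o) L ` Q1" using z1 image_eqI[of L "(+\<^sub>o) L" ozero Q1] by simp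
      have head: "L \<sqsubseteq>\<^sub>1 L +\<^sub>o q" if "q \<in> Q1" for q
        using le1_interval[OF Ln le_oadd] that Q1(3) by auto
      define L0 where "L0 = lam b0"
      have b0b: "b0 < b" unfolding b using oadd_strict_mono[OF omega_pow_pos[of c], of b0] by simp
      have ib0: "index (r *\<^sub>o b0)" using index_less b0b by blast
      have L0: "minimal L0" unfolding L0_def using ib0 minimal_kappa by blast
      have "L0 < L" unfolding L_def L0_def using lam_less_iff[OF ib0 ib] b0b by simp
      then obtain m where m: "L0 \<sqsubseteq>\<^sub>1 m" "\<And>x. L0 \<sqsubseteq>\<^sub>1 x \<Longrightarrow> x \<le> m" "m < L"
        using minimal_bounded[OF L0 L(1)] by blast
      obtain t e where t: "m = t +\<^sub>o e" "r dvd\<^sub>o t" "e < r" by (rule odvd_floor)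
      \<comment> \<open>The last successor \<open>m\<close> of \<open>lam b0\<close> is adjoined,
        and \<open>t\<close> for closedness. Both are fixed, so the image of \<open>L\<close> lies
        above \<open>m\<close> and its minimal predecessor above \<open>lam b0\<close>.\<close>
      define S where "S = {t, m} \<union> (+\<^sub>o) L ` Q1"
      have tL: "t < L" using m(3) t(1) le_oadd order.strict_trans1 by blast
      have "finite S" using Q1(1) unfolding S_def by simp
      moreover have cS: "closed S"
        unfolding S_def t(1) using t(2,3) L(2) Q1(2)
        by (intro closed_Un closed_floor closed_translate)
      moreover have "S \<subseteq> {..<L +\<^sub>o n}"
      proof -
        have "t < L +\<^sub>o n" "m < L +\<^sub>o n" using tL m(3) le_oadd order.strict_trans2 by blast+
        then show ?thesis using Q1(3) unfolding S_def by auto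
      qed
      ultimately obtain h where h: "cover S h" "\<And>z. z \<in> S \<Longrightarrow> z < L \<Longrightarrow> h z = z"
          "\<And>z. z \<in> S \<Longrightarrow> h z < L"
        by (rule le1E[OF Ln]) (rule that)
      have mem: "m \<in> S" "L \<in> S" "\<And>q. q \<in> Q1 \<Longrightarrow> L +\<^sub>o q \<in> S"
        using lQ1 unfolding S_def by auto
      define z where "z = h L"
      have mz: "m < z"
        using cover_less[OF h(1) mem(1,2)] h(2)[OF mem(1) m(3)] m(3) unfolding z_def by simp
      have zdvd: "r dvd\<^sub>o z" unfolding z_def using cover_odvd[OF h(1) mem(2) L(2)] .
      have zL: "z < L" unfolding z_def using h(3) mem(2) by blast
      \<comment> \<open>The image \<open>z\<close> of \<open>L\<close> need not be minimal. Its
        minimal predecessor is still related to all images by transitivity and replaces it as base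
        point.\<close>
      obtain L' where L': "minimal L'" "L' \<sqsubseteq>\<^sub>1 z" by (rule minimal_pred)
      have L'dvd: "r dvd\<^sub>o L'"
      proof -
        obtain s f where s: "L' = s +\<^sub>o f" "r dvd\<^sub>o s" "f < r" by (rule odvd_floor)
        then show ?thesis
          using le1_nonmultiple[OF s(2) _ s(3)] L'(2) zdvd by (cases "f = ozero") (auto simp: ozero_less_iff)
      qed
      obtain b' where b': "index (r *\<^sub>o b')" "L' = lam b'"
        using L'(1) L'dvd by (rule minimal_multiple_index)
      have "lam b' < lam b" using le1_le[OF L'(2)] zL b'(2) unfolding L_def by simp
      then have b'b: "b' < b" using lam_less_iff b'(1) ib by blast
      have "L0 < L'"
      proof (rule ccontr)
        assume "\<not> L0 < L'"
        then consider "L' = L0" | "L' < L0" by force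
        then show False
        proof cases
          case 1
          then show ?thesis using m(2) L'(2) mz by (meson not_le)
        next
          case 2
          have "L0 \<le> z" using le1_le[OF m(1)] mz by simp
          then show ?thesis using minimal_not_le1[OF L0 2] L'(2) by blast
        qed
      qed
      then have "b0 < b'" unfolding L0_def b'(2) using lam_less_iff ib0 b'(1) by blast
      then obtain a where a: "b' = b0 +\<^sub>o a" by (metis less_imp_le oadd_diff_exists)
      have "ozero < a" using a \<open>b0 < b'\<close> by (auto simp: ozero_less_iff)
      then obtain a' d where a': "a = a' +\<^sub>o omega_pow d" by (rule omega_pow_last_term)
      have "a < omega_pow c" using b'b unfolding a b by simp
      then have "omega_pow d < omega_pow c" using le_oadd_right[of "omega_pow d" a'] a' by simp
      then have "d < c" using omega_pow_mono by (meson not_le)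
      have kd: "kappa r d < K" unfolding K_def using kappa_less[OF ic \<open>d < c\<close>] .
      have b'd: "b' = (b0 +\<^sub>o a') +\<^sub>o omega_pow d" unfolding a a' by (simp add: oadd_assoc)
      define g where "g = (\<lambda>q. ominus (h (L +\<^sub>o q)) L')"
      have le1h: "L' \<sqsubseteq>\<^sub>1 h (L +\<^sub>o q)" if "q \<in> Q1" for q
        using cover_le1[OF h(1) mem(2) mem(3)[OF that] head[OF that]] le1_trans[OF L'(2)]
        unfolding z_def by blast
      have hg: "h (L +\<^sub>o q) = L' +\<^sub>o g q" if "q \<in> Q1" for q
        unfolding g_def using le1_le[OF le1h[OF that]] by (simp add: oadd_ominus)
      have head': "L' \<sqsubseteq>\<^sub>1 L' +\<^sub>o g q" if "q \<in> Q1" for q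
        using le1h[OF that] hg[OF that] by simp
      \<comment> \<open>By the induction hypothesis at \<open>b'\<close>, each \<open>g q\<close> is
        at most \<open>kappa r d\<close> or related from it, and no such relation reaches the
        minimal \<open>K\<close>.\<close>
      have gK: "g q < K" if "q \<in> Q1" for q
      proof -
        have "g q \<le> kappa r d \<or> kappa r d \<sqsubseteq>\<^sub>1 g q"
          using head'[OF that] IH[OF b'b b'(1) b'd] unfolding b'(2) by blast
        then show ?thesis
          using minimal_not_le1[OF K kd] kd by (meson not_le order.strict_trans1)
      qed
      have "cover Q1 g"
      proof (rule cover_untranslate[OF L(2) L'dvd Q1(2)])
        show "translatable L Q1" using L head by (rule translatableI)
        show "translatable L' (g ` Q1)" using L'(1) L'dvd head' by (intro translatableI) auto
        show "cover ((+\<^sub>o) L ` Q1) h" using h(1) by (rule cover_subset) (auto simp: S_def)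
        show "h (L +\<^sub>o q) = L' +\<^sub>o g q" if "q \<in> Q1" for q using hg that .
        show "ozero < g q" if q: "q \<in> Q1" "ozero < q" for q
        proof -
          have "L < L +\<^sub>o q" using oadd_strict_mono[OF q(2), of L] by simp
          then have "z < h (L +\<^sub>o q)"
            unfolding z_def using cover_less[OF h(1) mem(2) mem(3)[OF q(1)]] by simp
          then have "L' < L' +\<^sub>o g q" using le1_le[OF L'(2)] hg[OF q(1)] by simp
          then show ?thesis using oadd_less_iff[of L' ozero "g q"] by simp
        qed
      qed
      then have "cover Q g" by (rule cover_subset) (auto simp: Q1_def)
      then show "\<exists>h. cover Q h \<and> h ` Q \<subseteq> {..<K}"
        using gK unfolding Q1_def by (intro exI[of _ g]) auto
    qed
  qed
  show ?case
    using lower upper unfolding L_def K_def by blast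
qed

end

theorem theorem7p2:
  fixes \<rho> \<beta> :: "'o::ordinals"
  assumes "additively_indecomposable \<rho>"
    and "\<rho> *\<^sub>o omega_pow \<beta> <\<^sub>i theta1 \<rho>"
  shows "max1 \<rho> (kappa \<rho> (\<rho> *\<^sub>o omega_pow \<beta>)) =
    kappa \<rho> (\<rho> *\<^sub>o omega_pow \<beta>) +\<^sub>i max1 \<rho> (kappa \<rho> \<beta>)"
proof -
  interpret indecomposable \<rho> by standard (rule assms(1))
  define L where "L = kappa \<rho> (\<rho> *\<^sub>o omega_pow \<beta>)"
  define K where "K = kappa \<rho> \<beta>"
  \<comment> \<open>With \<open>b0 = ozero\<close>, the successors of \<open>L\<close> are the
    translates of those of \<open>K\<close> and of the ordinals up to \<open>K\<close>; the latter
    do not affect the maximum.\<close>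
  have iff: "le1 \<rho> L (L +\<^sub>o n) \<longleftrightarrow> n \<le> K \<or> le1 \<rho> K n" for n
    unfolding L_def K_def using lam_le1_iff[OF assms(2), of ozero \<beta>] by simp
  show ?thesis
  proof (cases "max1 \<rho> K")
    case (Fin m)
    note m = max1_greatest[OF Fin]
    have "le1 \<rho> L (L +\<^sub>o m)" using iff m by blast
    moreover have "b \<le> L +\<^sub>o m" if b: "le1 \<rho> L b" for b
    proof -
      obtain n where n: "b = L +\<^sub>o n" using le1_le[OF b] by (rule oadd_diff_exists)
      then have "n \<le> K \<or> le1 \<rho> K n" using b iff by blast
      moreover have "K \<le> m" using m le1_le by blast
      ultimately have "n \<le> m" using m by auto
      then show ?thesis using n by simp
    qed
    ultimately have "bdd_above {b. le1 \<rho> L b}" "(GREATEST b. le1 \<rho> L b) = L +\<^sub>o m"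
      by (auto simp: bdd_above_def intro: Greatest_equality)
    then show ?thesis
      using Fin unfolding max1_def[of \<rho> L] L_def[symmetric] K_def[symmetric] by simp
  next
    case Infty
    then have unb: "\<not> bdd_above {b. le1 \<rho> K b}" by (simp add: max1_def split: if_splits)
    have "\<not> bdd_above {b. le1 \<rho> L b}"
    proof
      assume "bdd_above {b. le1 \<rho> L b}"
      then obtain c where c: "\<And>b. le1 \<rho> L b \<Longrightarrow> b \<le> c" by (auto simp: bdd_above_def)
      \<comment> \<open>Since \<open>n \<le> L +\<^sub>o n\<close>, a bound for the successors of
        \<open>L\<close> also bounds those of \<open>K\<close>.\<close>
      have "n \<le> c" if "le1 \<rho> K n" for n
        using c[of "L +\<^sub>o n"] iff[of n] that le_oadd_right[of n L] by simp
      then show False using unb by (auto simp: bdd_above_def)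
    qed
    then show ?thesis
      using Infty unfolding max1_def[of \<rho> L] L_def[symmetric] K_def[symmetric] by simp
  qed
qed

end
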